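(* There exists an algorithm that, given a non-complete connected graph $G$ with $n$ vertices, $m$ edges and maximum degree $\Delta \geq 3$, and given a sequence $(p_1, \dots, p_s)$ of non-negative integers with $s \geq 2$ and $\sum_{i=1}^s p_i \geq \Delta - s$, outputs in time $O(n+m)$ a partition of $V(G)$ into sets $V_1, \dots, V_s$ such that for each $i \in \{1,\dots,s\}$ the induced subgraph $G[V_i]$ is $p_i$-degenerate.
   Context: A graph is $d$-degenerate if every non-empty subgraph of it contains a vertex of degree at most $d$. $G[V_i]$ denotes the subgraph of $G$ induced by $V_i$ (parts are allowed to be empty). *)

theory Defs
  imports Main "HOL-Library.Disjoint_Sets"
begin

section \<open>Finite simple graphs\<close>

definition simple_graph :: "'a set \<Rightarrow> 'a set set \<Rightarrow> bool" where
  "simple_graph V E \<longleftrightarrow> finite V \<and> (\<forall>e\<in>E. e \<subseteq> V \<and> card e = 2)"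

definition neighbours :: "'a set set \<Rightarrow> 'a \<Rightarrow> 'a set" where
  "neighbours E v = {u. {u, v} \<in> E}"

definition degree :: "'a set set \<Rightarrow> 'a \<Rightarrow> nat" where
  "degree E v = card (neighbours E v)"

definition max_degree :: "'a set \<Rightarrow> 'a set set \<Rightarrow> nat" where
  "max_degree V E = Max (degree E ` V)"

definition connected_graph :: "'a set \<Rightarrow> 'a set set \<Rightarrow> bool" where
  "connected_graph V E \<longleftrightarrow> V \<noteq> {} \<and> (\<forall>u\<in>V. \<forall>v\<in>V. (u, v) \<in> {(x, y). {x, y} \<in> E}\<^sup>*)"

definition complete_graph :: "'a set \<Rightarrow> 'a set set \<Rightarrow> bool" where
  "complete_graph V E \<longleftrightarrow> (\<forall>u\<in>V. \<forall>v\<in>V. u \<noteq> v \<longrightarrow> {u, v} \<in> E)"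

definition subgraph :: "'a set \<Rightarrow> 'a set set \<Rightarrow> 'a set \<Rightarrow> 'a set set \<Rightarrow> bool" where
  "subgraph V' E' V E \<longleftrightarrow> simple_graph V' E' \<and> V' \<subseteq> V \<and> E' \<subseteq> E"

definition induced_edges :: "'a set set \<Rightarrow> 'a set \<Rightarrow> 'a set set" where
  "induced_edges E U = {e \<in> E. e \<subseteq> U}"

definition degenerate :: "nat \<Rightarrow> 'a set \<Rightarrow> 'a set set \<Rightarrow> bool" where
  "degenerate d V E \<longleftrightarrow>
     (\<forall>V' E'. subgraph V' E' V E \<and> V' \<noteq> {} \<longrightarrow> (\<exists>v\<in>V'. degree E' v \<le> d))"


section \<open>Unit-cost random access programs\<close>

text \<open>
  The model of computation is a word RAM, given as a while language over natural-number registers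
  and random-access arrays.  The arithmetic is addition and truncated subtraction only.
  \<open>exec B P \<sigma> t \<sigma>'\<close> says that \<open>P\<close> started in \<open>\<sigma>\<close> halts in \<open>\<sigma>'\<close> after \<open>t\<close> steps, where every
  assignment and every test counts as one step; the expressions in a fixed program have constant
  size, so this is the number of elementary RAM operations up to a constant factor.  Machine words
  hold the numbers up to \<open>B\<close>: a program that stores a larger number, or writes at a larger
  address, is stuck and has no execution.
\<close>

datatype exp =
    Const nat
  | Reg string
  | Get string exp
  | Plus exp exp
  | Minus exp exp

datatype bexp =
    Less exp exp
  | Equal exp exp
  | Not bexp
  | And bexp bexp

datatype com =
    Skip
  | Assign string exp
  | Put string exp exp
  | Seq com com
  | If bexp com com
  | While bexp com

record state =
  reg :: "string \<Rightarrow> nat"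
  arr :: "string \<Rightarrow> nat \<Rightarrow> nat"

fun val :: "exp \<Rightarrow> state \<Rightarrow> nat" where
  "val (Const k) \<sigma> = k"
| "val (Reg x) \<sigma> = reg \<sigma> x"
| "val (Get a e) \<sigma> = arr \<sigma> a (val e \<sigma>)"
| "val (Plus e f) \<sigma> = val e \<sigma> + val f \<sigma>"
| "val (Minus e f) \<sigma> = val e \<sigma> - val f \<sigma>"

fun test :: "bexp \<Rightarrow> state \<Rightarrow> bool" where
  "test (Less e f) \<sigma> \<longleftrightarrow> val e \<sigma> < val f \<sigma>"
| "test (Equal e f) \<sigma> \<longleftrightarrow> val e \<sigma> = val f \<sigma>"
| "test (Not b) \<sigma> \<longleftrightarrow> \<not> test b \<sigma>"
| "test (And b b') \<sigma> \<longleftrightarrow> test b \<sigma> \<and> test b' \<sigma>"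

definition set_reg :: "string \<Rightarrow> nat \<Rightarrow> state \<Rightarrow> state" where
  "set_reg x k \<sigma> = \<sigma>\<lparr>reg := (reg \<sigma>)(x := k)\<rparr>"

definition set_arr :: "string \<Rightarrow> nat \<Rightarrow> nat \<Rightarrow> state \<Rightarrow> state" where
  "set_arr a i k \<sigma> = \<sigma>\<lparr>arr := (arr \<sigma>)(a := (arr \<sigma> a)(i := k))\<rparr>"

inductive exec :: "nat \<Rightarrow> com \<Rightarrow> state \<Rightarrow> nat \<Rightarrow> state \<Rightarrow> bool" for B :: nat where
  Skip: "exec B Skip \<sigma> 1 \<sigma>"
| Assign: "val e \<sigma> \<le> B \<Longrightarrow> exec B (Assign x e) \<sigma> 1 (set_reg x (val e \<sigma>) \<sigma>)"
| Put: "val e \<sigma> \<le> B \<Longrightarrow> val f \<sigma> \<le> B \<Longrightarrow>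
    exec B (Put a e f) \<sigma> 1 (set_arr a (val e \<sigma>) (val f \<sigma>) \<sigma>)"
| Seq: "exec B P \<sigma> t \<sigma>' \<Longrightarrow> exec B Q \<sigma>' t' \<sigma>'' \<Longrightarrow> exec B (Seq P Q) \<sigma> (t + t') \<sigma>''"
| IfTrue: "test b \<sigma> \<Longrightarrow> exec B P \<sigma> t \<sigma>' \<Longrightarrow> exec B (If b P Q) \<sigma> (t + 1) \<sigma>'"
| IfFalse: "\<not> test b \<sigma> \<Longrightarrow> exec B Q \<sigma> t \<sigma>' \<Longrightarrow> exec B (If b P Q) \<sigma> (t + 1) \<sigma>'"
| WhileFalse: "\<not> test b \<sigma> \<Longrightarrow> exec B (While b P) \<sigma> 1 \<sigma>"
| WhileTrue: "test b \<sigma> \<Longrightarrow> exec B P \<sigma> t \<sigma>' \<Longrightarrow> exec B (While b P) \<sigma>' t' \<sigma>'' \<Longrightarrow>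
    exec B (While b P) \<sigma> (t + t' + 1) \<sigma>''"

inductive_cases exec_SkipE: "exec B Skip \<sigma> t \<sigma>'"
inductive_cases exec_AssignE: "exec B (Assign x e) \<sigma> t \<sigma>'"
inductive_cases exec_PutE: "exec B (Put a e f) \<sigma> t \<sigma>'"
inductive_cases exec_SeqE: "exec B (Seq P Q) \<sigma> t \<sigma>'"
inductive_cases exec_IfE: "exec B (If b P Q) \<sigma> t \<sigma>'"
inductive_cases exec_WhileE: "exec B (While b P) \<sigma> t \<sigma>'"

lemma exec_deterministic:
  "exec B P \<sigma> t \<sigma>' \<Longrightarrow> exec B P \<sigma> u \<tau> \<Longrightarrow> u = t \<and> \<tau> = \<sigma>'"
proof (induction arbitrary: u \<tau> rule: exec.induct)
  case Skip
  then show ?case by (auto elim: exec_SkipE)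
next
  case Assign
  then show ?case by (auto elim: exec_AssignE)
next
  case Put
  then show ?case by (auto elim: exec_PutE)
next
  case (Seq P \<sigma> t \<sigma>' Q t' \<sigma>'')
  from Seq.prems show ?case by (rule exec_SeqE) (metis Seq.IH)
next
  case (IfTrue b \<sigma> P t \<sigma>' Q)
  from IfTrue.prems show ?case by (rule exec_IfE) (metis IfTrue.IH Suc_eq_plus1, metis IfTrue.hyps(1))
next
  case (IfFalse b \<sigma> Q t \<sigma>' P)
  from IfFalse.prems show ?case by (rule exec_IfE) (metis IfFalse.hyps(1), metis IfFalse.IH Suc_eq_plus1)
next
  case (WhileFalse b \<sigma> P)
  from WhileFalse.prems show ?case by (rule exec_WhileE) (simp, metis WhileFalse.hyps)
next
  case (WhileTrue b \<sigma> P t \<sigma>' t' \<sigma>'')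
  from WhileTrue.prems show ?case by (rule exec_WhileE) (metis WhileTrue.hyps(1), metis WhileTrue.IH Suc_eq_plus1)
qed


section \<open>Input and output conventions\<close>

text \<open>
  The vertices are \<open>0, \<dots>, n - 1\<close> and the graph is given by adjacency lists: the neighbours of
  \<open>v\<close> are listed, once each and in any order, in the cells of \<open>adj\<close> from \<open>off v\<close> up to and
  excluding \<open>off (v + 1)\<close>.  All memory not mentioned here has arbitrary initial contents.
\<close>

definition input :: "nat \<Rightarrow> nat set set \<Rightarrow> nat list \<Rightarrow> state \<Rightarrow> bool" where
  "input n E p \<sigma> \<longleftrightarrow>
     reg \<sigma> ''n'' = n \<and>
     arr \<sigma> ''off'' 0 = 0 \<and>
     (\<forall>v<n. arr \<sigma> ''off'' v \<le> arr \<sigma> ''off'' (Suc v) \<and>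
        bij_betw (arr \<sigma> ''adj'') {arr \<sigma> ''off'' v..<arr \<sigma> ''off'' (Suc v)} (neighbours E v)) \<and>
     reg \<sigma> ''s'' = length p \<and>
     (\<forall>i<length p. arr \<sigma> ''p'' i = p ! i)"

text \<open>
  The algorithm outputs the partition by writing the index of the part of \<open>v\<close> to cell \<open>v\<close> of the
  array \<open>part\<close>; parts are numbered from \<open>0\<close>.
\<close>

definition output_part :: "nat \<Rightarrow> state \<Rightarrow> nat \<Rightarrow> nat set" where
  "output_part n \<sigma> i = {v. v < n \<and> arr \<sigma> ''part'' v = i}"

text \<open>
  Every number occurring in the input is at most twice this quantity, so machine words of
  logarithmic length hold the numbers up to a fixed power of it.
\<close>

definition input_magnitude :: "nat \<Rightarrow> nat set set \<Rightarrow> nat list \<Rightarrow> nat" where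
  "input_magnitude n E p = n + card E + length p + sum_list p"

end

theory Submission
  imports Defs
begin

text \<open>
  Suppose all vertices but one, the hole \<open>h\<close>, are distributed over the parts.  If \<open>h\<close> has at most \<open>p ! i\<close>
  neighbours in some part \<open>i\<close>, it can join that part.  Otherwise, as the numbers \<open>p ! i + 1\<close> add up to at least
  the maximum degree, \<open>h\<close> has exactly \<open>p ! i + 1\<close> neighbours in every part \<open>i\<close>, so it may take the part of any
  neighbour \<open>u\<close>, which becomes the new hole.  Moving the hole around a cycle thus rotates the parts of the
  other vertices of the cycle.

  Extend a path greedily to a vertex \<open>l\<close> all of whose neighbours lie on it, fill the parts greedily against a
  search order that starts with this path, and move the hole along the path to \<open>l\<close>.  The neighbours of \<open>l\<close> do
  not all lie in one part.  If two successive neighbours of \<open>l\<close> on the path are not adjacent on it, a bounded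
  number of rotations along cycles through \<open>l\<close> changes what \<open>l\<close> sees, so the hole can be filled at some
  moment.  If the neighbours of \<open>l\<close> are consecutive on the path, they and \<open>l\<close> do not form a clique, because
  the graph is connected and not complete; a vertex \<open>v\<close> among them misses another one, and exchanging the parts
  of two successive vertices, exactly one of which is \<open>v\<close> or a neighbour of \<open>v\<close>, changes what \<open>v\<close> sees.  Every
  rotation takes linear time.
\<close>

section \<open>A weakest-precondition calculus with running times\<close>

text \<open>The program does not predict which rotation helps. It runs a script of at most six
  rotations, determined by the positions of the neighbours of the tip and a few colour comparisons,
  tests the hole after every move and stops moving once it is filled. \<open>tracks\<close> records
  that an unfinished run has met only jammed configurations; each script is made so that these
  contradict each other. Both contradictions count one colour in a neighbourhood before and after a
  rotation: jamming forces the count \<open>p ! i + 1\<close> twice, while the rotation changes it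
  by one. This needs different colours at two prescribed places, so one rotation is spent on
  producing them (\<open>make_diff\<close>). The gap script also needs a third neighbour of the tip,
  which a maximum degree of at least 3 provides.

  The time may depend neither on the number of parts nor on the entries of \<open>p\<close>. The
  scan for a free part stops at an index of at most the degree of the hole, and the counters are
  cleared by visiting the neighbours again, so handling a vertex costs a constant times its degree
  plus one. Each pass visits distinct vertices and is charged to \<open>dsum\<close>, at most
  \<open>2 * (n + card E)\<close>.\<close>

notation Seq (infixr ";;" 60)

text \<open>\<open>exec\<close> is deterministic, so the existence of one halting run with a good
  result is total correctness. The postcondition sees the time, so budgets compose along
  sequences.\<close>

definition wp :: "nat \<Rightarrow> com \<Rightarrow> state \<Rightarrow> (nat \<Rightarrow> state \<Rightarrow> bool) \<Rightarrow> bool" where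
  "wp B c \<sigma> Q \<longleftrightarrow> (\<exists>t \<sigma>'. exec B c \<sigma> t \<sigma>' \<and> Q t \<sigma>')"

lemma reg_set_reg [simp]: "reg (set_reg x k \<sigma>) y = (if y = x then k else reg \<sigma> y)"
  and arr_set_reg [simp]: "arr (set_reg x k \<sigma>) = arr \<sigma>"
  and reg_set_arr [simp]: "reg (set_arr a i k \<sigma>) = reg \<sigma>"
  and arr_set_arr [simp]: "arr (set_arr a i k \<sigma>) b = (if b = a then (arr \<sigma> a)(i := k) else arr \<sigma> b)"
  by (auto simp: set_reg_def set_arr_def)

lemma wp_Skip [simp]: "wp B Skip \<sigma> Q \<longleftrightarrow> Q 1 \<sigma>"
  unfolding wp_def by (auto elim!: exec_SkipE intro: exec.Skip[unfolded One_nat_def])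

lemma wp_Assign [simp]:
  "wp B (Assign x e) \<sigma> Q \<longleftrightarrow> val e \<sigma> \<le> B \<and> Q 1 (set_reg x (val e \<sigma>) \<sigma>)"
  unfolding wp_def by (auto elim!: exec_AssignE intro: exec.Assign[unfolded One_nat_def])

lemma wp_Put [simp]:
  "wp B (Put a e f) \<sigma> Q \<longleftrightarrow>
     val e \<sigma> \<le> B \<and> val f \<sigma> \<le> B \<and> Q 1 (set_arr a (val e \<sigma>) (val f \<sigma>) \<sigma>)"
  unfolding wp_def by (auto elim!: exec_PutE intro: exec.Put[unfolded One_nat_def])

lemma wp_Seq [simp]:
  "wp B (P ;; R) \<sigma> Q \<longleftrightarrow> wp B P \<sigma> (\<lambda>t \<sigma>'. wp B R \<sigma>' (\<lambda>t'. Q (t + t')))"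
  unfolding wp_def by (blast intro: exec.Seq elim: exec_SeqE)

lemma wp_If [simp]:
  "wp B (If b P R) \<sigma> Q \<longleftrightarrow> (if test b \<sigma> then wp B P \<sigma> (\<lambda>t. Q (t + 1)) else wp B R \<sigma> (\<lambda>t. Q (t + 1)))"
  unfolding wp_def by (cases "test b \<sigma>") (auto elim!: exec_IfE intro: exec.IfTrue[unfolded Suc_eq_plus1[symmetric]] exec.IfFalse[unfolded Suc_eq_plus1[symmetric]])

lemma wp_mono: "wp B c \<sigma> Q \<Longrightarrow> (\<And>t \<tau>. Q t \<tau> \<Longrightarrow> R t \<tau>) \<Longrightarrow> wp B c \<sigma> R"
  unfolding wp_def by blast

text \<open>Naming the value \<open>k\<close> lets it be simplified before it enters the state;
  later goals then carry no unevaluated expression.\<close>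

lemma wp_Assign_Seq:
  "val e \<sigma> = k \<Longrightarrow> k \<le> B \<Longrightarrow> wp B R (set_reg x k \<sigma>) (\<lambda>t. Q (1 + t)) \<Longrightarrow> wp B (Assign x e ;; R) \<sigma> Q"
  by simp

text \<open>The potential pays for every iteration, so it also bounds their number.\<close>

lemma wp_While:
  assumes "I \<sigma>"
    and step: "\<And>\<tau>. I \<tau> \<Longrightarrow> test b \<tau> \<Longrightarrow> wp B c \<tau> (\<lambda>t \<tau>'. I \<tau>' \<and> t + 1 + \<Phi> \<tau>' \<le> \<Phi> \<tau>)"
  shows "wp B (While b c) \<sigma> (\<lambda>t \<tau>. I \<tau> \<and> \<not> test b \<tau> \<and> t \<le> \<Phi> \<sigma> + 1)"
  using \<open>I \<sigma>\<close>
proof (induction "\<Phi> \<sigma>" arbitrary: \<sigma> rule: less_induct)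
  case less
  show ?case
  proof (cases "test b \<sigma>")
    case True
    from step[OF less.prems True] obtain t \<tau> where
      t: "exec B c \<sigma> t \<tau>" "I \<tau>" "t + 1 + \<Phi> \<tau> \<le> \<Phi> \<sigma>"
      unfolding wp_def by blast
    from less.hyps[OF _ t(2)] t(3) obtain t' \<tau>' where
      t': "exec B (While b c) \<tau> t' \<tau>'" "I \<tau>'" "\<not> test b \<tau>'" "t' \<le> \<Phi> \<tau> + 1"
      unfolding wp_def by auto
    have "exec B (While b c) \<sigma> (t + t' + 1) \<tau>'"
      using exec.WhileTrue[OF True t(1) t'(1)] .
    moreover have "t + t' + 1 \<le> \<Phi> \<sigma> + 1" using t(3) t'(4) by linarith
    ultimately show ?thesis unfolding wp_def using t'(2,3) by blast
  next
    case False
    then show ?thesis unfolding wp_def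
      using exec.WhileFalse[OF False] less.prems by fastforce
  qed
qed

fun wregs :: "com \<Rightarrow> string set" where
  "wregs Skip = {}"
| "wregs (Assign x e) = {x}"
| "wregs (Put a e f) = {}"
| "wregs (P ;; R) = wregs P \<union> wregs R"
| "wregs (If b P R) = wregs P \<union> wregs R"
| "wregs (While b P) = wregs P"

fun warrs :: "com \<Rightarrow> string set" where
  "warrs Skip = {}"
| "warrs (Assign x e) = {}"
| "warrs (Put a e f) = {a}"
| "warrs (P ;; R) = warrs P \<union> warrs R"
| "warrs (If b P R) = warrs P \<union> warrs R"
| "warrs (While b P) = warrs P"

text \<open>A syntactic bound on the effect of a command. Loop invariants then speak only of what
  changes, and the rest is recovered from \<open>frame\<close>.\<close>

definition frame :: "com \<Rightarrow> state \<Rightarrow> state \<Rightarrow> bool" where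
  "frame c \<sigma> \<tau> \<longleftrightarrow> (\<forall>x. x \<notin> wregs c \<longrightarrow> reg \<tau> x = reg \<sigma> x) \<and> (\<forall>a. a \<notin> warrs c \<longrightarrow> arr \<tau> a = arr \<sigma> a)"

lemma exec_frame: "exec B c \<sigma> t \<tau> \<Longrightarrow> frame c \<sigma> \<tau>"
  by (induction rule: exec.induct) (auto simp: frame_def)

lemma wp_frame: "wp B c \<sigma> Q \<Longrightarrow> wp B c \<sigma> (\<lambda>t \<tau>. Q t \<tau> \<and> frame c \<sigma> \<tau>)"
  unfolding wp_def using exec_frame by blast

lemma wp_mono_frame:
  "wp B c \<sigma> Q \<Longrightarrow> (\<And>t \<tau>. Q t \<tau> \<Longrightarrow> frame c \<sigma> \<tau> \<Longrightarrow> R t \<tau>) \<Longrightarrow> wp B c \<sigma> R"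
  by (rule wp_mono[OF wp_frame]) auto

definition for_range :: "string \<Rightarrow> exp \<Rightarrow> exp \<Rightarrow> com \<Rightarrow> com" where
  "for_range x e f c = Assign x e ;; While (Less (Reg x) f) (c ;; Assign x (Plus (Reg x) (Const 1)))"

lemma wregs_for_range [simp]: "wregs (for_range x e f c) = insert x (wregs c)"
  and warrs_for_range [simp]: "warrs (for_range x e f c) = warrs c"
  by (auto simp: for_range_def)

text \<open>The invariant takes the counter as a parameter, so it must survive overwriting the
  register \<open>x\<close> (\<open>ins\<close>). The limit \<open>f\<close> is evaluated anew in
  each round and only has to keep its value in states framed by the loop. Each round pays 2 beyond
  \<open>T i\<close>, for increment and test.\<close>

lemma wp_for_range:
  assumes x: "x \<notin> wregs c" and le: "val e \<sigma> \<le> m" "m \<le> B"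
    and f: "\<And>\<tau>. frame (for_range x e f c) \<sigma> \<tau> \<Longrightarrow> val f \<tau> = m"
    and ins: "\<And>i j \<tau>. I i \<tau> \<Longrightarrow> I i (set_reg x j \<tau>)"
    and init: "I (val e \<sigma>) \<sigma>"
    and step: "\<And>i \<tau>. val e \<sigma> \<le> i \<Longrightarrow> i < m \<Longrightarrow> I i \<tau> \<Longrightarrow> reg \<tau> x = i \<Longrightarrow>
       frame (for_range x e f c) \<sigma> \<tau> \<Longrightarrow> wp B c \<tau> (\<lambda>t \<tau>'. I (Suc i) \<tau>' \<and> t \<le> T i)"
  shows "wp B (for_range x e f c) \<sigma> (\<lambda>t \<tau>. I m \<tau> \<and> t \<le> (\<Sum>i = val e \<sigma>..<m. T i + 2) + 2)"
proof -
  let ?P = "for_range x e f c"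
  let ?b = "Less (Reg x) f" and ?c = "c ;; Assign x (Plus (Reg x) (Const 1))"
  let ?I = "\<lambda>\<tau>. val e \<sigma> \<le> reg \<tau> x \<and> reg \<tau> x \<le> m \<and> I (reg \<tau> x) \<tau> \<and> frame ?P \<sigma> \<tau>"
  let ?F = "\<lambda>\<tau>. \<Sum>i = reg \<tau> x..<m. T i + 2"
  let ?\<sigma> = "set_reg x (val e \<sigma>) \<sigma>"
  have "wp B (While ?b ?c) ?\<sigma> (\<lambda>t \<tau>. ?I \<tau> \<and> \<not> test ?b \<tau> \<and> t \<le> ?F ?\<sigma> + 1)"
  proof (rule wp_While)
    show "?I ?\<sigma>" using le init ins by (auto simp: frame_def)
  next
    fix \<tau> assume I: "?I \<tau>" and "test ?b \<tau>"
    hence lt: "reg \<tau> x < m" using f by auto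
    have "wp B c \<tau> (\<lambda>t \<tau>'. I (Suc (reg \<tau> x)) \<tau>' \<and> t \<le> T (reg \<tau> x))"
      using step[of "reg \<tau> x" \<tau>] I lt by auto
    from wp_frame[OF this]
    show "wp B ?c \<tau> (\<lambda>t \<tau>'. ?I \<tau>' \<and> t + 1 + ?F \<tau>' \<le> ?F \<tau>)"
      unfolding wp_Seq
    proof (rule wp_mono)
      fix t \<tau>' assume a: "(I (Suc (reg \<tau> x)) \<tau>' \<and> t \<le> T (reg \<tau> x)) \<and> frame c \<tau> \<tau>'"
      hence r: "reg \<tau>' x = reg \<tau> x" using x by (auto simp: frame_def)
      have "(\<Sum>i = reg \<tau> x..<m. T i + 2) = T (reg \<tau> x) + 2 + (\<Sum>i = Suc (reg \<tau> x)..<m. T i + 2)"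
        using lt by (simp add: sum.atLeast_Suc_lessThan)
      then show "wp B (Assign x (Plus (Reg x) (Const 1))) \<tau>'
         (\<lambda>t' \<tau>''. ?I \<tau>'' \<and> t + t' + 1 + ?F \<tau>'' \<le> ?F \<tau>)"
        using a I lt le r ins by (auto simp: frame_def)
    qed
  qed
  then show ?thesis
    unfolding for_range_def wp_Seq wp_Assign
    using le f by (auto simp: for_range_def elim!: wp_mono)
qed

section \<open>Partial partitions and moves of the hole\<close>

locale partition_problem =
  fixes n :: nat and E :: "nat set set" and p :: "nat list"
  assumes simple: "simple_graph {..<n} E"
    and conn: "connected_graph {..<n} E"
    and not_complete: "\<not> complete_graph {..<n} E"
    and max_degree_ge: "max_degree {..<n} E \<ge> 3"
    and two_parts: "length p \<ge> 2"
    and sum_ge: "int (sum_list p) \<ge> int (max_degree {..<n} E) - int (length p)"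
begin

section \<open>Neighbourhoods, degrees and the cost of visiting vertices\<close>

definition nb :: "nat \<Rightarrow> nat set" where "nb v = neighbours E v"

definition deg :: "nat \<Rightarrow> nat" where "deg v = card (nb v)"

definition \<Delta> :: nat where "\<Delta> = max_degree {..<n} E"

lemma nb_sym: "u \<in> nb v \<longleftrightarrow> v \<in> nb u"
  by (simp add: nb_def neighbours_def insert_commute)

lemma nb_less: "u \<in> nb v \<Longrightarrow> u < n"
  using simple by (auto simp: nb_def neighbours_def simple_graph_def)

lemma nb_irrefl: "v \<notin> nb v"
  using simple by (auto simp: nb_def neighbours_def simple_graph_def)

lemma nb_subset: "nb v \<subseteq> {..<n}"
  using nb_less by blast

lemma finite_nb [simp]: "finite (nb v)"
  using nb_subset finite_subset by blast

lemma deg_less: "v < n \<Longrightarrow> deg v < n"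
proof -
  assume "v < n"
  then have "nb v \<subset> {..<n}" using nb_subset nb_irrefl by blast
  from psubset_card_mono[OF _ this] show ?thesis by (simp add: deg_def)
qed

lemma deg_le: "v < n \<Longrightarrow> deg v \<le> \<Delta>"
  unfolding \<Delta>_def max_degree_def deg_def nb_def
  by (rule Max_ge) (auto simp: degree_def)

lemma Delta_ge: "\<Delta> \<ge> 3" using max_degree_ge by (simp add: \<Delta>_def)

lemma n_ge: "n \<ge> 4"
proof -
  have "n \<noteq> 0" using conn by (auto simp: connected_graph_def)
  then have "Max (degree E ` {..<n}) \<in> degree E ` {..<n}" by (intro Max_in) auto
  then obtain v where "v < n" "\<Delta> = deg v"
    by (auto simp: \<Delta>_def max_degree_def degree_def deg_def nb_def)
  then show ?thesis using deg_less[of v] Delta_ge by simp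
qed

lemma Delta_le_sum: "\<Delta> \<le> (\<Sum>i<length p. p ! i + 1)"
proof -
  have "(\<Sum>i<length p. p ! i + 1) = sum_list p + length p"
    by (simp only: sum.distrib sum_list_sum_nth atLeast0LessThan) simp
  then show ?thesis using sum_ge by (simp add: \<Delta>_def)
qed

text \<open>The working form of connectedness: it shows that the search reaches every vertex, and
  that a block of path vertices without outside neighbours is the whole graph.\<close>

lemma nb_closed_set:
  assumes "S \<noteq> {}" "S \<subseteq> {..<n}" "\<And>u v. u \<in> S \<Longrightarrow> v \<in> nb u \<Longrightarrow> v \<in> S"
  shows "S = {..<n}"
proof -
  obtain u where u: "u \<in> S" using assms(1) by blast
  have "v \<in> S" if "(u, v) \<in> {(x, y). {x, y} \<in> E}\<^sup>*" for v
    using that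
  proof (induction rule: rtrancl_induct)
    case (step y z)
    then show ?case using assms(3)[of y z] by (auto simp: nb_def neighbours_def insert_commute)
  qed (use u in simp)
  then show ?thesis using conn u assms(2) unfolding connected_graph_def by blast
qed

text \<open>Double counting: mapping the pairs of a vertex and a neighbour to their edges, each edge
  is hit at most twice.\<close>

lemma sum_deg_le: "(\<Sum>v<n. deg v) \<le> 2 * card E"
proof -
  let ?A = "SIGMA v:{..<n}. nb v"
  let ?f = "\<lambda>(v, u). {u, v}"
  have finE: "finite E"
    using simple by (auto simp: simple_graph_def intro: finite_subset[of E "Pow {..<n}"])
  have fib: "card {a \<in> ?A. ?f a = e} \<le> 2" if e: "e \<in> E" for e
  proof -
    have "card e = 2" using e simple by (simp add: simple_graph_def)
    then obtain x y where xy: "e = {x, y}" by (meson card_2_iff)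
    have "a \<in> {(x, y), (y, x)}" if "?f a = e" for a
    proof -
      obtain v u where a: "a = (v, u)" by (cases a)
      then have "{u, v} = {x, y}" using that unfolding xy by (simp only: prod.case)
      then have "u = x \<and> v = y \<or> u = y \<and> v = x" by (rule doubleton_eq_iff[THEN iffD1])
      then show ?thesis unfolding a by blast
    qed
    then have "{a \<in> ?A. ?f a = e} \<subseteq> {(x, y), (y, x)}" by blast
    then have "card {a \<in> ?A. ?f a = e} \<le> card {(x, y), (y, x)}" by (rule card_mono[rotated]) simp
    also have "\<dots> \<le> 2" by (cases "x = y") auto
    finally show ?thesis .
  qed
  have "(\<Sum>v<n. deg v) = card ?A" by (simp add: deg_def)
  also have "?A = (\<Union>e\<in>E. {a \<in> ?A. ?f a = e})" by (auto simp: nb_def neighbours_def)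
  also have "card \<dots> \<le> (\<Sum>e\<in>E. card {a \<in> ?A. ?f a = e})" by (rule card_UN_le[OF finE])
  also have "\<dots> \<le> (\<Sum>e\<in>E. 2)" by (rule sum_mono) (rule fib)
  finally show ?thesis by simp
qed

text \<open>The unit of all time bounds: visiting \<open>v\<close> and scanning its adjacency list
  costs a constant times \<open>deg v + 1\<close>.\<close>

definition dsum :: "nat set \<Rightarrow> nat" where "dsum S = (\<Sum>v\<in>S. deg v + 1)"

lemma dsum_V: "dsum {..<n} \<le> 2 * (n + card E)"
  using sum_deg_le by (simp add: dsum_def sum.distrib sum_Suc)

lemma dsum_mono: "S \<subseteq> {..<n} \<Longrightarrow> dsum S \<le> dsum {..<n}"
  unfolding dsum_def by (rule sum_mono2) auto

lemma dsum_remove: "finite S \<Longrightarrow> v \<in> S \<Longrightarrow> dsum S = deg v + 1 + dsum (S - {v})"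
  unfolding dsum_def by (rule sum.remove)

section \<open>Degeneracy of vertex sets\<close>

definition degen :: "nat \<Rightarrow> nat set \<Rightarrow> bool" where
  "degen d S \<longleftrightarrow> (\<forall>T\<subseteq>S. T \<noteq> {} \<longrightarrow> (\<exists>v\<in>T. card (nb v \<inter> T) \<le> d))"

lemma degen_empty [simp]: "degen d {}" by (auto simp: degen_def)

lemma degen_mono: "degen d S \<Longrightarrow> T \<subseteq> S \<Longrightarrow> degen d T" unfolding degen_def by blast

text \<open>A subset containing \<open>h\<close> has \<open>h\<close> itself as its vertex of small
  degree; any other subset already lies in \<open>S\<close>.\<close>

lemma degen_insert:
  assumes "degen d S" "card (nb h \<inter> S) \<le> d"
  shows "degen d (insert h S)"
  unfolding degen_def
proof (intro allI impI)
  fix T assume T: "T \<subseteq> insert h S" "T \<noteq> {}"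
  show "\<exists>v\<in>T. card (nb v \<inter> T) \<le> d"
  proof (cases "h \<in> T")
    case True
    have "nb h \<inter> T \<subseteq> nb h \<inter> S" using T nb_irrefl by blast
    then have "card (nb h \<inter> T) \<le> card (nb h \<inter> S)" by (intro card_mono) auto
    then have "card (nb h \<inter> T) \<le> d" using assms(2) by linarith
    with True show ?thesis by blast
  next
    case False
    then have "T \<subseteq> S" using T by blast
    then show ?thesis using assms(1) T unfolding degen_def by blast
  qed
qed

text \<open>Dropping edges only lowers degrees, so it is enough to test vertex sets, as
  \<open>degen\<close> does.\<close>

lemma degenerate_induced:
  assumes "degen d S"
  shows "degenerate d S (induced_edges E S)"
  unfolding degenerate_def
proof (intro allI impI)
  fix V' E' assume a: "subgraph V' E' S (induced_edges E S) \<and> V' \<noteq> {}"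
  then obtain v where v: "v \<in> V'" "card (nb v \<inter> V') \<le> d"
    using assms unfolding degen_def subgraph_def by blast
  have "neighbours E' v \<subseteq> nb v \<inter> V'"
    using a by (auto simp: neighbours_def nb_def subgraph_def simple_graph_def induced_edges_def)
  then have "degree E' v \<le> card (nb v \<inter> V')"
    unfolding degree_def by (intro card_mono) auto
  then show "\<exists>v\<in>V'. degree E' v \<le> d" using v by (meson le_trans)
qed

text \<open>
  Uncoloured vertices carry the value \<open>n\<close>, which may also be the index of a part; the coloured set
  is therefore passed explicitly.
\<close>

definition partial :: "(nat \<Rightarrow> nat) \<Rightarrow> nat set \<Rightarrow> bool" where
  "partial x U \<longleftrightarrow> U \<subseteq> {..<n} \<and> (\<forall>v\<in>U. x v < length p \<and> x v < n) \<and>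
     (\<forall>v<n. v \<notin> U \<longrightarrow> x v = n) \<and> (\<forall>i<length p. degen (p ! i) {v \<in> U. x v = i})"

section \<open>Colour counts and stuck vertices\<close>

definition cnt :: "(nat \<Rightarrow> nat) \<Rightarrow> nat \<Rightarrow> nat \<Rightarrow> nat" where
  "cnt x h i = card {u \<in> nb h. x u = i}"

lemma partial_insert:
  assumes x: "partial x U" and h: "h < n" "h \<notin> U" and i: "i < length p" "i < n" "cnt x h i \<le> p ! i"
  shows "partial (x(h := i)) (insert h U)"
proof -
  have "degen (p ! j) {v \<in> insert h U. (x(h := i)) v = j}" if j: "j < length p" for j
  proof (cases "j = i")
    case True
    have eq: "{v \<in> insert h U. (x(h := i)) v = j} = insert h {v \<in> U. x v = i}" using True h by auto
    have "nb h \<inter> {v \<in> U. x v = i} \<subseteq> {u \<in> nb h. x u = i}" by auto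
    then have "card (nb h \<inter> {v \<in> U. x v = i}) \<le> p ! i"
      using i(3) card_mono[of "{u \<in> nb h. x u = i}" "nb h \<inter> {v \<in> U. x v = i}"] unfolding cnt_def by simp
    then show ?thesis unfolding eq using x True j by (intro degen_insert) (auto simp: partial_def)
  next
    case False
    have "{v \<in> insert h U. (x(h := i)) v = j} = {v \<in> U. x v = j}" using False h by auto
    then show ?thesis using x j by (simp add: partial_def)
  qed
  then show ?thesis using x h i by (auto simp: partial_def)
qed

definition stuck :: "(nat \<Rightarrow> nat) \<Rightarrow> nat \<Rightarrow> bool" where
  "stuck x h \<longleftrightarrow> (\<forall>i<length p. p ! i < cnt x h i)"

lemma sum_cnt_le:
  assumes "k \<le> n"
  shows "(\<Sum>i<k. cnt x h i) \<le> card {u \<in> nb h. x u \<noteq> n}"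
proof -
  have "(\<Sum>i<k. cnt x h i) = card (\<Union>i<k. {u \<in> nb h. x u = i})"
    unfolding cnt_def by (subst card_UN_disjoint) auto
  also have "\<dots> \<le> card {u \<in> nb h. x u \<noteq> n}" using assms by (intro card_mono) auto
  finally show ?thesis .
qed

text \<open>Seeing the \<open>i\<close> colours below \<open>i\<close> takes at least
  \<open>i\<close> neighbours. This bounds the scan for a free part by the degree, however many
  parts there are.\<close>

lemma cnt_pos_le_deg:
  assumes "\<And>j. j < i \<Longrightarrow> cnt x h j > 0"
  shows "i \<le> deg h"
proof -
  have "{..<i} \<subseteq> x ` nb h"
  proof
    fix j assume "j \<in> {..<i}"
    then have "{u \<in> nb h. x u = j} \<noteq> {}" using assms[of j] by (auto simp: cnt_def card_gt_0_iff)
    then show "j \<in> x ` nb h" by blast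
  qed
  then have "card {..<i} \<le> card (x ` nb h)" by (intro card_mono) auto
  also have "\<dots> \<le> deg h" unfolding deg_def by (rule card_image_le) simp
  finally show ?thesis by simp
qed

text \<open>A stuck vertex sees every part, so there are fewer parts than vertices, and the value
  \<open>n\<close> of uncoloured vertices is not the index of a part.\<close>

lemma stuck_length: "stuck x h \<Longrightarrow> h < n \<Longrightarrow> length p < n"
  using cnt_pos_le_deg[of "length p" x h] deg_less[of h] by (force simp: stuck_def)

text \<open>An uncoloured neighbour is one unit of slack in the count; this is why filling against
  the search order never fails.\<close>

lemma not_stuck_uncoloured:
  assumes "h < n" "u \<in> nb h" "x u = n"
  shows "\<not> stuck x h"
proof
  assume s: "stuck x h"
  have "(\<Sum>i<length p. p ! i + 1) \<le> (\<Sum>i<length p. cnt x h i)"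
    by (rule sum_mono) (use s in \<open>auto simp: stuck_def Suc_le_eq\<close>)
  also have "\<dots> \<le> card {u \<in> nb h. x u \<noteq> n}" using stuck_length[OF s assms(1)] by (intro sum_cnt_le) simp
  also have "\<dots> < deg h" unfolding deg_def by (rule psubset_card_mono) (use assms in auto)
  finally show False using Delta_le_sum deg_le[OF assms(1)] by simp
qed

text \<open>A stuck vertex has no slack at all, because the numbers \<open>p ! i + 1\<close> add up to at least its degree.\<close>

lemma stuck_tight:
  assumes s: "stuck x h" and h: "h < n"
  shows stuck_cnt: "\<And>i. i < length p \<Longrightarrow> cnt x h i = p ! i + 1"
    and stuck_deg: "deg h = \<Delta>"
    and stuck_coloured: "\<And>u. u \<in> nb h \<Longrightarrow> x u \<noteq> n"
proof -
  have le: "p ! i + 1 \<le> cnt x h i" if "i < length p" for i using s that by (auto simp: stuck_def Suc_le_eq)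
  have 1: "(\<Sum>i<length p. p ! i + 1) \<le> (\<Sum>i<length p. cnt x h i)" by (rule sum_mono) (use le in auto)
  have "(\<Sum>i<length p. cnt x h i) \<le> card {u \<in> nb h. x u \<noteq> n}"
    using stuck_length[OF s h] by (intro sum_cnt_le) simp
  also have "\<dots> \<le> deg h" unfolding deg_def by (rule card_mono) auto
  finally have 2: "(\<Sum>i<length p. cnt x h i) \<le> deg h" .
  show "deg h = \<Delta>" using 1 2 Delta_le_sum deg_le[OF h] by linarith
  show "x u \<noteq> n" if "u \<in> nb h" for u using not_stuck_uncoloured[OF h that] s by blast
  show "cnt x h i = p ! i + 1" if i: "i < length p" for i
  proof (rule ccontr)
    \<comment> \<open>A surplus in one part is not offset elsewhere, so the counts would add up to
      more than the degree.\<close>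
    assume "cnt x h i \<noteq> p ! i + 1"
    then have "p ! i + 1 < cnt x h i" using le[OF i] by simp
    then have "(\<Sum>i<length p. p ! i + 1) < (\<Sum>i<length p. cnt x h i)"
      by (intro sum_strict_mono_ex1) (use le i in auto)
    then show False using 2 Delta_le_sum deg_le[OF h] by linarith
  qed
qed

text \<open>Here the second part is needed: some part other than \<open>c\<close> exists, and a
  stuck vertex has \<open>p ! i + 1\<close>, hence at least one, neighbours in it.\<close>

lemma stuck_not_mono:
  assumes "stuck x h" "h < n"
  shows "\<exists>u\<in>nb h. x u \<noteq> c"
proof -
  obtain i where i: "i < length p" "i \<noteq> c"
    using two_parts by (cases "c = 0") (auto intro: that[of 1] that[of 0])
  then have "cnt x h i > 0" using stuck_cnt[OF assms, of i] by simp
  then have "{u \<in> nb h. x u = i} \<noteq> {}" by (auto simp: cnt_def card_gt_0_iff)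
  then show ?thesis using i by blast
qed

section \<open>The hole and its moves along paths and cycles\<close>

definition hole :: "(nat \<Rightarrow> nat) \<times> nat \<Rightarrow> bool" where
  "hole st \<longleftrightarrow> snd st < n \<and> partial (fst st) ({..<n} - {snd st})"

text \<open>Jamming is both the reason to move the hole and, through \<open>stuck_cnt\<close>, the
  reason why moving it is legal.\<close>

definition jam :: "(nat \<Rightarrow> nat) \<times> nat \<Rightarrow> bool" where
  "jam st \<longleftrightarrow> hole st \<and> stuck (fst st) (snd st)"

fun mv :: "(nat \<Rightarrow> nat) \<times> nat \<Rightarrow> nat \<Rightarrow> (nat \<Rightarrow> nat) \<times> nat" where
  "mv (x, h) v = (x(h := x v, v := n), v)"

text \<open>Taking \<open>v\<close> out of its part \<open>i\<close> lowers the count seen by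
  \<open>h\<close> from exactly \<open>p ! i + 1\<close> to \<open>p ! i\<close>, so
  \<open>h\<close> may join that part.\<close>

lemma hole_mv:
  assumes j: "jam (x, h)" and v: "v \<in> nb h"
  shows "hole (mv (x, h) v)"
proof -
  have h: "h < n" and P: "partial x ({..<n} - {h})" and s: "stuck x h"
    using j by (auto simp: jam_def hole_def)
  have vh: "v \<noteq> h" "v < n" using v nb_irrefl nb_less by auto
  let ?x = "x(v := n)" and ?U = "{..<n} - {h} - {v}"
  have P1: "partial ?x ?U"
  proof -
    have "degen (p ! i) {u \<in> ?U. ?x u = i}" if "i < length p" for i
    proof -
      have "degen (p ! i) {u \<in> {..<n} - {h}. x u = i}" using P that by (simp add: partial_def)
      then show ?thesis by (rule degen_mono) auto
    qed
    then show ?thesis using P by (auto simp: partial_def)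
  qed
  let ?i = "x v"
  have i: "?i < length p" "?i < n" using P vh by (auto simp: partial_def)
  have "{u \<in> nb h. ?x u = ?i} = {u \<in> nb h. x u = ?i} - {v}" using i by auto
  then have "cnt ?x h ?i = cnt x h ?i - 1" using v by (simp add: cnt_def)
  then have "cnt ?x h ?i \<le> p ! ?i" using stuck_cnt[OF s h i(1)] by simp
  from partial_insert[OF P1 h _ i this]
  have "partial (?x(h := ?i)) (insert h ?U)" by simp
  moreover have "insert h ?U = {..<n} - {v}" using h vh by auto
  moreover have "?x(h := ?i) = x(h := x v, v := n)" using vh by (auto simp: fun_upd_twist)
  ultimately show ?thesis using vh by (simp add: hole_def)
qed

lemma snd_foldl_mv: "vs \<noteq> [] \<Longrightarrow> snd (foldl mv st vs) = last vs"
proof (induction vs rule: rev_induct)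
  case (snoc v vs)
  then show ?case by (cases "foldl mv st vs") simp
qed simp

text \<open>Each vertex of the path inherits the colour of its successor. This is a fact about
  functions alone; neither adjacency nor jamming enters.\<close>

lemma foldl_mv_path:
  assumes "distinct (h # vs)"
  shows "(\<forall>i<length vs. fst (foldl mv (x, h) vs) ((h # vs) ! i) = x (vs ! i)) \<and>
    (\<forall>u. u \<notin> set (h # vs) \<longrightarrow> fst (foldl mv (x, h) vs) u = x u)"
  using assms
proof (induction vs arbitrary: h x)
  case (Cons v vs)
  define y where "y = x(h := x v, v := n)"
  have IH: "(\<forall>i<length vs. fst (foldl mv (y, v) vs) ((v # vs) ! i) = y (vs ! i)) \<and>
    (\<forall>u. u \<notin> set (v # vs) \<longrightarrow> fst (foldl mv (y, v) vs) u = y u)"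
    by (rule Cons.IH) (use Cons.prems in simp)
  have st: "foldl mv (x, h) (v # vs) = foldl mv (y, v) vs" by (simp add: y_def)
  have "fst (foldl mv (y, v) vs) ((h # v # vs) ! i) = x ((v # vs) ! i)" if i: "i < length (v # vs)" for i
  proof (cases i)
    case 0
    have "h \<notin> set (v # vs)" using Cons.prems by auto
    then have "fst (foldl mv (y, v) vs) h = y h" using IH by blast
    then show ?thesis using 0 Cons.prems by (simp add: y_def)
  next
    case (Suc k)
    have "fst (foldl mv (y, v) vs) ((v # vs) ! k) = y (vs ! k)" using IH i Suc by simp
    moreover have "vs ! k \<noteq> h" "vs ! k \<noteq> v" using Cons.prems i Suc by auto
    ultimately show ?thesis using Suc by (simp add: y_def)
  qed
  moreover have "fst (foldl mv (y, v) vs) u = x u" if "u \<notin> set (h # v # vs)" for u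
    using IH that by (simp add: y_def)
  ultimately show ?case unfolding st by blast
qed simp

text \<open>The colour of \<open>hd vs\<close> is first parked on \<open>h\<close> and, when the
  hole comes back, handed on to \<open>last vs\<close>; this closes the rotation.\<close>

lemma foldl_mv_cycle:
  assumes d: "distinct (h # vs)" and ne: "vs \<noteq> []" and xh: "x h = n"
  defines "x' \<equiv> fst (foldl mv (x, h) (vs @ [h]))"
  shows "\<And>i. i < length vs - 1 \<Longrightarrow> x' (vs ! i) = x (vs ! Suc i)"
    and "x' (last vs) = x (hd vs)"
    and "x' h = n"
    and "\<And>u. u \<notin> set vs \<Longrightarrow> x' u = x u"
    and "foldl mv (x, h) (vs @ [h]) = (x', h)"
proof -
  let ?y = "fst (foldl mv (x, h) vs)"
  have st: "foldl mv (x, h) vs = (?y, last vs)" using snd_foldl_mv[OF ne] by (metis prod.collapse)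
  have st': "foldl mv (x, h) (vs @ [h]) = (?y(last vs := ?y h, h := n), h)"
    by (simp only: foldl_append foldl.simps) (subst st, rule mv.simps)
  have x': "x' = ?y(last vs := ?y h, h := n)" unfolding x'_def st' by (rule fst_conv)
  have yh: "?y h = x (hd vs)" using conjunct1[OF foldl_mv_path[OF d, of x], rule_format, of 0] ne by (simp add: hd_conv_nth)
  have lh: "last vs \<noteq> h" using d ne by auto
  show "x' (last vs) = x (hd vs)" using x' yh lh by simp
  show "x' h = n" using x' by simp
  show "x' (vs ! i) = x (vs ! Suc i)" if i: "i < length vs - 1" for i
  proof -
    have "vs ! i \<noteq> last vs" using i d ne by (simp add: last_conv_nth nth_eq_iff_index_eq)
    moreover have "vs ! i \<noteq> h" using i d by (auto simp: in_set_conv_nth)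
    moreover have "?y (vs ! i) = x (vs ! Suc i)" using conjunct1[OF foldl_mv_path[OF d, of x], rule_format, of "Suc i"] i by simp
    ultimately show ?thesis using x' by simp
  qed
  show "x' u = x u" if u: "u \<notin> set vs" for u
  proof (cases "u = h")
    case False
    then have "u \<noteq> last vs" "?y u = x u" using u ne foldl_mv_path[OF d, of x] by auto
    then show ?thesis using x' False by simp
  qed (use x' xh in simp)
  show "foldl mv (x, h) (vs @ [h]) = (x', h)"
    unfolding x' by (rule st')
qed

end

section \<open>Moving the hole on the machine\<close>

definition for_nbr :: "string \<Rightarrow> com \<Rightarrow> com" where
  "for_nbr x c = Assign ''k'' (Get ''off'' (Reg x)) ;;
     While (Less (Reg ''k'') (Get ''off'' (Plus (Reg x) (Const 1))))
       (c ;; Assign ''k'' (Plus (Reg ''k'') (Const 1)))"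

lemma wregs_for_nbr [simp]: "wregs (for_nbr x c) = insert ''k'' (wregs c)"
  and warrs_for_nbr [simp]: "warrs (for_nbr x c) = warrs c"
  by (auto simp: for_nbr_def)

text \<open>The counters are cleared by a second pass over the neighbours instead of over the whole
  array, which keeps the cost proportional to the degree of the hole.\<close>

definition try_hole :: com where
  "try_hole =
     for_nbr ''h'' (Assign ''c'' (Get ''part'' (Get ''adj'' (Reg ''k''))) ;;
       Put ''cnt'' (Reg ''c'') (Plus (Get ''cnt'' (Reg ''c'')) (Const 1))) ;;
     Assign ''i'' (Const 0) ;;
     While (And (Less (Reg ''i'') (Reg ''s'')) (Less (Get ''p'' (Reg ''i'')) (Get ''cnt'' (Reg ''i''))))
       (Assign ''i'' (Plus (Reg ''i'') (Const 1))) ;;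
     for_nbr ''h'' (Put ''cnt'' (Get ''part'' (Get ''adj'' (Reg ''k''))) (Const 0)) ;;
     If (Less (Reg ''i'') (Reg ''s''))
       (Put ''part'' (Reg ''h'') (Reg ''i'') ;; Assign ''done'' (Const 1))
       (Assign ''done'' (Const 0))"

lemma wregs_try_hole [simp]: "wregs try_hole = {''k'', ''c'', ''i'', ''done''}"
  and warrs_try_hole [simp]: "warrs try_hole = {''cnt'', ''part''}"
  by (auto simp: try_hole_def)

definition step_hole :: com where
  "step_hole = Put ''part'' (Reg ''h'') (Get ''part'' (Reg ''v'')) ;;
     Put ''part'' (Reg ''v'') (Reg ''n'') ;; Assign ''h'' (Reg ''v'') ;; try_hole"

lemma wregs_step_hole [simp]: "wregs step_hole = {''h'', ''k'', ''c'', ''i'', ''done''}"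
  and warrs_step_hole [simp]: "warrs step_hole = {''cnt'', ''part''}"
  by (auto simp: step_hole_def)

text \<open>The index \<open>wj\<close> has to be visited too, and the walk may descend to 0, where
  truncated subtraction gives no index below the end; therefore a flag \<open>fin\<close>, set after
  the last visit, ends the loop. A walk entered with the hole already filled makes no move.\<close>

definition walk :: "exp \<Rightarrow> exp \<Rightarrow> com" where
  "walk e f = Assign ''wi'' e ;; Assign ''wj'' f ;; Assign ''fin'' (Const 0) ;;
     While (And (Equal (Reg ''done'') (Const 0)) (Equal (Reg ''fin'') (Const 0)))
       (Assign ''v'' (Get ''ord'' (Reg ''wi'')) ;; step_hole ;;
        If (Equal (Reg ''wi'') (Reg ''wj'')) (Assign ''fin'' (Const 1))
          (If (Less (Reg ''wi'') (Reg ''wj'')) (Assign ''wi'' (Plus (Reg ''wi'') (Const 1)))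
             (Assign ''wi'' (Minus (Reg ''wi'') (Const 1)))))"

lemma wregs_walk [simp]: "wregs (walk e f) = {''wi'', ''wj'', ''fin'', ''v'', ''h'', ''k'', ''c'', ''i'', ''done''}"
  and warrs_walk [simp]: "warrs (walk e f) = {''cnt'', ''part''}"
  by (auto simp: walk_def)

text \<open>The indices in the order of travel, both ends included, for walks in either
  direction.\<close>

definition idx :: "nat \<Rightarrow> nat \<Rightarrow> nat list" where
  "idx i j = (if i \<le> j then [i..<Suc j] else rev [j..<Suc i])"

lemma idx_self [simp]: "idx i i = [i]" by (simp add: idx_def)

lemma idx_up: "i < j \<Longrightarrow> idx i j = i # idx (Suc i) j"
  by (simp add: idx_def upt_conv_Cons)

lemma idx_down: "j < i \<Longrightarrow> idx i j = i # idx (i - 1) j"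
  by (cases i) (auto simp: idx_def)

lemma distinct_idx [simp]: "distinct (idx i j)" by (simp add: idx_def)

lemma set_idx: "set (idx i j) = {min i j..max i j}" by (auto simp: idx_def)

lemma idx_nonempty [simp]: "idx i j \<noteq> []" by (auto simp: idx_def)

lemma hd_idx [simp]: "hd (idx i j) = i"
  by (cases i j rule: linorder_cases) (auto simp: idx_up idx_down)

lemma last_idx [simp]: "last (idx i j) = j"
  by (auto simp: idx_def last_rev hd_upt simp del: upt_Suc)

context partition_problem
begin

section \<open>The input and passes over a neighbourhood\<close>

lemma inputD:
  assumes "input n E p \<sigma>"
  shows "reg \<sigma> ''n'' = n" "reg \<sigma> ''s'' = length p" "i < length p \<Longrightarrow> arr \<sigma> ''p'' i = p ! i"
    "v < n \<Longrightarrow> arr \<sigma> ''off'' v \<le> arr \<sigma> ''off'' (Suc v)"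
    "v < n \<Longrightarrow> bij_betw (arr \<sigma> ''adj'') {arr \<sigma> ''off'' v..<arr \<sigma> ''off'' (Suc v)} (nb v)"
    "v < n \<Longrightarrow> arr \<sigma> ''off'' (Suc v) - arr \<sigma> ''off'' v = deg v"
proof -
  show b: "v < n \<Longrightarrow> bij_betw (arr \<sigma> ''adj'') {arr \<sigma> ''off'' v..<arr \<sigma> ''off'' (Suc v)} (nb v)"
    using assms by (simp add: input_def nb_def)
  show "v < n \<Longrightarrow> arr \<sigma> ''off'' (Suc v) - arr \<sigma> ''off'' v = deg v"
    using bij_betw_same_card[OF b] by (simp add: deg_def)
qed (use assms in \<open>auto simp: input_def\<close>)

text \<open>The offsets are the prefix sums of the degrees, hence at most twice the number of edges;
  this is what makes them fit into a word.\<close>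

lemma off_le:
  assumes "input n E p \<sigma>" "v \<le> n"
  shows "arr \<sigma> ''off'' v \<le> 2 * card E"
proof -
  have "arr \<sigma> ''off'' v = (\<Sum>u<v. deg u)"
    using assms(2)
  proof (induction v)
    case 0
    then show ?case using assms(1) by (simp add: input_def)
  next
    case (Suc v)
    then show ?case using inputD(4,6)[OF assms(1), of v] by simp
  qed
  also have "\<dots> \<le> (\<Sum>u<n. deg u)" using assms(2) by (intro sum_mono2) auto
  also have "\<dots> \<le> 2 * card E" by (rule sum_deg_le)
  finally show ?thesis .
qed

lemma input_frame:
  assumes "input n E p \<sigma>" "frame c \<sigma> \<tau>"
    and "''n'' \<notin> wregs c" "''s'' \<notin> wregs c" "''off'' \<notin> warrs c" "''adj'' \<notin> warrs c" "''p'' \<notin> warrs c"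
  shows "input n E p \<tau>"
  using assms unfolding input_def by (auto simp: frame_def)

end

text \<open>The bound covers everything the program stores: vertex numbers and part indices,
  counters up to \<open>n + 1\<close>, and positions in \<open>adj\<close> up to
  \<open>2 * card E\<close>.\<close>

locale machine = partition_problem +
  fixes B :: nat
  assumes B_ge: "n + 2 * card E + 2 \<le> B"
begin

text \<open>The invariant is indexed by the set \<open>D\<close> of neighbours visited so far, which
  hides the order of the adjacency list; \<open>bij_betw\<close> guarantees that each neighbour
  comes up once.\<close>

lemma wp_for_nbr:
  assumes inp: "input n E p \<sigma>" and v: "reg \<sigma> x = v" "v < n"
    and c: "''k'' \<notin> wregs c" "x \<notin> wregs c" "x \<noteq> ''k''" "''off'' \<notin> warrs c" "''adj'' \<notin> warrs c"
    and ins: "\<And>D j \<tau>. I D \<tau> \<Longrightarrow> I D (set_reg ''k'' j \<tau>)"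
    and init: "I {} \<sigma>"
    and step: "\<And>D u \<tau>. D \<subseteq> nb v \<Longrightarrow> u \<in> nb v \<Longrightarrow> u \<notin> D \<Longrightarrow> I D \<tau> \<Longrightarrow>
      arr \<tau> ''adj'' (reg \<tau> ''k'') = u \<Longrightarrow> frame (for_nbr x c) \<sigma> \<tau> \<Longrightarrow>
      wp B c \<tau> (\<lambda>t \<tau>'. I (insert u D) \<tau>' \<and> t \<le> T)"
  shows "wp B (for_nbr x c) \<sigma> (\<lambda>t \<tau>. I (nb v) \<tau> \<and> t \<le> (T + 2) * deg v + 2)"
proof -
  define lo hi adj where "lo = arr \<sigma> ''off'' v" and "hi = arr \<sigma> ''off'' (Suc v)" and "adj = arr \<sigma> ''adj''"
  have lohi: "lo \<le> hi" "hi - lo = deg v" and hiB: "hi \<le> B"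
    using inputD(4,6)[OF inp v(2)] off_le[OF inp, of "Suc v"] v B_ge by (auto simp: lo_def hi_def)
  have bij: "bij_betw adj {lo..<hi} (nb v)"
    using inputD(5)[OF inp v(2)] by (simp add: lo_def hi_def adj_def)
  let ?P = "for_nbr x c"
  let ?b = "Less (Reg ''k'') (Get ''off'' (Plus (Reg x) (Const 1)))"
  let ?c = "c ;; Assign ''k'' (Plus (Reg ''k'') (Const 1))"
  let ?I = "\<lambda>\<tau>. lo \<le> reg \<tau> ''k'' \<and> reg \<tau> ''k'' \<le> hi \<and> I (adj ` {lo..<reg \<tau> ''k''}) \<tau> \<and> frame ?P \<sigma> \<tau>"
  let ?F = "\<lambda>\<tau>. (T + 2) * (hi - reg \<tau> ''k'')"
  let ?\<sigma> = "set_reg ''k'' lo \<sigma>"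
  have fr: "reg \<tau> x = v" "arr \<tau> ''off'' = arr \<sigma> ''off''" "arr \<tau> ''adj'' = adj" if "frame ?P \<sigma> \<tau>" for \<tau>
    using that c v by (auto simp: frame_def adj_def)
  have "wp B (While ?b ?c) ?\<sigma> (\<lambda>t \<tau>. ?I \<tau> \<and> \<not> test ?b \<tau> \<and> t \<le> ?F ?\<sigma> + 1)"
  proof (rule wp_While)
    show "?I ?\<sigma>" using lohi init ins by (auto simp: frame_def)
  next
    fix \<tau> assume I: "?I \<tau>" and "test ?b \<tau>"
    hence lt: "reg \<tau> ''k'' < hi" using fr by (auto simp: hi_def)
    let ?k = "reg \<tau> ''k''" and ?D = "adj ` {lo..<reg \<tau> ''k''}"
    have u: "adj ?k \<in> nb v" "?D \<subseteq> nb v" using bij lt I by (auto simp: bij_betw_def)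
    have "adj ?k \<notin> ?D"
    proof
      assume "adj ?k \<in> ?D"
      then obtain j where "lo \<le> j" "j < ?k" "adj j = adj ?k" by auto
      then show False using bij lt I inj_onD[of adj "{lo..<hi}" j ?k] by (auto simp: bij_betw_def)
    qed
    moreover have "insert (adj ?k) ?D = adj ` {lo..<Suc ?k}" using I by (auto simp: less_Suc_eq)
    ultimately have "wp B c \<tau> (\<lambda>t \<tau>'. I (adj ` {lo..<Suc ?k}) \<tau>' \<and> t \<le> T)"
      using step[of ?D "adj ?k" \<tau>] u I fr by auto
    from wp_frame[OF this]
    show "wp B ?c \<tau> (\<lambda>t \<tau>'. ?I \<tau>' \<and> t + 1 + ?F \<tau>' \<le> ?F \<tau>)"
      unfolding wp_Seq
    proof (rule wp_mono)
      fix t \<tau>' assume a: "(I (adj ` {lo..<Suc ?k}) \<tau>' \<and> t \<le> T) \<and> frame c \<tau> \<tau>'"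
      hence r: "reg \<tau>' ''k'' = ?k" using c by (auto simp: frame_def)
      have "hi - ?k = Suc (hi - Suc ?k)" using lt by simp
      then have "(T + 2) * (hi - ?k) = T + 2 + (T + 2) * (hi - Suc ?k)" by (metis mult_Suc_right)
      then show "wp B (Assign ''k'' (Plus (Reg ''k'') (Const 1))) \<tau>'
         (\<lambda>t' \<tau>''. ?I \<tau>'' \<and> t + t' + 1 + ?F \<tau>'' \<le> ?F \<tau>)"
        using a I lt hiB r ins by (auto simp: frame_def)
    qed
  qed
  then have "wp B (While ?b ?c) ?\<sigma> (\<lambda>t \<tau>. I (nb v) \<tau> \<and> 1 + t \<le> (T + 2) * deg v + 2)"
  proof (rule wp_mono, goal_cases)
    case (1 t \<tau>)
    then have "reg \<tau> ''k'' = hi" using fr[of \<tau>] by (auto simp: hi_def)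
    then show ?case using 1 bij lohi by (auto simp: bij_betw_def)
  qed
  moreover have "val (Get ''off'' (Reg x)) \<sigma> = lo" using v by (simp add: lo_def)
  ultimately show ?thesis
    unfolding for_nbr_def wp_Seq wp_Assign using lohi hiB by simp
qed

text \<open>The counters include cell \<open>n\<close>, because uncoloured neighbours are counted
  there.\<close>

definition ready :: "state \<Rightarrow> bool" where
  "ready \<sigma> \<longleftrightarrow> input n E p \<sigma> \<and> (\<forall>c\<le>n. arr \<sigma> ''cnt'' c = 0) \<and> (\<forall>v<n. arr \<sigma> ''part'' v \<le> n)"

lemma wp_try_hole:
  assumes r: "ready \<sigma>" and h: "reg \<sigma> ''h'' = h" "h < n"
  defines "x \<equiv> arr \<sigma> ''part''"
  shows "wp B try_hole \<sigma> (\<lambda>t \<tau>. ready \<tau> \<and> t \<le> 20 * (deg h + 1) \<and>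
    ((\<exists>i. i < length p \<and> i < n \<and> cnt x h i \<le> p ! i \<and> arr \<tau> ''part'' = x(h := i) \<and> reg \<tau> ''done'' = 1) \<or>
     (stuck x h \<and> arr \<tau> ''part'' = x \<and> reg \<tau> ''done'' = 0)))"
proof -
  have inp: "input n E p \<sigma>" and cnt0: "\<And>c. c \<le> n \<Longrightarrow> arr \<sigma> ''cnt'' c = 0" and xn: "\<And>v. v < n \<Longrightarrow> x v \<le> n"
    using r by (auto simp: ready_def x_def)
  let ?c1 = "Assign ''c'' (Get ''part'' (Get ''adj'' (Reg ''k''))) ;;
       Put ''cnt'' (Reg ''c'') (Plus (Get ''cnt'' (Reg ''c'')) (Const 1))"
  let ?I1 = "\<lambda>D \<tau>. \<forall>c\<le>n. arr \<tau> ''cnt'' c = card {u \<in> D. x u = c}"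
  have 1: "wp B (for_nbr ''h'' ?c1) \<sigma> (\<lambda>t \<tau>. ?I1 (nb h) \<tau> \<and> t \<le> (2 + 2) * deg h + 2)"
  proof (rule wp_for_nbr[OF inp h])
    fix D u \<tau> assume a: "D \<subseteq> nb h" "u \<in> nb h" "u \<notin> D" "?I1 D \<tau>" "arr \<tau> ''adj'' (reg \<tau> ''k'') = u"
      "frame (for_nbr ''h'' ?c1) \<sigma> \<tau>"
    have xe: "arr \<tau> ''part'' = x" using a(6) by (simp add: frame_def x_def)
    have fin: "finite D" using a(1) by (rule finite_subset) simp
    have xu: "x u \<le> n" using xn nb_less a(2) by blast
    have "card {w \<in> insert u D. x w = c} = (if c = x u then Suc (card {w \<in> D. x w = c}) else card {w \<in> D. x w = c})"
      for c
    proof -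
      have "{w \<in> insert u D. x w = c} = (if c = x u then insert u {w \<in> D. x w = c} else {w \<in> D. x w = c})" by auto
      then show ?thesis using a(3) fin by simp
    qed
    moreover have "card {w \<in> D. x w = x u} \<le> n"
    proof -
      have "{w \<in> D. x w = x u} \<subseteq> {..<n}" using a(1) nb_subset by auto
      from card_mono[OF _ this] show ?thesis by simp
    qed
    ultimately show "wp B ?c1 \<tau> (\<lambda>t \<tau>'. ?I1 (insert u D) \<tau>' \<and> t \<le> 2)"
      using a(4,5) xe xu B_ge by auto
  qed (use cnt0 in auto)
  let ?b = "And (Less (Reg ''i'') (Reg ''s'')) (Less (Get ''p'' (Reg ''i'')) (Get ''cnt'' (Reg ''i'')))"
  let ?c2 = "Assign ''i'' (Plus (Reg ''i'') (Const 1))"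
  let ?J = "\<lambda>\<tau>. input n E p \<tau> \<and> arr \<tau> ''part'' = x \<and> reg \<tau> ''h'' = h"
  let ?I2 = "\<lambda>\<tau>. ?J \<tau> \<and> (\<forall>c\<le>n. arr \<tau> ''cnt'' c = cnt x h c) \<and> reg \<tau> ''i'' \<le> length p \<and>
       (\<forall>j<reg \<tau> ''i''. p ! j < cnt x h j)"
  \<comment> \<open>All parts passed so far have a positive count, so the index stays within the
    degree. This bounds the time of the scan and keeps it on the cells of \<open>cnt\<close> that
    are known.\<close>
  have le: "reg \<tau> ''i'' \<le> deg h" if "?I2 \<tau>" for \<tau>
    by (rule cnt_pos_le_deg[of _ x]) (use that in auto)
  note dn = deg_less[OF h(2)]
  have pJ: "reg \<tau> ''s'' = length p" "i < length p \<Longrightarrow> arr \<tau> ''p'' i = p ! i" if "?J \<tau>" for \<tau> i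
    using that by (auto simp: ready_def input_def)
  have 2: "wp B (While ?b ?c2) \<sigma>' (\<lambda>t \<tau>. ?I2 \<tau> \<and> \<not> test ?b \<tau> \<and> t \<le> 2 * (deg h - reg \<sigma>' ''i'') + 1)"
    if "?I2 \<sigma>'" for \<sigma>'
  proof (rule wp_While)
    fix \<tau> assume I: "?I2 \<tau>" and t: "test ?b \<tau>"
    have "reg \<tau> ''i'' \<le> n" using le[OF I] dn by simp
    then have q: "reg \<tau> ''i'' < length p" "p ! reg \<tau> ''i'' < cnt x h (reg \<tau> ''i'')"
      using I t pJ[of \<tau>] by auto
    have "Suc (reg \<tau> ''i'') \<le> deg h"
      by (rule cnt_pos_le_deg[of _ x]) (use q I in \<open>force simp: less_Suc_eq\<close>)
    then show "wp B ?c2 \<tau> (\<lambda>t \<tau>'. ?I2 \<tau>' \<and> t + 1 + 2 * (deg h - reg \<tau>' ''i'') \<le> 2 * (deg h - reg \<tau> ''i''))"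
      using I q B_ge dn by (auto simp: ready_def input_def less_Suc_eq)
  qed (use that in simp)
  let ?c3 = "Put ''cnt'' (Get ''part'' (Get ''adj'' (Reg ''k''))) (Const 0)"
  \<comment> \<open>A cell is clean once a neighbour of its colour has been visited, or if no
    neighbour has that colour; at \<open>D = nb h\<close> this covers all cells.\<close>
  let ?I3 = "\<lambda>D \<tau>. \<forall>c\<le>n. (\<exists>u\<in>D. x u = c) \<or> {u \<in> nb h. x u = c} = {} \<longrightarrow> arr \<tau> ''cnt'' c = 0"
  have 3: "wp B (for_nbr ''h'' ?c3) \<sigma>' (\<lambda>t \<tau>. ?I3 (nb h) \<tau> \<and> t \<le> (1 + 2) * deg h + 2)" if J: "?I2 \<sigma>'" for \<sigma>'
  proof (rule wp_for_nbr[where I = ?I3])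
    show "input n E p \<sigma>'" using J by blast
    fix D u \<tau> assume a: "D \<subseteq> nb h" "u \<in> nb h" "u \<notin> D" "?I3 D \<tau>" "arr \<tau> ''adj'' (reg \<tau> ''k'') = u"
      "frame (for_nbr ''h'' ?c3) \<sigma>' \<tau>"
    have xe: "arr \<tau> ''part'' = x" using a(6) J by (simp add: frame_def)
    have xu: "x u \<le> n" using xn nb_less a(2) by blast
    show "wp B ?c3 \<tau> (\<lambda>t \<tau>'. ?I3 (insert u D) \<tau>' \<and> t \<le> 1)"
      using a(4,5) xe xu B_ge by auto
  qed (use J h in \<open>auto simp: cnt_def\<close>)
  show ?thesis
    unfolding try_hole_def wp_Seq
  proof (rule wp_mono_frame[OF 1], goal_cases)
    case (1 t1 \<tau>1)
    let ?\<tau>1 = "set_reg ''i'' 0 \<tau>1"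
    have "?J ?\<tau>1"
      using 1(2) r h by (auto simp: ready_def input_def frame_def x_def)
    then have I: "?I2 ?\<tau>1" using 1(1) by (simp add: cnt_def)
    show ?case unfolding wp_Assign
    proof (intro conjI, simp, simp only: val.simps, rule wp_mono[OF 2[OF I]], goal_cases)
      case (1 t2 \<tau>2)
      then have I2: "?I2 \<tau>2" by blast
      from 1 have nt: "\<not> test ?b \<tau>2" and t2: "t2 \<le> 2 * deg h + 1" by auto
      show ?case
      proof (rule wp_mono_frame[OF 3[OF I2]], goal_cases)
        case (1 t3 \<tau>3)
        then have fr: "frame (for_nbr ''h'' ?c3) \<tau>2 \<tau>3" and c0: "\<forall>c\<le>n. arr \<tau>3 ''cnt'' c = 0"
          by (auto)
        have i: "reg \<tau>3 ''i'' = reg \<tau>2 ''i''" "reg \<tau>3 ''s'' = length p" "reg \<tau>3 ''h'' = h" "arr \<tau>3 ''part'' = x"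
          using fr I2 pJ[of \<tau>2] by (auto simp: frame_def)
        have rd: "ready \<tau>3" using fr I2 c0 xn by (auto simp: ready_def input_def frame_def)
        have iB: "reg \<tau>2 ''i'' < n" using le[OF I2] dn by simp
        have tt: "t1 + (1 + (t2 + (t3 + 3))) \<le> 20 * (deg h + 1)"
          using 1(1) \<open>?I1 (nb h) \<tau>1 \<and> t1 \<le> (2 + 2) * deg h + 2\<close> t2 by simp
        show ?case
        proof (cases "reg \<tau>2 ''i'' < length p")
          case True
          then have "cnt x h (reg \<tau>2 ''i'') \<le> p ! (reg \<tau>2 ''i'')" using nt I2 pJ[of \<tau>2] iB by auto
          then show ?thesis using True i rd iB tt h B_ge by (auto simp: ready_def input_def)
        next
          case False
          then have "stuck x h" using I2 by (auto simp: stuck_def)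
          then show ?thesis using False i rd tt B_ge by (auto simp: ready_def input_def)
        qed
      qed
    qed
  qed
qed

text \<open>Either the hole has been filled, or the whole walk \<open>vs\<close> was made from
  \<open>st\<close> and every configuration on the way was jammed. Recording all prefixes is what
  later turns an unfinished run into a contradiction.\<close>

definition tracks :: "(nat \<Rightarrow> nat) \<times> nat \<Rightarrow> nat list \<Rightarrow> state \<Rightarrow> bool" where
  "tracks st vs \<sigma> \<longleftrightarrow> ready \<sigma> \<and>
     (reg \<sigma> ''done'' = 1 \<and> partial (arr \<sigma> ''part'') {..<n} \<or>
      reg \<sigma> ''done'' = 0 \<and> (arr \<sigma> ''part'', reg \<sigma> ''h'') = foldl mv st vs \<and>
        (\<forall>m\<le>length vs. jam (foldl mv st (take m vs))))"

lemma wp_try_tracks: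
  assumes rd: "ready \<sigma>" and h: "reg \<sigma> ''h'' = h" "h < n" and x: "partial (arr \<sigma> ''part'') ({..<n} - {h})"
  shows "wp B try_hole \<sigma> (\<lambda>t \<tau>. tracks (arr \<sigma> ''part'', h) [] \<tau> \<and> t \<le> 20 * (deg h + 1))"
proof (rule wp_mono_frame[OF wp_try_hole[OF rd h]], goal_cases)
  case (1 t \<tau>)
  let ?x = "arr \<sigma> ''part''"
  have e: "reg \<tau> ''h'' = h" using 1(2) h by (simp add: frame_def)
  from conjunct2[OF conjunct2[OF 1(1)]]
  consider i where "i < length p" "i < n" "cnt ?x h i \<le> p ! i" "arr \<tau> ''part'' = ?x(h := i)" "reg \<tau> ''done'' = 1"
    | "stuck ?x h" "arr \<tau> ''part'' = ?x" "reg \<tau> ''done'' = 0" by (elim disjE exE conjE)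
  then show ?case
  proof cases
    case 1
    have "partial (?x(h := i)) (insert h ({..<n} - {h}))"
      using partial_insert[OF x h(2) _ 1(1-3)] by simp
    then have "partial (arr \<tau> ''part'') {..<n}" using 1 h by (simp add: insert_absorb)
    then show ?thesis using \<open>ready \<tau> \<and> _\<close> 1 by (simp add: tracks_def)
  next
    case 2
    then show ?thesis using \<open>ready \<tau> \<and> _\<close> e x h by (simp add: tracks_def jam_def hole_def)
  qed
qed

text \<open>The move is legal by \<open>hole_mv\<close>, since the configuration before it is
  jammed. Three assignments precede the test of the new hole, hence 23 in place of 20.\<close>

lemma wp_step_hole:
  assumes tr: "tracks st vs \<sigma>" and d: "reg \<sigma> ''done'' = 0" and v: "reg \<sigma> ''v'' = v" "v \<in> nb (reg \<sigma> ''h'')"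
  shows "wp B step_hole \<sigma> (\<lambda>t \<tau>. tracks st (vs @ [v]) \<tau> \<and> t \<le> 23 * (deg v + 1))"
proof -
  let ?x = "arr \<sigma> ''part''" and ?h = "reg \<sigma> ''h''"
  have st: "(?x, ?h) = foldl mv st vs" and jam: "\<And>m. m \<le> length vs \<Longrightarrow> jam (foldl mv st (take m vs))"
    and rd: "ready \<sigma>" using tr d by (auto simp: tracks_def)
  have j: "jam (?x, ?h)" using jam[of "length vs"] st by simp
  then have hn: "?h < n" by (simp add: jam_def hole_def)
  have vn: "v < n" using v nb_less by blast
  define y where "y = ?x(?h := ?x v, v := n)"
  have st': "foldl mv st (vs @ [v]) = (y, v)" by (simp add: st[symmetric] y_def)
  have hole: "hole (y, v)" using hole_mv[OF j v(2)] by (simp add: y_def)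
  have xv: "?x v \<le> n" using rd vn by (simp add: ready_def)
  have regn: "reg \<sigma> ''n'' = n" using rd by (simp add: ready_def input_def)
  define \<sigma>' where "\<sigma>' = set_reg ''h'' v (set_arr ''part'' v n (set_arr ''part'' ?h (?x v) \<sigma>))"
  have y': "arr \<sigma>' ''part'' = y" by (simp add: \<sigma>'_def y_def)
  have rd': "ready \<sigma>'" using rd xv by (auto simp: ready_def input_def \<sigma>'_def)
  have h': "reg \<sigma>' ''h'' = v" by (simp add: \<sigma>'_def)
  have P: "partial (arr \<sigma>' ''part'') ({..<n} - {v})" using hole by (simp add: y' hole_def)
  have "tracks st (vs @ [v]) \<tau>" if "tracks (y, v) [] \<tau>" for \<tau>
  proof -
    have "jam (foldl mv st (take m (vs @ [v])))" if "jam (y, v)" "m \<le> length (vs @ [v])" for m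
      using that jam[of m] st' by (cases "m \<le> length vs") (auto simp: not_le simp del: foldl_append)
    then show ?thesis using that st' by (auto simp: tracks_def simp del: foldl_append)
  qed
  then have "wp B try_hole \<sigma>' (\<lambda>t \<tau>. tracks st (vs @ [v]) \<tau> \<and> t \<le> 20 * (deg v + 1))"
    using wp_try_tracks[OF rd' h' vn P] unfolding y' by (auto elim: wp_mono)
  then have "wp B try_hole \<sigma>' (\<lambda>t \<tau>. tracks st (vs @ [v]) \<tau> \<and> 1 + (1 + (1 + t)) \<le> 23 * (deg v + 1))"
    by (rule wp_mono) simp
  then show ?thesis
    unfolding step_hole_def wp_Seq wp_Put wp_Assign val.simps reg_set_arr v(1) regn \<sigma>'_def
    using hn vn xv B_ge by auto
qed

text \<open>After the hole is filled, the start and the walk are arbitrary, so the remaining script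
  can be followed on paper without any effect.\<close>

lemma tracks_cong_done: "tracks st vs \<sigma> \<Longrightarrow> reg \<sigma> ''done'' \<noteq> 0 \<Longrightarrow> tracks st' vs' \<sigma>"
  by (auto simp: tracks_def)

lemma tracks_set_reg [simp]:
  "x \<notin> {''done'', ''h'', ''n'', ''s''} \<Longrightarrow> tracks st vs (set_reg x k \<sigma>) \<longleftrightarrow> tracks st vs \<sigma>"
  by (auto simp: tracks_def ready_def input_def)

lemma wp_walk:
  assumes tr: "tracks st vs \<sigma>"
    and i: "val e \<sigma> = i" and j: "val f (set_reg ''wi'' i \<sigma>) = j"
    and ys: "\<And>k. k < length ys \<Longrightarrow> arr \<sigma> ''ord'' k = ys ! k" "distinct ys" "set ys \<subseteq> {..<n}"
    and ij: "i < length ys" "j < length ys"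
    and path: "\<And>k. min i j \<le> k \<Longrightarrow> k < max i j \<Longrightarrow> ys ! Suc k \<in> nb (ys ! k)"
    and first: "ys ! i \<in> nb (snd (foldl mv st vs))"
  shows "wp B (walk e f) \<sigma> (\<lambda>t \<tau>. tracks st (vs @ map ((!) ys) (idx i j)) \<tau> \<and> t \<le> 30 * dsum {..<n} + 10)"
proof -
  let ?b = "And (Equal (Reg ''done'') (Const 0)) (Equal (Reg ''fin'') (Const 0))"
  let ?c2 = "If (Equal (Reg ''wi'') (Reg ''wj'')) (Assign ''fin'' (Const 1))
          (If (Less (Reg ''wi'') (Reg ''wj'')) (Assign ''wi'' (Plus (Reg ''wi'') (Const 1)))
             (Assign ''wi'' (Minus (Reg ''wi'') (Const 1))))"
  let ?c = "Assign ''v'' (Get ''ord'' (Reg ''wi'')) ;; step_hole ;; ?c2"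
  have len: "length ys \<le> n"
    using card_mono[OF _ ys(3)] distinct_card[OF ys(2)] by simp
  let ?full = "map ((!) ys) (idx i j)"
  \<comment> \<open>\<open>us\<close> is the part of the walk made so far. The flag
    \<open>fin\<close> separates the states in which the vertex at \<open>wi\<close> is still to be
    visited from the final one.\<close>
  define I where "I = (\<lambda>\<tau> :: state. arr \<tau> ''ord'' = arr \<sigma> ''ord'' \<and> reg \<tau> ''wj'' = j \<and> min i j \<le> reg \<tau> ''wi'' \<and> reg \<tau> ''wi'' \<le> max i j \<and>
    (if reg \<tau> ''fin'' = 0 then \<exists>us. ?full = us @ map ((!) ys) (idx (reg \<tau> ''wi'') j) \<and> tracks st (vs @ us) \<tau> \<and>
         ys ! reg \<tau> ''wi'' \<in> nb (snd (foldl mv st (vs @ us)))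
     else tracks st (vs @ ?full) \<tau>))"
  define cost where "cost = (\<lambda>k. 30 * (deg (ys ! k) + 1))"
  \<comment> \<open>The potential drops to 0 as soon as the hole is filled, because the loop then
    stops.\<close>
  define F where "F = (\<lambda>\<tau> :: state. if reg \<tau> ''fin'' = 0 \<and> reg \<tau> ''done'' = 0 then (\<Sum>k\<leftarrow>idx (reg \<tau> ''wi'') j. cost k) else 0)"
  let ?\<sigma> = "set_reg ''fin'' 0 (set_reg ''wj'' j (set_reg ''wi'' i \<sigma>))"
  have "wp B (While ?b ?c) ?\<sigma> (\<lambda>t \<tau>. I \<tau> \<and> \<not> test ?b \<tau> \<and> t \<le> F ?\<sigma> + 1)"
  proof (rule wp_While)
    show "I ?\<sigma>" using tr first by (auto simp: I_def intro!: exI[of _ "[]"])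
  next
    fix \<tau> assume I: "I \<tau>" and t: "test ?b \<tau>"
    let ?w = "reg \<tau> ''wi''"
    from I t obtain us where us: "?full = us @ map ((!) ys) (idx ?w j)" "tracks st (vs @ us) \<tau>"
        "ys ! ?w \<in> nb (snd (foldl mv st (vs @ us)))"
      and w: "min i j \<le> ?w" "?w \<le> max i j" and r: "reg \<tau> ''wj'' = j" "reg \<tau> ''fin'' = 0" "reg \<tau> ''done'' = 0"
        "arr \<tau> ''ord'' = arr \<sigma> ''ord''"
      by (auto simp: I_def)
    have wl: "?w < length ys" using w ij by auto
    let ?v = "ys ! ?w"
    have vn: "?v < n" using wl ys(3) nth_mem by blast
    let ?\<tau> = "set_reg ''v'' ?v \<tau>"
    have h: "reg \<tau> ''h'' = snd (foldl mv st (vs @ us))" using us(2) r(3) by (auto simp: tracks_def dest: arg_cong[where f = snd])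
    have "wp B step_hole ?\<tau> (\<lambda>t \<tau>'. tracks st ((vs @ us) @ [?v]) \<tau>' \<and> t \<le> 23 * (deg ?v + 1))"
      using us(2,3) r(3) h by (intro wp_step_hole) auto
    from wp_frame[OF this]
    have "wp B (step_hole ;; ?c2) ?\<tau> (\<lambda>t \<tau>'. I \<tau>' \<and> t + 2 + F \<tau>' \<le> F \<tau>)"
      unfolding wp_Seq
    proof (rule wp_mono, goal_cases)
      case (1 t1 \<tau>1)
      then have fr: "frame step_hole ?\<tau> \<tau>1" and t1: "t1 \<le> 23 * (deg ?v + 1)"
        and tr1: "tracks st (vs @ us @ [?v]) \<tau>1" by auto
      have e: "reg \<tau>1 ''wi'' = ?w" "reg \<tau>1 ''wj'' = j" "reg \<tau>1 ''fin'' = 0" "arr \<tau>1 ''ord'' = arr \<sigma> ''ord''"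
        using fr r by (auto simp: frame_def)
      have s1: "snd (foldl mv st (vs @ us @ [?v])) = ?v" by (subst snd_foldl_mv) auto
      have F0: "F \<tau> = (\<Sum>k\<leftarrow>idx ?w j. cost k)" using r by (simp add: F_def)
      consider "?w = j" | "?w < j" | "j < ?w" by linarith
      then show ?case
      proof cases
        case 1
        then have "us @ [?v] = ?full" using us(1) by simp
        then have "tracks st (vs @ ?full) \<tau>1" using tr1 by simp
        then show ?thesis using 1 e w F0 t1 B_ge by (auto simp: I_def F_def cost_def)
      next
        case 2
        have f: "?full = (us @ [?v]) @ map ((!) ys) (idx (Suc ?w) j)" using us(1) idx_up[OF 2] by simp
        have "ys ! Suc ?w \<in> nb ?v" using path[of ?w] w 2 by auto
        then have I': "I (set_reg ''wi'' (Suc ?w) \<tau>1)"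
          using 2 e w f tr1 s1 unfolding I_def by (auto intro!: exI[of _ "us @ [?v]"])
        have "F (set_reg ''wi'' (Suc ?w) \<tau>1) + cost ?w \<le> F \<tau>"
          unfolding F0 idx_up[OF 2] by (simp add: F_def)
        then show ?thesis using 2 e t1 I' B_ge wl len by (auto simp: cost_def)
      next
        case 3
        have f: "?full = (us @ [?v]) @ map ((!) ys) (idx (?w - 1) j)" using us(1) idx_down[OF 3] by simp
        have "ys ! Suc (?w - 1) \<in> nb (ys ! (?w - 1))" using path[of "?w - 1"] w 3 by auto
        then have "ys ! (?w - 1) \<in> nb ?v" using 3 nb_sym by simp
        then have I': "I (set_reg ''wi'' (?w - 1) \<tau>1)"
          using 3 e w f tr1 s1 unfolding I_def by (auto intro!: exI[of _ "us @ [?v]"])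
        have "F (set_reg ''wi'' (?w - 1) \<tau>1) + cost ?w \<le> F \<tau>"
          unfolding F0 idx_down[OF 3] by (simp add: F_def)
        then show ?thesis using 3 e t1 I' B_ge wl len by (auto simp: cost_def)
      qed
    qed
    then show "wp B ?c \<tau> (\<lambda>t \<tau>'. I \<tau>' \<and> t + 1 + F \<tau>' \<le> F \<tau>)"
      using r ys(1)[OF wl] vn B_ge by (auto elim!: wp_mono)
  qed
  \<comment> \<open>If the loop stopped early because the hole was filled, \<open>tracks\<close>
    holds for the full walk as well.\<close>
  moreover have "tracks st (vs @ ?full) \<tau>" if "I \<tau>" "\<not> test ?b \<tau>" for \<tau>
    using that tracks_cong_done[of st _ \<tau> st "vs @ ?full"] unfolding I_def by (auto split: if_splits)
  moreover have "F ?\<sigma> \<le> 30 * dsum {..<n}"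
  proof -
    \<comment> \<open>The walk never repeats a vertex, so its cost is a sum over distinct
      vertices.\<close>
    have inj: "inj_on ((!) ys) (set (idx i j))"
      using ys(2) ij by (auto simp: set_idx intro!: inj_on_nth)
    have "(\<Sum>k\<leftarrow>idx i j. cost k) = (\<Sum>k\<in>set (idx i j). cost k)" by (simp add: sum_list_distinct_conv_sum_set)
    also have "\<dots> = 30 * dsum ((!) ys ` set (idx i j))"
      unfolding dsum_def cost_def sum_distrib_left by (simp add: sum.reindex[OF inj])
    also have "\<dots> \<le> 30 * dsum {..<n}"
      using ys(3) ij by (intro mult_le_mono2 dsum_mono) (auto simp: set_idx subset_iff)
    finally show ?thesis by (simp add: F_def)
  qed
  ultimately show ?thesis
    unfolding walk_def using i j ij len B_ge by (auto elim!: wp_mono)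
qed

end

section \<open>A maximal path, a search order and the first partial partition\<close>

text \<open>The range includes cell \<open>n\<close>, where \<open>cnt\<close> collects uncoloured
  neighbours. In \<open>pos\<close> the value \<open>n\<close> means that the vertex is not listed
  yet.\<close>

definition init_arrays :: com where
  "init_arrays = for_range ''v'' (Const 0) (Plus (Reg ''n'') (Const 1))
     (Put ''part'' (Reg ''v'') (Reg ''n'') ;; Put ''cnt'' (Reg ''v'') (Const 0) ;;
      Put ''pos'' (Reg ''v'') (Reg ''n'') ;; Put ''mark'' (Reg ''v'') (Const 0) ;;
      Put ''mk'' (Reg ''v'') (Const 0))"

definition push :: com where
  "push = Put ''pos'' (Reg ''u'') (Reg ''tail'') ;; Put ''ord'' (Reg ''tail'') (Reg ''u'') ;;
     Assign ''tail'' (Plus (Reg ''tail'') (Const 1))"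

definition scan_new :: com where
  "scan_new = Assign ''u'' (Get ''adj'' (Reg ''k'')) ;;
     If (Equal (Get ''pos'' (Reg ''u'')) (Reg ''n'')) (Assign ''nx'' (Reg ''u'')) Skip"

definition path_step :: com where
  "path_step = Assign ''v'' (Get ''ord'' (Minus (Reg ''tail'') (Const 1))) ;;
     Assign ''nx'' (Reg ''n'') ;; for_nbr ''v'' scan_new ;;
     If (Equal (Reg ''nx'') (Reg ''n'')) (Assign ''go'' (Const 0)) (Assign ''u'' (Reg ''nx'') ;; push)"

definition find_path :: com where
  "find_path = Assign ''tail'' (Const 0) ;; Assign ''u'' (Const 0) ;; push ;; Assign ''go'' (Const 1) ;;
     While (Equal (Reg ''go'') (Const 1)) path_step ;;
     Assign ''len'' (Reg ''tail'') ;; Assign ''l'' (Get ''ord'' (Minus (Reg ''tail'') (Const 1)))"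

definition push_new :: com where
  "push_new = Assign ''u'' (Get ''adj'' (Reg ''k'')) ;;
     If (Equal (Get ''pos'' (Reg ''u'')) (Reg ''n'')) push Skip"

text \<open>\<open>ord\<close> is both the queue and the resulting order. The path is its initial
  content, so it stays an initial segment.\<close>

definition search :: com where
  "search = Assign ''head'' (Const 0) ;;
     While (Less (Reg ''head'') (Reg ''tail''))
       (Assign ''v'' (Get ''ord'' (Reg ''head'')) ;; for_nbr ''v'' push_new ;;
        Assign ''head'' (Plus (Reg ''head'') (Const 1)))"

text \<open>The loop ends at \<open>j\<close> = 1, leaving the root as the hole; the walk then
  carries it from index 1 to the far end of the path.\<close>

definition greedy :: com where
  "greedy = Assign ''j'' (Reg ''n'') ;;
     While (Less (Const 1) (Reg ''j''))
       (Assign ''j'' (Minus (Reg ''j'') (Const 1)) ;; Assign ''h'' (Get ''ord'' (Reg ''j'')) ;; try_hole) ;;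
     Assign ''h'' (Get ''ord'' (Const 0)) ;; try_hole ;;
     If (Less (Const 1) (Reg ''len'')) (walk (Const 1) (Minus (Reg ''len'') (Const 1))) Skip"

definition prepare :: com where
  "prepare = init_arrays ;; find_path ;; search ;; greedy"

lemma wregs_init_arrays [simp]: "wregs init_arrays = {''v''}"
  and warrs_init_arrays [simp]: "warrs init_arrays = {''part'', ''cnt'', ''pos'', ''mark'', ''mk''}"
  by (auto simp: init_arrays_def)

lemma wregs_push [simp]: "wregs push = {''tail''}"
  and warrs_push [simp]: "warrs push = {''pos'', ''ord''}"
  by (auto simp: push_def)

lemma wregs_scan_new [simp]: "wregs scan_new = {''u'', ''nx''}"
  and warrs_scan_new [simp]: "warrs scan_new = {}"
  by (auto simp: scan_new_def)

lemma wregs_path_step [simp]: "wregs path_step = {''v'', ''nx'', ''k'', ''u'', ''go'', ''tail''}"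
  and warrs_path_step [simp]: "warrs path_step = {''pos'', ''ord''}"
  by (auto simp: path_step_def)

lemma wregs_find_path [simp]: "wregs find_path = {''v'', ''nx'', ''k'', ''u'', ''go'', ''tail'', ''len'', ''l''}"
  and warrs_find_path [simp]: "warrs find_path = {''pos'', ''ord''}"
  by (auto simp: find_path_def)

lemma wregs_push_new [simp]: "wregs push_new = {''u'', ''tail''}"
  and warrs_push_new [simp]: "warrs push_new = {''pos'', ''ord''}"
  by (auto simp: push_new_def)

lemma wregs_search [simp]: "wregs search = {''head'', ''v'', ''k'', ''u'', ''tail''}"
  and warrs_search [simp]: "warrs search = {''pos'', ''ord''}"
  by (auto simp: search_def)

lemma wregs_greedy [simp]:
    "wregs greedy = {''j'', ''wi'', ''wj'', ''fin'', ''v'', ''h'', ''k'', ''c'', ''i'', ''done''}"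
  and warrs_greedy [simp]: "warrs greedy = {''cnt'', ''part''}"
  by (auto simp: greedy_def)

context machine
begin

section \<open>Initialisation and the maximal path\<close>

lemma wp_init_arrays:
  assumes inp: "input n E p \<sigma>"
  shows "wp B init_arrays \<sigma> (\<lambda>t \<tau>. t \<le> 20 * dsum {..<n} \<and> input n E p \<tau> \<and>
    (\<forall>v\<le>n. arr \<tau> ''part'' v = n \<and> arr \<tau> ''cnt'' v = 0 \<and> arr \<tau> ''pos'' v = n \<and> arr \<tau> ''mark'' v = 0 \<and> arr \<tau> ''mk'' v = 0))"
proof -
  let ?I = "\<lambda>i (\<tau> :: state). \<forall>v<i. arr \<tau> ''part'' v = n \<and> arr \<tau> ''cnt'' v = 0 \<and> arr \<tau> ''pos'' v = n \<and> arr \<tau> ''mark'' v = 0 \<and> arr \<tau> ''mk'' v = 0"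
  have "wp B init_arrays \<sigma> (\<lambda>t \<tau>. ?I (Suc n) \<tau> \<and> t \<le> (\<Sum>i = val (Const 0) \<sigma>..<Suc n. 5 + 2) + 2)"
    unfolding init_arrays_def
  proof (rule wp_for_range, goal_cases)
    case (7 i \<tau>)
    then have "reg \<tau> ''n'' = n" using inputD(1)[OF inp] by (simp add: frame_def)
    then show ?case using 7 B_ge by (auto simp: less_Suc_eq)
  qed (use inputD(1)[OF inp] B_ge in \<open>auto simp: frame_def\<close>)
  then show ?thesis
  proof (rule wp_mono_frame, goal_cases)
    case (1 t \<tau>)
    have "n \<le> dsum {..<n}" by (simp add: dsum_def sum.distrib sum_Suc)
    then have "t \<le> 20 * dsum {..<n}" using 1(1) n_ge by simp
    moreover have "input n E p \<tau>" using input_frame[OF inp 1(2)] by simp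
    ultimately show ?case using 1 by auto
  qed
qed

text \<open>\<open>pos\<close> inverts \<open>ord\<close> on the listed vertices. As there are at
  most \<open>n\<close> of them, the value \<open>n\<close> is free to mark the others.\<close>

definition listed :: "nat list \<Rightarrow> state \<Rightarrow> bool" where
  "listed ys \<sigma> \<longleftrightarrow> ys = map (arr \<sigma> ''ord'') [0..<reg \<sigma> ''tail''] \<and> distinct ys \<and> set ys \<subseteq> {..<n} \<and>
     (\<forall>i<length ys. arr \<sigma> ''pos'' (ys ! i) = i) \<and> (\<forall>v<n. v \<notin> set ys \<longrightarrow> arr \<sigma> ''pos'' v = n)"

lemma listedD:
  assumes "listed ys \<sigma>"
  shows "reg \<sigma> ''tail'' = length ys" "distinct ys" "set ys \<subseteq> {..<n}" "length ys \<le> n"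
    "\<And>i. i < length ys \<Longrightarrow> arr \<sigma> ''ord'' i = ys ! i" "\<And>i. i < length ys \<Longrightarrow> arr \<sigma> ''pos'' (ys ! i) = i"
    "\<And>v. v < n \<Longrightarrow> arr \<sigma> ''pos'' v = n \<longleftrightarrow> v \<notin> set ys" "\<And>i. i < length ys \<Longrightarrow> ys ! i < n"
    "map (arr \<sigma> ''ord'') [0..<reg \<sigma> ''tail''] = ys"
proof -
  have ys: "ys = map (arr \<sigma> ''ord'') [0..<reg \<sigma> ''tail'']" using assms by (simp add: listed_def)
  show "map (arr \<sigma> ''ord'') [0..<reg \<sigma> ''tail''] = ys" using ys by simp
  show l: "reg \<sigma> ''tail'' = length ys" using arg_cong[OF ys, of length] by simp
  show d: "distinct ys" and s: "set ys \<subseteq> {..<n}" using assms unfolding listed_def by blast+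
  show len: "length ys \<le> n" using card_mono[OF _ s] distinct_card[OF d] by simp
  show "arr \<sigma> ''ord'' i = ys ! i" if "i < length ys" for i
    using arg_cong[OF ys, of "\<lambda>zs. zs ! i"] that l by simp
  show p: "arr \<sigma> ''pos'' (ys ! i) = i" if "i < length ys" for i
    using assms that unfolding listed_def by blast
  show "ys ! i < n" if "i < length ys" for i using s nth_mem[OF that] by blast
  show "arr \<sigma> ''pos'' v = n \<longleftrightarrow> v \<notin> set ys" if "v < n" for v
  proof
    assume a: "arr \<sigma> ''pos'' v = n"
    show "v \<notin> set ys"
    proof
      assume "v \<in> set ys"
      then obtain i where "i < length ys" "ys ! i = v" by (auto simp: in_set_conv_nth)
      then show False using p[of i] a len by simp
    qed
  qed (use assms that in \<open>simp add: listed_def\<close>)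
qed

lemma listed_frame:
  assumes "listed ys \<sigma>" "arr \<tau> ''ord'' = arr \<sigma> ''ord''" "arr \<tau> ''pos'' = arr \<sigma> ''pos''" "reg \<tau> ''tail'' = reg \<sigma> ''tail''"
  shows "listed ys \<tau>"
  unfolding listed_def assms(2-4) using assms(1)[unfolded listed_def] .

lemma wp_push:
  assumes ys: "listed ys \<sigma>" and u: "reg \<sigma> ''u'' = u" "u < n" "u \<notin> set ys"
  shows "wp B push \<sigma> (\<lambda>t \<tau>. listed (ys @ [u]) \<tau> \<and> t = 3)"
proof -
  note D = listedD[OF ys]
  have "ys = map (arr \<sigma> ''ord'') [0..<length ys]" using D by simp
  moreover have "card (insert u (set ys)) \<le> card {..<n}" using D u by (intro card_mono) auto
  then have "length ys < n" using u distinct_card[OF D(2)] by simp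
  ultimately show ?thesis
    unfolding push_def using u D B_ge by (auto simp: listed_def nth_append less_Suc_eq in_set_conv_nth)
qed

definition is_path :: "nat list \<Rightarrow> bool" where
  "is_path ys \<longleftrightarrow> (\<forall>k. Suc k < length ys \<longrightarrow> ys ! Suc k \<in> nb (ys ! k))"

lemma is_path_snoc:
  assumes "is_path ys" "ys \<noteq> []" "u \<in> nb (last ys)"
  shows "is_path (ys @ [u])"
  unfolding is_path_def
proof (intro allI impI)
  fix k assume k: "Suc k < length (ys @ [u])"
  show "(ys @ [u]) ! Suc k \<in> nb ((ys @ [u]) ! k)"
  proof (cases "Suc k < length ys")
    case True
    then show ?thesis using assms(1) by (simp add: is_path_def nth_append)
  next
    case False
    then have "k = length ys - 1" using k by simp
    then show ?thesis using assms(2,3) by (simp add: nth_append last_conv_nth)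
  qed
qed

lemma wp_path_step:
  assumes inp: "input n E p \<sigma>" and ys: "listed ys \<sigma>" "is_path ys" "ys \<noteq> []" and go: "reg \<sigma> ''go'' = 1"
  shows "wp B path_step \<sigma> (\<lambda>t \<tau>. t \<le> 15 * (deg (last ys) + 1) \<and>
    (listed ys \<tau> \<and> nb (last ys) \<subseteq> set ys \<and> reg \<tau> ''go'' = 0 \<or>
     (\<exists>u. listed (ys @ [u]) \<tau> \<and> is_path (ys @ [u]) \<and> reg \<tau> ''go'' = 1)))"
proof -
  note D = listedD[OF ys(1)]
  define v where "v = last ys"
  have v: "arr \<sigma> ''ord'' (reg \<sigma> ''tail'' - 1) = v" "v < n"
    using D(5)[of "length ys - 1"] D(1,8) ys(3) by (auto simp: last_conv_nth v_def)
  let ?\<sigma> = "set_reg ''nx'' n (set_reg ''v'' v \<sigma>)"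
  have regn: "reg \<sigma> ''n'' = n" using inp by (simp add: input_def)
  have inp': "input n E p ?\<sigma>" using inp by (simp add: input_def)
  \<comment> \<open>\<open>nx\<close> holds some unlisted neighbour met so far, or \<open>n\<close>
    if there was none.\<close>
  let ?I = "\<lambda>D \<tau>. (reg \<tau> ''nx'' = n \<and> D \<subseteq> set ys) \<or> (reg \<tau> ''nx'' \<in> nb v - set ys)"
  have "wp B (for_nbr ''v'' scan_new) ?\<sigma> (\<lambda>t \<tau>. ?I (nb v) \<tau> \<and> t \<le> (3 + 2) * deg v + 2)"
  proof (rule wp_for_nbr[where I = ?I, OF inp'], goal_cases)
    case (10 D u \<tau>)
    then have e: "reg \<tau> ''n'' = n" "arr \<tau> ''pos'' = arr \<sigma> ''pos''" using regn by (auto simp: frame_def)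
    have un: "u < n" using 10 nb_less by blast
    then show ?case using 10(2,4,5) e D(7)[OF un] B_ge by (auto simp: scan_new_def)
  qed (use v in auto)
  then have "wp B (for_nbr ''v'' scan_new ;;
     If (Equal (Reg ''nx'') (Reg ''n'')) (Assign ''go'' (Const 0)) (Assign ''u'' (Reg ''nx'') ;; push)) ?\<sigma>
     (\<lambda>t \<tau>. 1 + (1 + t) \<le> 15 * (deg (last ys) + 1) \<and>
    (listed ys \<tau> \<and> nb (last ys) \<subseteq> set ys \<and> reg \<tau> ''go'' = 0 \<or>
     (\<exists>u. listed (ys @ [u]) \<tau> \<and> is_path (ys @ [u]) \<and> reg \<tau> ''go'' = 1)))"
    unfolding wp_Seq
  proof (rule wp_mono_frame, goal_cases)
    case (1 t \<tau>)
    then have t: "t \<le> 5 * deg v + 2" and e: "reg \<tau> ''n'' = n" "reg \<tau> ''go'' = 1" and I: "?I (nb v) \<tau>"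
      using regn go by (auto simp: frame_def)
    have ls: "listed ys \<tau>" using ys(1) by (rule listed_frame) (use 1 in \<open>auto simp: frame_def\<close>)
    show ?case
    proof (cases "reg \<tau> ''nx'' = n")
      case True
      then have "nb v \<subseteq> set ys" using I nb_less by blast
      moreover have "listed ys (set_reg ''go'' 0 \<tau>)" using ls by (rule listed_frame) auto
      ultimately show ?thesis using True e t B_ge by (auto simp: v_def)
    next
      case False
      let ?u = "reg \<tau> ''nx''"
      have u: "?u \<in> nb v" "?u \<notin> set ys" using I False by auto
      have un: "?u < n" using u nb_less by blast
      let ?\<tau> = "set_reg ''u'' ?u \<tau>"
      have "listed ys ?\<tau>" using ls by (rule listed_frame) auto
      from wp_push[OF this _ un u(2)]
      have "wp B push ?\<tau> (\<lambda>t \<tau>. listed (ys @ [?u]) \<tau> \<and> t = 3)" by simp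
      moreover have "is_path (ys @ [?u])" using is_path_snoc[OF ys(2,3)] u(1) by (simp add: v_def)
      ultimately have "wp B push ?\<tau> (\<lambda>t \<tau>. listed (ys @ [?u]) \<tau> \<and> t = 3 \<and> is_path (ys @ [?u]) \<and> reg \<tau> ''go'' = 1)"
        by (elim wp_mono_frame) (use e in \<open>auto simp: frame_def\<close>)
      then show ?thesis using False e t un B_ge by (auto simp: v_def elim!: wp_mono)
    qed
  qed
  then show ?thesis
    unfolding path_step_def using v regn B_ge
    by (intro wp_Assign_Seq[where k = v] wp_Assign_Seq[where k = n]) auto
qed

lemma wp_find_path:
  assumes inp: "input n E p \<sigma>" and pos: "\<And>v. v < n \<Longrightarrow> arr \<sigma> ''pos'' v = n"
  shows "wp B find_path \<sigma> (\<lambda>t \<tau>. t \<le> 30 * dsum {..<n} \<and> input n E p \<tau> \<and>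
    (\<exists>ys. listed ys \<tau> \<and> is_path ys \<and> ys \<noteq> [] \<and> nb (last ys) \<subseteq> set ys \<and> reg \<tau> ''len'' = length ys \<and>
       reg \<tau> ''l'' = last ys))"
proof -
  let ?b = "Equal (Reg ''go'') (Const 1)"
  let ?ys = "\<lambda>\<sigma>. map (arr \<sigma> ''ord'') [0..<reg \<sigma> ''tail'']"
  define I where "I = (\<lambda>\<tau> :: state. input n E p \<tau> \<and> (\<exists>ys. listed ys \<tau> \<and> is_path ys \<and> ys \<noteq> [] \<and>
     (reg \<tau> ''go'' = 1 \<or> nb (last ys) \<subseteq> set ys)))"
  \<comment> \<open>\<open>butlast\<close> is used because the last vertex of the path has not been
    scanned yet: its own scan pays for the next step.\<close>
  define F where "F = (\<lambda>\<tau> :: state. if reg \<tau> ''go'' = 1 then 16 * dsum ({..<n} - set (butlast (?ys \<tau>))) else 0)"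
  have n0: "0 < n" using n_ge by simp
  have W: "wp B (While ?b path_step) \<sigma>' (\<lambda>t \<tau>. I \<tau> \<and> \<not> test ?b \<tau> \<and> t \<le> F \<sigma>' + 1)" if "I \<sigma>'" for \<sigma>'
  proof (rule wp_While)
    fix \<tau> assume I: "I \<tau>" and t: "test ?b \<tau>"
    then obtain ys where ys: "input n E p \<tau>" "listed ys \<tau>" "is_path ys" "ys \<noteq> []" and go: "reg \<tau> ''go'' = 1"
      by (auto simp: I_def)
    note D = listedD[OF ys(2)]
    have dl: "last ys \<notin> set (butlast ys)" using D(2) ys(4)
      by (metis append_butlast_last_id distinct_append disjoint_iff list.set_intros(1))
    have "last ys \<in> {..<n} - set (butlast ys)" using D(3) last_in_set[OF ys(4)] dl by auto
    from dsum_remove[OF _ this]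
    have F: "F \<tau> = 16 * (deg (last ys) + 1) + 16 * dsum ({..<n} - set (butlast ys) - {last ys})"
      using go D(9) by (simp add: F_def)
    have S: "{..<n} - set (butlast ys) - {last ys} = {..<n} - set ys"
      using arg_cong[OF append_butlast_last_id[OF ys(4)], of set] by auto
    show "wp B path_step \<tau> (\<lambda>t \<tau>'. I \<tau>' \<and> t + 1 + F \<tau>' \<le> F \<tau>)"
    proof (rule wp_mono_frame[OF wp_path_step[OF ys go]], goal_cases)
      case (1 t \<tau>')
      have inp: "input n E p \<tau>'" using input_frame[OF ys(1) 1(2)] by simp
      from conjunct2[OF 1(1)] consider "listed ys \<tau>'" "nb (last ys) \<subseteq> set ys" "reg \<tau>' ''go'' = 0"
        | u where "listed (ys @ [u]) \<tau>'" "is_path (ys @ [u])" "reg \<tau>' ''go'' = 1" by (elim disjE exE conjE)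
      then show ?case
      proof cases
        case 1
        then show ?thesis using F \<open>t \<le> _ \<and> _\<close> inp ys(3,4) by (auto simp: I_def F_def)
      next
        case 2
        have "F \<tau>' = 16 * dsum ({..<n} - set ys)" using 2(3) listedD(9)[OF 2(1)] by (simp add: F_def)
        then show ?thesis using 2 F S \<open>t \<le> _ \<and> _\<close> inp by (auto simp: I_def)
      qed
    qed
  qed (rule that)
  let ?\<sigma> = "set_reg ''u'' 0 (set_reg ''tail'' 0 \<sigma>)"
  have "listed [] ?\<sigma>" using pos by (simp add: listed_def)
  from wp_push[OF this _ n0]
  have "wp B push ?\<sigma> (\<lambda>t \<tau>. listed [0] \<tau> \<and> t = 3)" by simp
  then show ?thesis
    unfolding find_path_def wp_Seq wp_Assign val.simps
  proof (intro conjI, simp, simp, elim wp_mono_frame, goal_cases)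
    case (1 t \<tau>)
    let ?\<tau> = "set_reg ''go'' 1 \<tau>"
    have "listed [0] ?\<tau>" using conjunct1[OF 1(2)] by (rule listed_frame) auto
    moreover have "input n E p ?\<tau>" using inp 1(3) by (auto simp: input_def frame_def)
    ultimately have I: "I ?\<tau>" by (auto simp: I_def is_path_def)
    have "F ?\<tau> \<le> 16 * dsum {..<n}" using dsum_mono[of "{..<n} - _"] by (simp add: F_def)
    moreover have "4 \<le> dsum {..<n}" using n_ge by (simp add: dsum_def sum.distrib sum_Suc)
    ultimately have Ft: "F ?\<tau> + 20 \<le> 30 * dsum {..<n}" by linarith
    have "wp B (While ?b path_step) ?\<tau> (\<lambda>t' \<tau>'. wp B (Assign ''len'' (Reg ''tail'')) \<tau>' (\<lambda>t'' \<tau>''.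
          wp B (Assign ''l'' (Get ''ord'' (Minus (Reg ''tail'') (Const 1)))) \<tau>'' (\<lambda>t''' \<tau>'''.
            8 + t' \<le> 30 * dsum {..<n} \<and> t'' = 1 \<and> t''' = 1 \<and> input n E p \<tau>''' \<and>
    (\<exists>ys. listed ys \<tau>''' \<and> is_path ys \<and> ys \<noteq> [] \<and> nb (last ys) \<subseteq> set ys \<and> reg \<tau>''' ''len'' = length ys \<and>
       reg \<tau>''' ''l'' = last ys))))"
    proof (rule wp_mono[OF W[OF I]], goal_cases)
      case (1 t' \<tau>')
      then obtain ys where ys: "input n E p \<tau>'" "listed ys \<tau>'" "is_path ys" "ys \<noteq> []" "nb (last ys) \<subseteq> set ys"
        by (auto simp: I_def)
      note D = listedD[OF ys(2)]
      have l: "arr \<tau>' ''ord'' (length ys - 1) = last ys" "last ys < n"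
        using D(5)[of "length ys - 1"] D(8)[of "length ys - 1"] ys(4) by (auto simp: last_conv_nth)
      have "listed ys (set_reg ''l'' a (set_reg ''len'' b \<tau>'))" for a b
        using ys(2) by (rule listed_frame) auto
      then show ?case using 1 ys D(1,4) l B_ge Ft by (auto simp: input_def)
    qed
    then show ?case using 1 B_ge by (auto elim!: wp_mono)
  qed
qed

section \<open>The search order\<close>

definition rooted :: "nat list \<Rightarrow> bool" where
  "rooted zs \<longleftrightarrow> (\<forall>j<length zs. 0 < j \<longrightarrow> (\<exists>i<j. zs ! i \<in> nb (zs ! j)))"

text \<open>The predecessor on the path serves as the earlier neighbour, so the search can start
  from the whole path as its queue.\<close>

lemma is_path_rooted: "is_path ys \<Longrightarrow> rooted ys"
  unfolding rooted_def is_path_def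
proof (intro allI impI, goal_cases)
  case (1 j)
  then show ?case using nb_sym[of "ys ! (j - 1)" "ys ! j"] 1(1)[rule_format, of "j - 1"]
    by (intro exI[of _ "j - 1"]) auto
qed

lemma rooted_snoc:
  assumes "rooted zs" "i < length zs" "u \<in> nb (zs ! i)"
  shows "rooted (zs @ [u])"
  unfolding rooted_def
proof (intro allI impI)
  fix j assume j: "j < length (zs @ [u])" "0 < j"
  show "\<exists>i<j. (zs @ [u]) ! i \<in> nb ((zs @ [u]) ! j)"
  proof (cases "j < length zs")
    case True
    then obtain k where "k < j" "zs ! k \<in> nb (zs ! j)" using assms(1) j by (auto simp: rooted_def)
    then show ?thesis using True by (auto simp: nth_append intro!: exI[of _ k])
  next
    case False
    then show ?thesis using j assms(2,3) nb_sym by (auto simp: nth_append intro!: exI[of _ i])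
  qed
qed

lemma wp_scan_push:
  assumes inp: "input n E p \<sigma>" and zs: "listed zs \<sigma>" "rooted zs" and k: "k < length zs" "reg \<sigma> ''v'' = zs ! k"
  shows "wp B (for_nbr ''v'' push_new) \<sigma> (\<lambda>t \<tau>. t \<le> 7 * deg (zs ! k) + 2 \<and>
    (\<exists>r. listed (zs @ r) \<tau> \<and> rooted (zs @ r) \<and> nb (zs ! k) \<subseteq> set (zs @ r)))"
proof -
  let ?v = "zs ! k"
  have v: "?v < n" using listedD(8)[OF zs(1) k(1)] .
  have regn: "reg \<sigma> ''n'' = n" using inp by (simp add: input_def)
  let ?I = "\<lambda>D \<tau>. \<exists>r. listed (zs @ r) \<tau> \<and> rooted (zs @ r) \<and> D \<subseteq> set (zs @ r)"
  have "wp B (for_nbr ''v'' push_new) \<sigma> (\<lambda>t \<tau>. ?I (nb ?v) \<tau> \<and> t \<le> (5 + 2) * deg ?v + 2)"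
  proof (rule wp_for_nbr[where I = ?I, OF inp], goal_cases)
    case (8 D j \<tau>)
    then obtain r where r: "listed (zs @ r) \<tau>" "rooted (zs @ r)" "D \<subseteq> set (zs @ r)" by blast
    have "listed (zs @ r) (set_reg ''k'' j \<tau>)" using r(1) by (rule listed_frame) auto
    then show ?case using r by blast
  next
    case 9
    then show ?case using zs by (auto intro: exI[of _ "[]"])
  next
    case (10 D u \<tau>)
    then obtain r where r: "listed (zs @ r) \<tau>" "rooted (zs @ r)" "D \<subseteq> set (zs @ r)" by blast
    have e: "reg \<tau> ''n'' = n" using 10 regn by (auto simp: frame_def)
    have un: "u < n" using 10 nb_less by blast
    note P = listedD(7)[OF r(1) un]
    let ?\<tau> = "set_reg ''u'' u \<tau>"
    have l: "listed (zs @ r) ?\<tau>" using r(1) by (rule listed_frame) auto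
    show ?case
    proof (cases "u \<in> set (zs @ r)")
      case True
      then have "insert u D \<subseteq> set (zs @ r)" using r(3) by blast
      then have "?I (insert u D) ?\<tau>" using l r(2) by blast
      then show ?thesis using True P e 10(5) un B_ge by (auto simp: push_new_def)
    next
      case False
      have "rooted ((zs @ r) @ [u])" using r(2) by (rule rooted_snoc[of _ k]) (use k 10(2) in \<open>auto simp: nth_append\<close>)
      moreover have "wp B push ?\<tau> (\<lambda>t \<tau>. listed ((zs @ r) @ [u]) \<tau> \<and> t = 3)"
        using wp_push[OF l _ un False] by simp
      ultimately have "wp B push ?\<tau> (\<lambda>t \<tau>. ?I (insert u D) \<tau> \<and> t = 3)"
        using r(3) by (elim wp_mono) (auto intro!: exI[of _ "r @ [u]"])
      then have "wp B push ?\<tau> (\<lambda>t \<tau>. ?I (insert u D) \<tau> \<and> 1 + (t + 1) \<le> 5)" by (rule wp_mono) simp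
      moreover have "arr \<tau> ''pos'' u = n" using False P by blast
      ultimately show ?thesis unfolding push_new_def wp_Seq wp_Assign wp_If using e 10(5) un B_ge by simp
    qed
  qed (use v k in auto)
  then show ?thesis by (rule wp_mono) auto
qed

lemma wp_search:
  assumes inp: "input n E p \<sigma>" and ys: "listed ys \<sigma>" "rooted ys" "ys \<noteq> []"
  shows "wp B search \<sigma> (\<lambda>t \<tau>. t \<le> 30 * dsum {..<n} \<and> input n E p \<tau> \<and>
    (\<exists>r. listed (ys @ r) \<tau> \<and> rooted (ys @ r) \<and> set (ys @ r) = {..<n} \<and> length (ys @ r) = n))"
proof -
  let ?b = "Less (Reg ''head'') (Reg ''tail'')"
  let ?c2 = "for_nbr ''v'' push_new ;; Assign ''head'' (Plus (Reg ''head'') (Const 1))"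
  let ?c = "Assign ''v'' (Get ''ord'' (Reg ''head'')) ;; ?c2"
  let ?ys = "\<lambda>\<sigma>. map (arr \<sigma> ''ord'') [0..<reg \<sigma> ''tail'']"
  define I where "I = (\<lambda>\<tau> :: state. input n E p \<tau> \<and> (\<exists>r. listed (ys @ r) \<tau> \<and> rooted (ys @ r) \<and>
     reg \<tau> ''head'' \<le> length (ys @ r) \<and> (\<forall>i<reg \<tau> ''head''. nb ((ys @ r) ! i) \<subseteq> set (ys @ r))))"
  \<comment> \<open>Only vertices before \<open>head\<close> have been scanned; the others still
    hold their share of the budget.\<close>
  define F where "F = (\<lambda>\<tau> :: state. 16 * dsum ({..<n} - set (take (reg \<tau> ''head'') (?ys \<tau>))))"
  let ?\<sigma> = "set_reg ''head'' 0 \<sigma>"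
  have "wp B (While ?b ?c) ?\<sigma> (\<lambda>t \<tau>. I \<tau> \<and> \<not> test ?b \<tau> \<and> t \<le> F ?\<sigma> + 1)"
  proof (rule wp_While)
    have "listed ys ?\<sigma>" using ys(1) by (rule listed_frame) auto
    then show "I ?\<sigma>" using inp ys(2) by (auto simp: I_def input_def intro!: exI[of _ "[]"])
  next
    fix \<tau> assume I: "I \<tau>" and t: "test ?b \<tau>"
    then obtain r where inp: "input n E p \<tau>" and r: "listed (ys @ r) \<tau>" "rooted (ys @ r)"
      and nb: "\<forall>i<reg \<tau> ''head''. nb ((ys @ r) ! i) \<subseteq> set (ys @ r)" by (auto simp: I_def)
    define zs where "zs = ys @ r"
    note r = r[folded zs_def] and nb = nb[folded zs_def]
    note D = listedD[OF r(1)]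
    let ?k = "reg \<tau> ''head''"
    have k: "?k < length zs" using t D(1) by simp
    have nt: "zs ! ?k \<notin> set (take ?k zs)"
      using D(2) k by (auto simp: in_set_conv_nth nth_eq_iff_index_eq)
    have "zs ! ?k \<in> {..<n} - set (take ?k zs)" using D(8)[OF k] nt by auto
    from dsum_remove[OF _ this]
    have F: "F \<tau> = 16 * (deg (zs ! ?k) + 1) + 16 * dsum ({..<n} - set (take ?k zs) - {zs ! ?k})"
      using D(9) by (simp add: F_def)
    have S: "{..<n} - set (take ?k zs) - {zs ! ?k} = {..<n} - set (take (Suc ?k) zs)"
      using k by (auto simp: take_Suc_conv_app_nth)
    let ?\<tau> = "set_reg ''v'' (zs ! ?k) \<tau>"
    have "input n E p ?\<tau>" using inp by (simp add: input_def)
    moreover have "listed zs ?\<tau>" using r(1) by (rule listed_frame) auto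
    ultimately have "wp B (for_nbr ''v'' push_new) ?\<tau> (\<lambda>t \<tau>. t \<le> 7 * deg (zs ! ?k) + 2 \<and>
      (\<exists>r. listed (zs @ r) \<tau> \<and> rooted (zs @ r) \<and> nb (zs ! ?k) \<subseteq> set (zs @ r)))"
      using r(2) k by (intro wp_scan_push) auto
    then have "wp B ?c2 ?\<tau> (\<lambda>t \<tau>'. I \<tau>' \<and> 1 + t + 1 + F \<tau>' \<le> F \<tau>)"
      unfolding wp_Seq
    proof (rule wp_mono_frame, goal_cases)
      case (1 t1 \<tau>1)
      then obtain r' where r': "listed (zs @ r') \<tau>1" "rooted (zs @ r')" "nb (zs ! ?k) \<subseteq> set (zs @ r')"
        and t1: "t1 \<le> 7 * deg (zs ! ?k) + 2" by blast
      have e: "reg \<tau>1 ''head'' = ?k" using 1(2) by (simp add: frame_def)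
      let ?\<tau>1 = "set_reg ''head'' (Suc ?k) \<tau>1"
      have l: "listed (zs @ r') ?\<tau>1" using r'(1) by (rule listed_frame) auto
      have "input n E p ?\<tau>1" using inp 1(2) by (auto simp: input_def frame_def)
      moreover have "nb ((zs @ r') ! i) \<subseteq> set (zs @ r')" if "i < Suc ?k" for i
      proof (cases "i = ?k")
        case False
        then have "i < ?k" using that by simp
        then show ?thesis using nb k by (auto simp: nth_append)
      qed (use r'(3) k in \<open>simp add: nth_append\<close>)
      ultimately have "I ?\<tau>1"
        unfolding I_def append_assoc[symmetric] using l r'(2) k
        by (intro conjI exI[of _ "r @ r'"]) (simp_all add: zs_def)
      moreover have "F ?\<tau>1 = 16 * dsum ({..<n} - set (take (Suc ?k) zs))"
        using listedD(9)[OF l] k by (simp add: F_def)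
      then have "1 + (t1 + 1) + 1 + F ?\<tau>1 \<le> F \<tau>" using F S t1 by simp
      ultimately show ?case using e k D(4) B_ge by simp
    qed
    then show "wp B ?c \<tau> (\<lambda>t \<tau>'. I \<tau>' \<and> t + 1 + F \<tau>' \<le> F \<tau>)"
      using D(5)[OF k] D(8)[OF k] B_ge by (intro wp_Assign_Seq[where k = "zs ! ?k"]) auto
  qed
  then have "wp B (While ?b ?c) ?\<sigma> (\<lambda>t \<tau>. 1 + t \<le> 30 * dsum {..<n} \<and> input n E p \<tau> \<and>
    (\<exists>r. listed (ys @ r) \<tau> \<and> rooted (ys @ r) \<and> set (ys @ r) = {..<n} \<and> length (ys @ r) = n))"
  proof (rule wp_mono, goal_cases)
    case (1 t \<tau>)
    then obtain r where inp: "input n E p \<tau>" and r: "listed (ys @ r) \<tau>" "rooted (ys @ r)"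
      and nb: "\<forall>i<reg \<tau> ''head''. nb ((ys @ r) ! i) \<subseteq> set (ys @ r)" by (auto simp: I_def)
    note D = listedD[OF r(1)]
    have hd: "length (ys @ r) \<le> reg \<tau> ''head''" using 1 D(1) by simp
    \<comment> \<open>When \<open>head\<close> has reached \<open>tail\<close>, every listed vertex
      has been scanned, so the listed set is closed under neighbours.\<close>
    have "set (ys @ r) = {..<n}"
    proof (rule nb_closed_set)
      fix u v assume "u \<in> set (ys @ r)" "v \<in> nb u"
      moreover from this obtain i where "i < length (ys @ r)" "(ys @ r) ! i = u" by (meson in_set_conv_nth)
      ultimately show "v \<in> set (ys @ r)" using nb[rule_format, of i] hd by auto
    qed (use ys(3) D(3) in auto)
    moreover from this have "length (ys @ r) = n" using distinct_card[OF D(2)] by simp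
    moreover have "F ?\<sigma> \<le> 16 * dsum {..<n}" by (simp add: F_def)
    moreover have "4 \<le> dsum {..<n}" using n_ge by (simp add: dsum_def sum.distrib sum_Suc)
    ultimately show ?case using 1 r inp by auto
  qed
  then show ?thesis unfolding search_def by (intro wp_Assign_Seq[where k = 0]) auto
qed

text \<open>Forgets the history: the current configuration becomes the start of a new, empty
  walk.\<close>

lemma tracks_reset: "tracks st vs \<sigma> \<Longrightarrow> tracks (arr \<sigma> ''part'', reg \<sigma> ''h'') [] \<sigma>"
  by (auto simp: tracks_def)

lemma tracks_hole: "tracks st vs \<sigma> \<Longrightarrow> reg \<sigma> ''done'' = 0 \<Longrightarrow> reg \<sigma> ''h'' = snd (foldl mv st vs)"
  by (auto simp: tracks_def dest: arg_cong[where f = snd])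

lemma dsum_ge: "4 \<le> dsum {..<n}"
  using n_ge by (simp add: dsum_def sum.distrib sum_Suc)

lemma deg_le_dsum: "v < n \<Longrightarrow> deg v + 1 \<le> dsum {..<n}"
  using dsum_remove[of "{..<n}" v] by simp

text \<open>In reverse search order each vertex still has an uncoloured earlier neighbour when its
  turn comes, so some part accepts it. Only the root has none and is left out.\<close>

lemma wp_greedy_loop:
  assumes rd: "ready \<sigma>" and part: "\<And>v. v < n \<Longrightarrow> arr \<sigma> ''part'' v = n"
    and zs: "listed zs \<sigma>" "rooted zs" "length zs = n" and j: "reg \<sigma> ''j'' = n"
  shows "wp B (While (Less (Const 1) (Reg ''j''))
       (Assign ''j'' (Minus (Reg ''j'') (Const 1)) ;; Assign ''h'' (Get ''ord'' (Reg ''j'')) ;; try_hole)) \<sigma>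
     (\<lambda>t \<tau>. t \<le> 30 * dsum {..<n} + 1 \<and> ready \<tau> \<and> partial (arr \<tau> ''part'') ({..<n} - {zs ! 0}))"
    (is "wp B (While ?b ?c) \<sigma> _")
proof -
  define I where "I = (\<lambda>\<tau> :: state. ready \<tau> \<and> arr \<tau> ''ord'' = arr \<sigma> ''ord'' \<and> 0 < reg \<tau> ''j'' \<and> reg \<tau> ''j'' \<le> n \<and>
     partial (arr \<tau> ''part'') (set (drop (reg \<tau> ''j'') zs)))"
  define F where "F = (\<lambda>\<tau> :: state. 30 * dsum (set (take (reg \<tau> ''j'') zs)))"
  note D = listedD[OF zs(1)]
  have "wp B (While ?b ?c) \<sigma> (\<lambda>t \<tau>. I \<tau> \<and> \<not> test ?b \<tau> \<and> t \<le> F \<sigma> + 1)"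
  proof (rule wp_While)
    show "I \<sigma>" using rd part zs(3) j n_ge by (auto simp: I_def partial_def)
  next
    fix \<tau> assume I: "I \<tau>" and t: "test ?b \<tau>"
    define j where "j = reg \<tau> ''j'' - 1"
    have j: "reg \<tau> ''j'' = Suc j" "0 < j" "j < n" using I t by (auto simp: I_def j_def)
    let ?h = "zs ! j" and ?x = "arr \<tau> ''part''"
    let ?\<tau> = "set_reg ''h'' ?h (set_reg ''j'' j \<tau>)"
    have hn: "?h < n" and ordj: "arr \<tau> ''ord'' j = ?h" using D(5,8)[of j] j zs(3) I by (auto simp: I_def)
    have x: "partial ?x (set (drop (Suc j) zs))" using I j by (simp add: I_def)
    have hU: "zs ! i \<notin> set (drop (Suc j) zs)" if "i \<le> j" for i
      using D(2) that j zs(3) by (auto simp: in_set_conv_nth nth_eq_iff_index_eq)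
    obtain i where i: "i < j" "zs ! i \<in> nb ?h" using zs(2,3) j by (auto simp: rooted_def)
    have "?x (zs ! i) = n" using x hU[of i] i(1) D(8)[of i] j zs(3) by (auto simp: partial_def)
    then have ns: "\<not> stuck ?x ?h" using not_stuck_uncoloured[OF hn i(2)] by blast
    have rd': "ready ?\<tau>" using I by (auto simp: I_def ready_def input_def)
    have F: "F \<tau> = 30 * (deg ?h + 1) + 30 * dsum (set (take j zs))"
    proof -
      have "?h \<in> set (take (Suc j) zs)" using j zs(3) by (simp add: take_Suc_conv_app_nth)
      moreover have "set (take (Suc j) zs) - {?h} = set (take j zs)"
        using D(2) j zs(3) by (auto simp: take_Suc_conv_app_nth in_set_conv_nth nth_eq_iff_index_eq)
      ultimately show ?thesis using dsum_remove[of "set (take (Suc j) zs)" ?h] j by (simp add: F_def)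
    qed
    have "wp B try_hole ?\<tau> (\<lambda>t \<tau>'. I \<tau>' \<and> 1 + (1 + t) + 1 + F \<tau>' \<le> F \<tau>)"
    proof (rule wp_mono_frame[OF wp_try_hole[OF rd' _ hn]], simp, goal_cases)
      case (1 t \<tau>')
      from 1 ns obtain k where k: "k < length p" "k < n" "cnt ?x ?h k \<le> p ! k" "arr \<tau>' ''part'' = ?x(?h := k)"
        by auto
      have "partial (arr \<tau>' ''part'') (insert ?h (set (drop (Suc j) zs)))"
        unfolding k(4) using hU[of j] by (intro partial_insert[OF x hn]) (use k in auto)
      moreover have "insert ?h (set (drop (Suc j) zs)) = set (drop j zs)"
        using j zs(3) by (simp add: Cons_nth_drop_Suc[symmetric])
      moreover have "reg \<tau>' ''j'' = j" "arr \<tau>' ''ord'' = arr \<tau> ''ord''" using 1(2) by (auto simp: frame_def)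
      ultimately show ?case using 1(1) I j F by (auto simp: I_def F_def)
    qed
    then show "wp B ?c \<tau> (\<lambda>t \<tau>'. I \<tau>' \<and> t + 1 + F \<tau>' \<le> F \<tau>)"
      using j hn ordj B_ge by (intro wp_Assign_Seq[where k = j] wp_Assign_Seq[where k = ?h]) auto
  qed
  then show ?thesis
  proof (rule wp_mono, goal_cases)
    case (1 t \<tau>)
    then have j1: "reg \<tau> ''j'' = 1" by (auto simp: I_def)
    have ne: "zs \<noteq> []" using zs(3) n_ge by auto
    then have "set zs = insert (zs ! 0) (set (drop 1 zs))" "zs ! 0 \<notin> set (drop 1 zs)"
      using D(2) by (cases zs; simp)+
    moreover have "set zs = {..<n}"
      using card_subset_eq[OF _ D(3)] distinct_card[OF D(2)] zs(3) by simp
    ultimately have "set (drop 1 zs) = {..<n} - {zs ! 0}" by auto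
    moreover have "F \<sigma> \<le> 30 * dsum {..<n}" using j zs(3) D(3) dsum_mono by (simp add: F_def)
    ultimately show ?case using 1 j1 by (auto simp: I_def)
  qed
qed

lemma wp_greedy:
  assumes rd: "ready \<sigma>" and part: "\<And>v. v < n \<Longrightarrow> arr \<sigma> ''part'' v = n"
    and zs: "listed zs \<sigma>" "rooted zs" "length zs = n"
    and len: "reg \<sigma> ''len'' = len" "0 < len" "len \<le> n" "is_path (take len zs)"
  shows "wp B greedy \<sigma> (\<lambda>t \<tau>. t \<le> 100 * dsum {..<n} \<and> tracks (arr \<tau> ''part'', reg \<tau> ''h'') [] \<tau> \<and>
    (reg \<tau> ''done'' = 0 \<longrightarrow> reg \<tau> ''h'' = zs ! (len - 1)))"
proof -
  note D = listedD[OF zs(1)]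
  let ?W = "While (Less (Const 1) (Reg ''j''))
       (Assign ''j'' (Minus (Reg ''j'') (Const 1)) ;; Assign ''h'' (Get ''ord'' (Reg ''j'')) ;; try_hole)"
  let ?R = "If (Less (Const 1) (Reg ''len'')) (walk (Const 1) (Minus (Reg ''len'') (Const 1))) Skip"
  let ?Q = "\<lambda>t \<tau>. t \<le> 100 * dsum {..<n} \<and> tracks (arr \<tau> ''part'', reg \<tau> ''h'') [] \<tau> \<and>
    (reg \<tau> ''done'' = 0 \<longrightarrow> reg \<tau> ''h'' = zs ! (len - 1))"
  let ?\<sigma> = "set_reg ''j'' n \<sigma>"
  have h0: "zs ! 0 < n" using D(8)[of 0] zs(3) n_ge by simp
  have "ready ?\<sigma>" using rd by (auto simp: ready_def input_def)
  moreover have "listed zs ?\<sigma>" using zs(1) by (rule listed_frame) auto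
  ultimately have W: "wp B ?W ?\<sigma> (\<lambda>t \<tau>. t \<le> 30 * dsum {..<n} + 1 \<and> ready \<tau> \<and>
     partial (arr \<tau> ''part'') ({..<n} - {zs ! 0}))"
    using wp_greedy_loop[of ?\<sigma> zs] part zs(2,3) by simp
  have "wp B (?W ;; Assign ''h'' (Get ''ord'' (Const 0)) ;; try_hole ;; ?R) ?\<sigma> (\<lambda>t. ?Q (1 + t))"
    unfolding wp_Seq[of _ ?W]
  proof (rule wp_mono_frame[OF W], goal_cases)
    case (1 t1 \<tau>1)
    have ord: "arr \<tau>1 ''ord'' = arr \<sigma> ''ord''" "reg \<tau>1 ''len'' = len" using 1(2) len by (auto simp: frame_def)
    let ?\<tau>1 = "set_reg ''h'' (zs ! 0) \<tau>1"
    have "ready ?\<tau>1" using 1(1) by (auto simp: ready_def input_def)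
    then have T: "wp B try_hole ?\<tau>1 (\<lambda>t \<tau>. tracks (arr \<tau>1 ''part'', zs ! 0) [] \<tau> \<and> t \<le> 20 * (deg (zs ! 0) + 1))"
      using wp_try_tracks[of ?\<tau>1 "zs ! 0"] h0 1(1) by simp
    have "wp B (try_hole ;; ?R) ?\<tau>1 (\<lambda>t. ?Q (1 + (t1 + (1 + t))))"
      unfolding wp_Seq
    proof (rule wp_mono_frame[OF T], goal_cases)
      case (1 t2 \<tau>2)
      let ?st = "(arr \<tau>1 ''part'', zs ! 0)"
      have ord2: "arr \<tau>2 ''ord'' = arr \<sigma> ''ord''" "reg \<tau>2 ''len'' = len" using 1(2) ord by (auto simp: frame_def)
      have tr: "tracks ?st [] \<tau>2" and t2: "t2 \<le> 20 * dsum {..<n}"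
        using 1(1) deg_le_dsum[OF h0] by auto
      have t1: "t1 \<le> 30 * dsum {..<n} + 1" using \<open>t1 \<le> _ \<and> _\<close> by blast
      show ?case
      proof (cases "1 < len")
        case False
        \<comment> \<open>The path is a single vertex, so the hole already stands at its
          end.\<close>
        then have "len = 1" using len(2) by simp
        then show ?thesis
          using ord2 tracks_reset[OF tr] tracks_hole[OF tr] t1 t2 dsum_ge by simp
      next
        case True
        have "wp B (walk (Const 1) (Minus (Reg ''len'') (Const 1))) \<tau>2
          (\<lambda>t \<tau>. tracks ?st ([] @ map ((!) zs) (idx 1 (len - 1))) \<tau> \<and> t \<le> 30 * dsum {..<n} + 10)"
        proof (rule wp_walk[OF tr])
          fix k assume k: "min 1 (len - 1) \<le> k" "k < max 1 (len - 1)"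
          then show "zs ! Suc k \<in> nb (zs ! k)" using len(4) True zs(3) len(3) by (auto simp: is_path_def)
        next
          show "zs ! 1 \<in> nb (snd (foldl mv ?st []))"
            using len(4)[unfolded is_path_def, rule_format, of 0] True zs(3) len(3) by simp
        qed (use ord2 D zs(3) len True in auto)
        then have "wp B (walk (Const 1) (Minus (Reg ''len'') (Const 1))) \<tau>2 (\<lambda>t. ?Q (1 + (t1 + (1 + (t2 + (t + 1))))))"
        proof (rule wp_mono, goal_cases)
          case (1 t \<tau>)
          then have tr3: "tracks ?st (map ((!) zs) (idx 1 (len - 1))) \<tau>" by simp
          have "snd (foldl mv ?st (map ((!) zs) (idx 1 (len - 1)))) = zs ! (len - 1)"
            by (subst snd_foldl_mv) (simp_all add: last_map)
          then show ?case using 1 tracks_reset[OF tr3] tracks_hole[OF tr3] t1 t2 dsum_ge by simp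
        qed
        then show ?thesis using True ord2 by simp
      qed
    qed
    then show ?case using D(5)[of 0] zs(3) n_ge h0 ord B_ge by (intro wp_Assign_Seq[where k = "zs ! 0"]) auto
  qed
  moreover have "reg \<sigma> ''n'' = n" using rd by (simp add: ready_def input_def)
  ultimately show ?thesis unfolding greedy_def using B_ge by (intro wp_Assign_Seq[where k = n]) auto
qed

definition geometry :: "nat list \<Rightarrow> nat \<Rightarrow> state \<Rightarrow> bool" where
  "geometry zs len \<sigma> \<longleftrightarrow> listed zs \<sigma> \<and> length zs = n \<and> reg \<sigma> ''len'' = len \<and> 0 < len \<and> len \<le> n \<and>
     is_path (take len zs) \<and> reg \<sigma> ''l'' = zs ! (len - 1) \<and> nb (zs ! (len - 1)) \<subseteq> set (take len zs)"

lemma wp_prepare: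
  assumes inp: "input n E p \<sigma>"
  shows "wp B prepare \<sigma> (\<lambda>t \<tau>. t \<le> 200 * dsum {..<n} \<and> (\<exists>zs len. geometry zs len \<tau>) \<and>
     tracks (arr \<tau> ''part'', reg \<tau> ''h'') [] \<tau> \<and> (reg \<tau> ''done'' = 0 \<longrightarrow> reg \<tau> ''h'' = reg \<tau> ''l'') \<and>
     (\<forall>v\<le>n. arr \<tau> ''mark'' v = 0 \<and> arr \<tau> ''mk'' v = 0))"
  unfolding prepare_def wp_Seq
proof (rule wp_mono_frame[OF wp_init_arrays[OF inp]], goal_cases)
  case (1 t1 \<tau>1)
  then have i1: "input n E p \<tau>1" and t1: "t1 \<le> 20 * dsum {..<n}"
    and a1: "\<And>v. v \<le> n \<Longrightarrow> arr \<tau>1 ''part'' v = n \<and> arr \<tau>1 ''cnt'' v = 0 \<and> arr \<tau>1 ''pos'' v = n \<and> arr \<tau>1 ''mark'' v = 0 \<and> arr \<tau>1 ''mk'' v = 0"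
    by auto
  show ?case
  proof (rule wp_mono_frame[OF wp_find_path[OF i1]], goal_cases)
    case (1 v)
    then show ?case using a1[of v] by simp
  next
    case (2 t2 \<tau>2)
    then obtain ys where i2: "input n E p \<tau>2" and t2: "t2 \<le> 30 * dsum {..<n}"
      and ys: "listed ys \<tau>2" "is_path ys" "ys \<noteq> []" "nb (last ys) \<subseteq> set ys" "reg \<tau>2 ''len'' = length ys"
        "reg \<tau>2 ''l'' = last ys" by blast
    note f2 = 2(2)
    from wp_search[OF i2 ys(1) is_path_rooted[OF ys(2)] ys(3)] show ?case
    proof (rule wp_mono_frame, goal_cases)
      case (1 t3 \<tau>3)
      then obtain r where i3: "input n E p \<tau>3" and t3: "t3 \<le> 30 * dsum {..<n}"
        and zs: "listed (ys @ r) \<tau>3" "rooted (ys @ r)" "length (ys @ r) = n" by blast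
      note f3 = 1(2)
      have eq: "arr \<tau>3 a = arr \<tau>1 a" if "a \<notin> {''pos'', ''ord''}" for a
        using f2 f3 that by (simp add: frame_def)
      have eq': "reg \<tau>3 ''len'' = length ys" "reg \<tau>3 ''l'' = last ys"
        using f3 ys(5,6) by (auto simp: frame_def)
      have r3: "ready \<tau>3" using i3 a1 by (auto simp: ready_def eq)
      have tk: "take (length ys) (ys @ r) = ys" by simp
      have ln: "(ys @ r) ! (length ys - 1) = last ys" using ys(3) by (simp add: nth_append last_conv_nth)
      have "wp B greedy \<tau>3 (\<lambda>t \<tau>. t \<le> 100 * dsum {..<n} \<and> tracks (arr \<tau> ''part'', reg \<tau> ''h'') [] \<tau> \<and>
          (reg \<tau> ''done'' = 0 \<longrightarrow> reg \<tau> ''h'' = (ys @ r) ! (length ys - 1)))"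
        using zs(3) ys(2,3) by (intro wp_greedy[OF r3 _ zs]) (auto simp: eq eq' a1)
      then show ?case
      proof (rule wp_mono_frame, goal_cases)
        case (1 t4 \<tau>4)
        have "listed (ys @ r) \<tau>4" using zs(1) by (rule listed_frame) (use 1(2) in \<open>auto simp: frame_def\<close>)
        then have "geometry (ys @ r) (length ys) \<tau>4"
          unfolding geometry_def tk ln using zs(3) ys(2-4) eq' 1(2) by (auto simp: frame_def)
        moreover have "arr \<tau>4 ''mark'' = arr \<tau>1 ''mark''" "arr \<tau>4 ''mk'' = arr \<tau>1 ''mk''" "reg \<tau>4 ''l'' = last ys"
          using 1(2) eq eq' by (auto simp: frame_def)
        ultimately show ?case using 1(1) t1 t2 t3 a1 ln by auto
      qed
    qed
  qed
qed

end

section \<open>Rotations that free the hole\<close>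

lemma length_idx: "length (idx i j) = Suc (max i j - min i j)"
  by (auto simp: idx_def)

lemma nth_idx_up: "i \<le> j \<Longrightarrow> t \<le> j - i \<Longrightarrow> idx i j ! t = i + t"
  by (auto simp: idx_def simp del: upt_Suc)

lemma nth_idx_down: "j \<le> i \<Longrightarrow> t \<le> i - j \<Longrightarrow> idx i j ! t = i - t"
  by (auto simp: idx_def rev_nth simp del: upt_Suc)

text \<open>The path occupies the indices up to \<open>K\<close>, and its last vertex has all its
  neighbours there; the rest of \<open>zs\<close> is the remainder of the search order.\<close>

locale route = machine +
  fixes zs :: "nat list" and K :: nat
  assumes dist: "distinct zs" and zs_less: "set zs \<subseteq> {..<n}" and K_less: "K < length zs"
    and path: "\<And>k. k < K \<Longrightarrow> zs ! Suc k \<in> nb (zs ! k)"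
    and closed: "nb (zs ! K) \<subseteq> set (take (Suc K) zs)"
begin

section \<open>The tip, its neighbours on the path, and rotations\<close>

definition tip :: nat where "tip = zs ! K"

definition NI :: "nat set" where "NI = {i. i < K \<and> zs ! i \<in> nb tip}"

lemma zs_eq: "i \<le> K \<Longrightarrow> j \<le> K \<Longrightarrow> zs ! i = zs ! j \<longleftrightarrow> i = j"
  using dist K_less by (simp add: nth_eq_iff_index_eq)

lemma zs_tip: "i < K \<Longrightarrow> zs ! i \<noteq> tip"
  using zs_eq[of i K] by (simp add: tip_def)

lemma zs_n: "i \<le> K \<Longrightarrow> zs ! i < n"
  using zs_less K_less nth_mem[of i zs] by (auto simp: subset_iff)

lemma nb_tip: "nb tip = (!) zs ` NI"
proof
  show "nb tip \<subseteq> (!) zs ` NI"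
  proof
    fix u assume u: "u \<in> nb tip"
    then have "u \<in> set (take (Suc K) zs)" using closed by (auto simp: tip_def)
    then obtain i where i: "i < Suc K" "u = zs ! i" by (auto simp: in_set_conv_nth)
    moreover have "i \<noteq> K" using u i nb_irrefl by (auto simp: tip_def)
    ultimately show "u \<in> (!) zs ` NI" using u by (auto simp: NI_def)
  qed
qed (auto simp: NI_def)

lemma card_NI: "card NI = deg tip"
proof -
  have "inj_on ((!) zs) NI" by (rule inj_onI) (use zs_eq in \<open>auto simp: NI_def\<close>)
  then show ?thesis by (simp add: deg_def nb_tip card_image)
qed

lemma finite_NI [simp]: "finite NI" by (simp add: NI_def)

lemma NI_less: "i \<in> NI \<Longrightarrow> i < K" by (simp add: NI_def)

lemma pred_NI: "0 < K \<Longrightarrow> K - 1 \<in> NI"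
  using path[of "K - 1"] nb_sym by (auto simp: NI_def tip_def)

definition seg :: "nat \<Rightarrow> nat \<Rightarrow> nat list" where "seg i j = map ((!) zs) (idx i j)"

text \<open>The hole leaves the tip for \<open>zs ! i\<close>, follows the path to
  \<open>zs ! j\<close> and returns. For \<open>i\<close> and \<open>j\<close> in \<open>NI\<close>
  this is a cycle of the graph, but the formulas below hold without adjacency.\<close>

definition rnd :: "(nat \<Rightarrow> nat) \<Rightarrow> nat \<Rightarrow> nat \<Rightarrow> nat \<Rightarrow> nat" where
  "rnd x i j = fst (foldl mv (x, tip) (seg i j @ [tip]))"

context
  fixes x :: "nat \<Rightarrow> nat" and i j :: nat
  assumes ij: "i < K" "j < K" and xl: "x tip = n"
begin

lemma seg_cycle: "distinct (tip # seg i j)" "seg i j \<noteq> []"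
proof -
  have "inj_on ((!) zs) (set (idx i j))" by (rule inj_onI) (use zs_eq ij in \<open>auto simp: set_idx\<close>)
  moreover have "tip \<notin> set (seg i j)" 
  proof
    assume "tip \<in> set (seg i j)"
    then obtain m where "m \<le> max i j" "tip = zs ! m" by (auto simp: seg_def set_idx)
    then show False using zs_tip[of m] ij by (auto simp: max_def split: if_splits)
  qed
  ultimately show "distinct (tip # seg i j)" by (simp add: seg_def distinct_map)
qed (simp add: seg_def)

lemma foldl_rnd: "foldl mv (x, tip) (seg i j @ [tip]) = (rnd x i j, tip)"
  unfolding rnd_def using foldl_mv_cycle(5)[where x = x, OF seg_cycle xl] .

lemma rnd_tip: "rnd x i j tip = n"
  unfolding rnd_def by (rule foldl_mv_cycle(3)[where x = x, OF seg_cycle xl])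

lemma rnd_last: "rnd x i j (zs ! j) = x (zs ! i)"
  using foldl_mv_cycle(2)[where x = x, OF seg_cycle xl] unfolding rnd_def by (simp add: seg_def last_map hd_map)

lemma rnd_other: "u \<notin> (!) zs ` {min i j..max i j} \<Longrightarrow> rnd x i j u = x u"
  using foldl_mv_cycle(4)[where x = x, OF seg_cycle xl, of u] unfolding rnd_def by (simp add: seg_def set_idx)

lemma rnd_other_nth: "m \<le> K \<Longrightarrow> m < min i j \<or> max i j < m \<Longrightarrow> rnd x i j (zs ! m) = x (zs ! m)"
  by (rule rnd_other) (use zs_eq ij in \<open>auto\<close>)

lemma rnd_up:
  assumes "i \<le> m" "m < j"
  shows "rnd x i j (zs ! m) = x (zs ! Suc m)"
proof -
  have "m - i < length (seg i j) - 1" using assms by (simp add: seg_def length_idx)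
  from foldl_mv_cycle(1)[where x = x, OF seg_cycle xl this]
  show ?thesis unfolding rnd_def using assms by (simp add: seg_def length_idx nth_idx_up)
qed

lemma rnd_down:
  assumes "j < m" "m \<le> i"
  shows "rnd x i j (zs ! m) = x (zs ! (m - 1))"
proof -
  have "i - m < length (seg i j) - 1" using assms by (simp add: seg_def length_idx)
  from foldl_mv_cycle(1)[where x = x, OF seg_cycle xl this]
  show ?thesis unfolding rnd_def using assms by (simp add: seg_def length_idx nth_idx_down)
qed

end

text \<open>Running round the cycle in the opposite sense undoes the rotation. The gap script uses
  this to try a second rotation from the same colouring.\<close>

lemma rnd_inverse:
  assumes ij: "i < K" "j < K" and xl: "x tip = n"
  shows "rnd (rnd x i j) j i = x"
proof
  fix u
  let ?y = "rnd x i j"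
  note yl = rnd_tip[of i j x, OF ij xl]
  show "rnd ?y j i u = x u"
  proof (cases "u \<in> (!) zs ` {min i j..max i j}")
    case False
    then have "rnd ?y j i u = ?y u" using rnd_other[of j i ?y u] ij yl by (simp add: min.commute max.commute)
    then show ?thesis using rnd_other[of i j x u] ij xl False by simp
  next
    case True
    then obtain m where m: "u = zs ! m" "min i j \<le> m" "m \<le> max i j" by auto
    consider "m = i" | "i < j" "i < m" "m \<le> j" | "j < i" "j \<le> m" "m < i" using m by linarith
    then show ?thesis
    proof cases
      case 1
      then show ?thesis using m rnd_last[of j i ?y] rnd_last[of i j x] ij xl yl by simp
    next
      case 2
      then show ?thesis using m rnd_down[of j i ?y m] rnd_up[of i j x "m - 1"] ij xl yl by simp
    next
      case 3
      then show ?thesis using m rnd_up[of j i ?y m] rnd_down[of i j x "Suc m"] ij xl yl by simp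
    qed
  qed
qed

section \<open>Counts in jammed configurations and the two contradictions\<close>

lemma cnt_sum: "cnt x h c = (\<Sum>u\<in>nb h. if x u = c then 1 else 0)"
  unfolding cnt_def by (simp add: sum.If_cases Int_def)

lemma jam_colour:
  assumes "jam (x, h)" "u < n" "u \<noteq> h"
  shows "x u < length p" "x u < n"
  using assms by (auto simp: jam_def hole_def partial_def)

lemma jam_cnt: "jam (x, h) \<Longrightarrow> c < length p \<Longrightarrow> cnt x h c = p ! c + 1"
  using stuck_cnt by (auto simp: jam_def hole_def)

lemma jam_hole_value: "jam (x, h) \<Longrightarrow> x h = n"
  by (auto simp: jam_def hole_def partial_def)

text \<open>
  Rotating along a gap in the neighbourhood of the tip replaces, among the colours seen by the tip, that of
  the last vertex by that of the second one.
\<close>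

lemma gap_colour:
  assumes x: "jam (x, tip)" and x': "jam (rnd x i j, tip)"
    and ij: "i \<in> NI" "j \<in> NI" and gap: "\<And>m. m \<in> NI \<Longrightarrow> min i j < m \<Longrightarrow> m < max i j \<Longrightarrow> False"
    and k: "k = (if i < j then i + 1 else i - 1)" "min i j < k" "k < max i j"
  shows "x (zs ! j) = x (zs ! k)"
proof (rule ccontr)
  assume ne: "x (zs ! j) \<noteq> x (zs ! k)"
  let ?y = "rnd x i j" and ?c = "x (zs ! j)"
  let ?f = "\<lambda>y u. if y u = ?c then 1 else 0 :: nat"
  let ?R = "nb tip - {zs ! i} - {zs ! j}"
  have K: "i < K" "j < K" using ij NI_less by auto
  have xl: "x tip = n" using jam_hole_value[OF x] .
  have c: "?c < length p" using jam_colour[OF x, of "zs ! j"] zs_n[of j] zs_tip[of j] K by simp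
  have neq: "zs ! i \<noteq> zs ! j" using zs_eq[of i j] K k by auto
  have nbs: "zs ! i \<in> nb tip" "zs ! j \<in> nb tip" using ij by (auto simp: NI_def)
  have split: "(\<Sum>u\<in>nb tip. ?f y u) = ?f y (zs ! i) + (?f y (zs ! j) + (\<Sum>u\<in>?R. ?f y u))" for y
    using nbs neq by (simp add: sum.remove[of _ "zs ! i"] sum.remove[of _ "zs ! j"])
  \<comment> \<open>No neighbour of the tip lies strictly inside the gap, so all neighbours other
    than the two ends are outside the rotated stretch.\<close>
  have R: "(\<Sum>u\<in>?R. ?f ?y u) = (\<Sum>u\<in>?R. ?f x u)"
  proof (rule sum.cong[OF refl])
    fix u assume u: "u \<in> ?R"
    then obtain m where m: "u = zs ! m" "m \<in> NI" by (auto simp: nb_tip)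
    then have "m \<noteq> i" "m \<noteq> j" using u by auto
    then have "m < min i j \<or> max i j < m" using gap[OF m(2)] by fastforce
    then show "?f ?y u = ?f x u" using rnd_other_nth[where x = x, OF K xl, of m] NI_less[OF m(2)] m(1) by simp
  qed
  have yi: "?y (zs ! i) = x (zs ! k)"
    using rnd_up[where x = x, OF K xl, of i] rnd_down[where x = x, OF K xl, of i] k by (auto split: if_splits)
  have yj: "?y (zs ! j) = x (zs ! i)" using rnd_last[where x = x, OF K xl] .
  have "cnt x tip ?c = cnt ?y tip ?c" using jam_cnt[OF x c] jam_cnt[OF x' c] by simp
  then show False unfolding cnt_sum split R yi yj using ne by (auto split: if_splits)
qed

text \<open>
  Seen from \<open>v\<close>, the hole at \<open>v\<close> after a move from the tip is as if the tip were absent and \<open>v\<close> were one of its own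
  neighbours.
\<close>

lemma cnt_peek:
  assumes v: "v \<in> nb tip" and c: "c \<noteq> n"
  shows "cnt (fst (mv (x, tip) v)) v c = (\<Sum>u\<in>insert v (nb v) - {tip}. if x u = c then 1 else 0)"
proof -
  define y where "y = x(tip := x v, v := n)"
  have vt: "v \<noteq> tip" "tip \<in> nb v" using v nb_irrefl nb_sym by auto
  have "cnt y v c = (if y tip = c then 1 else 0) + (\<Sum>u\<in>nb v - {tip}. if y u = c then 1 else 0)"
    unfolding cnt_sum by (rule sum.remove) (use vt in auto)
  also have "(\<Sum>u\<in>nb v - {tip}. if y u = c then 1 else 0 :: nat) = (\<Sum>u\<in>nb v - {tip}. if x u = c then 1 else 0)"
    by (rule sum.cong) (use nb_irrefl in \<open>auto simp: y_def\<close>)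
  also have "y tip = x v" using vt by (simp add: y_def)
  finally have "cnt y v c = (if x v = c then 1 else 0) + (\<Sum>u\<in>nb v - {tip}. if x u = c then 1 else 0)" .
  moreover have "insert v (nb v) - {tip} = insert v (nb v - {tip})" using vt by auto
  moreover have "fst (mv (x, tip) v) = y" by (simp add: y_def)
  ultimately show ?thesis using nb_irrefl by simp
qed

text \<open>A rotation over two successive vertices exchanges their colours. Exactly one of them
  lies in the closed neighbourhood of \<open>zs ! q\<close>, so by \<open>cnt_peek\<close> the count
  seen from there changes by one; yet both looks from \<open>zs ! q\<close> are jammed and require
  the same count.\<close>

lemma swap_contradiction:
  assumes x: "jam (x, tip)" and ab: "a \<in> NI" "Suc a \<in> NI" and q: "q \<in> NI"
    and diff: "x (zs ! a) \<noteq> x (zs ! Suc a)"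
    and bd: "(zs ! a \<in> insert (zs ! q) (nb (zs ! q))) \<noteq> (zs ! Suc a \<in> insert (zs ! q) (nb (zs ! q)))"
    and j1: "jam (mv (x, tip) (zs ! q))" and j2: "jam (mv (rnd x a (Suc a), tip) (zs ! q))"
  shows False
proof -
  let ?v = "zs ! q" and ?y = "rnd x a (Suc a)" and ?S = "insert (zs ! q) (nb (zs ! q)) - {tip}"
  let ?c = "x (zs ! a)"
  let ?f = "\<lambda>y u. if y u = ?c then 1 else 0 :: nat"
  have K: "a < K" "Suc a < K" using ab NI_less by auto
  have xl: "x tip = n" using jam_hole_value[OF x] .
  have c: "?c < length p" "?c < n" using jam_colour[OF x, of "zs ! a"] zs_n[of a] zs_tip[of a] K by simp_all
  have v: "?v \<in> nb tip" using q by (simp add: NI_def)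
  have j1': "jam (fst (mv (x, tip) ?v), ?v)" and j2': "jam (fst (mv (?y, tip) ?v), ?v)"
    using j1 j2 by simp_all
  have eq: "(\<Sum>u\<in>?S. ?f x u) = (\<Sum>u\<in>?S. ?f ?y u)"
    using jam_cnt[OF j1' c(1)] jam_cnt[OF j2' c(1)]
      cnt_peek[OF v, of ?c x] cnt_peek[OF v, of ?c ?y] c(2) by simp
  have ya: "?y (zs ! a) = x (zs ! Suc a)" using rnd_up[where x = x, OF K xl, of a] by simp
  have yb: "?y (zs ! Suc a) = ?c" using rnd_last[where x = x, OF K xl] .
  have oth: "?y u = x u" if "u \<noteq> zs ! a" "u \<noteq> zs ! Suc a" for u
    by (rule rnd_other[where x = x, OF K xl]) (use that in \<open>auto simp: le_Suc_eq\<close>)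
  have nt: "zs ! a \<noteq> tip" "zs ! Suc a \<noteq> tip" using zs_tip K by auto
  \<comment> \<open>\<open>w\<close> is whichever of the two exchanged vertices lies in the closed
    neighbourhood: the only summand that changes.\<close>
  obtain w where w: "w \<in> ?S" "\<And>u. u \<in> ?S - {w} \<Longrightarrow> ?y u = x u" "?f x w \<noteq> ?f ?y w"
  proof (cases "zs ! a \<in> insert ?v (nb ?v)")
    case True
    show ?thesis by (rule that[of "zs ! a"]) (use True bd nt diff ya oth in \<open>auto\<close>)
  next
    case False
    show ?thesis by (rule that[of "zs ! Suc a"]) (use False bd nt diff yb in \<open>auto intro!: oth\<close>)
  qed
  have "(\<Sum>u\<in>?S. ?f x u) = ?f x w + (\<Sum>u\<in>?S - {w}. ?f x u)"
    and "(\<Sum>u\<in>?S. ?f ?y u) = ?f ?y w + (\<Sum>u\<in>?S - {w}. ?f ?y u)"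
    by (rule sum.remove, simp, rule w(1))+
  moreover have "(\<Sum>u\<in>?S - {w}. ?f x u) = (\<Sum>u\<in>?S - {w}. ?f ?y u)"
    by (rule sum.cong) (use w(2) in auto)
  ultimately show False using eq w(3) by linarith
qed

text \<open>Let \<open>k\<close> be the index next to \<open>f\<close> inside the gap. By
  \<open>gap_colour\<close>, jamming after rotating from \<open>f\<close> to \<open>g\<close> forces
  the colour at \<open>g\<close> to equal that at \<open>k\<close>. The rotation from
  \<open>e\<close> to \<open>g\<close> puts the colour of \<open>e\<close> on \<open>g\<close> and
  misses \<open>k\<close>, since \<open>e\<close> lies beyond \<open>g\<close>. A second use of
  \<open>gap_colour\<close> then gives \<open>e\<close> and \<open>g\<close> the same
  colour.\<close>

lemma gap_contradiction:
  assumes x: "jam (x, tip)" and fge: "f \<in> NI" "g \<in> NI" "e \<in> NI"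
    and gap: "\<And>m. m \<in> NI \<Longrightarrow> min f g < m \<Longrightarrow> m < max f g \<Longrightarrow> False"
    and wide: "Suc f < g \<and> g < e \<or> Suc g < f \<and> e < g"
    and diff: "x (zs ! e) \<noteq> x (zs ! g)"
    and j1: "jam (rnd x f g, tip)" and j2: "jam (rnd x e g, tip)" and j3: "jam (rnd (rnd x e g) f g, tip)"
  shows False
proof -
  define k where "k = (if f < g then f + 1 else f - 1)"
  have k: "min f g < k" "k < max f g" using wide by (auto simp: k_def)
  have K: "f < K" "g < K" "e < K" using fge NI_less by auto
  have xl: "x tip = n" using jam_hole_value[OF x] .
  have 1: "x (zs ! g) = x (zs ! k)" using gap_colour[OF x j1 fge(1,2) gap k_def k] .
  have 2: "rnd x e g (zs ! g) = rnd x e g (zs ! k)" using gap_colour[OF j2 j3 fge(1,2) gap k_def k] .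
  have "rnd x e g (zs ! g) = x (zs ! e)" using rnd_last[where x = x, OF K(3,2) xl] .
  moreover have "rnd x e g (zs ! k) = x (zs ! k)"
    by (rule rnd_other_nth[where x = x, OF K(3,2) xl]) (use wide K in \<open>auto simp: k_def\<close>)
  ultimately show False using 1 2 diff by simp
qed

end

section \<open>The algorithm\<close>

text \<open>Realises \<open>rnd\<close>: the walk is followed by the move back to the tip, unless
  the hole has been filled on the way.\<close>

definition round :: "exp \<Rightarrow> exp \<Rightarrow> com" where
  "round e f = walk e f ;; If (Equal (Reg ''done'') (Const 0)) (Assign ''v'' (Reg ''l'') ;; step_hole) Skip"

abbreviation vtx :: "string \<Rightarrow> exp" where "vtx x \<equiv> Get ''ord'' (Reg x)"

abbreviation colour :: "string \<Rightarrow> exp" where "colour x \<equiv> Get ''part'' (vtx x)"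

text \<open>\<open>lo\<close> starts at \<open>len\<close>, which is not an index of a neighbour of
  the tip, as a sign that none has been met. Of several gaps the last one is kept.\<close>

definition scan_gap :: com where
  "scan_gap = Assign ''lo'' (Reg ''len'') ;; Assign ''gap'' (Const 0) ;;
     for_range ''j'' (Const 0) (Minus (Reg ''len'') (Const 1))
       (If (Equal (Get ''mark'' (vtx ''j'')) (Const 1))
          (If (Equal (Reg ''lo'') (Reg ''len'')) (Assign ''lo'' (Reg ''j''))
             (If (Less (Plus (Reg ''last'') (Const 1)) (Reg ''j''))
                (Assign ''gap'' (Const 1) ;; Assign ''a'' (Reg ''last'') ;; Assign ''b'' (Reg ''j'')) Skip) ;;
           Assign ''last'' (Reg ''j''))
          Skip)"

definition count_inside :: com where
  "count_inside = Assign ''u'' (Get ''pos'' (Get ''adj'' (Reg ''k''))) ;;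
     If (And (Not (Less (Reg ''u'') (Reg ''lo''))) (Less (Reg ''u'') (Reg ''len'')))
       (Assign ''m'' (Plus (Reg ''m'') (Const 1))) Skip"

text \<open>As \<open>len\<close> is \<open>K + 1\<close>, the test on \<open>m\<close> says that
  the vertex has fewer than \<open>K - lo\<close> neighbours in the block from \<open>lo\<close> to
  the tip, so it misses another vertex of it. The second loop stops before \<open>len - 2\<close>
  because it looks at \<open>j + 1\<close> as well and leaves out the tip.\<close>

definition find_far :: com where
  "find_far =
     for_range ''j'' (Reg ''lo'') (Minus (Reg ''len'') (Const 1))
       (Assign ''v'' (vtx ''j'') ;; Assign ''m'' (Const 0) ;; for_nbr ''v'' count_inside ;;
        If (Less (Plus (Plus (Reg ''m'') (Reg ''lo'')) (Const 1)) (Reg ''len'')) (Assign ''q'' (Reg ''j'')) Skip) ;;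
     Assign ''v'' (vtx ''q'') ;; for_nbr ''v'' (Put ''mk'' (Get ''adj'' (Reg ''k'')) (Const 1)) ;;
     Put ''mk'' (Reg ''v'') (Const 1) ;;
     for_range ''j'' (Reg ''lo'') (Minus (Reg ''len'') (Const 2))
       (If (Equal (Get ''mk'' (vtx ''j'')) (Get ''mk'' (Get ''ord'' (Plus (Reg ''j'') (Const 1)))))
          Skip (Assign ''a'' (Reg ''j''))) ;;
     Assign ''b'' (Plus (Reg ''a'') (Const 1))"

text \<open>Rotating from \<open>d\<close> to the nearer of \<open>a\<close> and \<open>b\<close>
  brings the colour of \<open>d\<close> there and leaves the other one alone. Hence \<open>d\<close>
  is chosen with a colour different from that other one.\<close>

definition make_diff :: com where
  "make_diff =
     for_range ''j'' (Reg ''lo'') (Minus (Reg ''len'') (Const 1))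
       (If (And (Equal (Get ''mark'' (vtx ''j'')) (Const 1))
              (And (Not (And (Less (Reg ''a'') (Reg ''j'')) (Equal (colour ''j'') (colour ''a''))))
                 (Not (And (Not (Less (Reg ''a'') (Reg ''j''))) (Equal (colour ''j'') (colour ''b''))))))
          (Assign ''d'' (Reg ''j'')) Skip) ;;
     If (Less (Reg ''a'') (Reg ''d'')) (round (Reg ''d'') (Reg ''b'')) (round (Reg ''d'') (Reg ''a''))"

text \<open>A round from \<open>q\<close> to \<open>q\<close> restores the colouring; its purpose is
  the test of the hole at \<open>q\<close>, once before and once after the exchange.\<close>

definition finish_swap :: com where
  "finish_swap = round (Reg ''q'') (Reg ''q'') ;; round (Reg ''a'') (Reg ''b'') ;; round (Reg ''q'') (Reg ''q'')"

text \<open>\<open>f\<close> and \<open>g\<close> are the ends of the gap, \<open>g\<close> being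
  the one beyond which a further neighbour \<open>e\<close> of the tip exists. If \<open>e\<close>
  and \<open>g\<close> have equal colours, one extra rotation brings the different colour of
  \<open>f\<close> to \<open>g\<close>. The remaining rounds are a rotation, its inverse, and the
  two further rotations of \<open>gap_contradiction\<close>.\<close>

definition finish_gap :: com where
  "finish_gap =
     If (Less (Reg ''lo'') (Reg ''a''))
       (Assign ''f'' (Reg ''b'') ;; Assign ''g'' (Reg ''a'') ;; Assign ''e'' (Reg ''lo''))
       (Assign ''f'' (Reg ''a'') ;; Assign ''g'' (Reg ''b'') ;; Assign ''e'' (Minus (Reg ''len'') (Const 2))) ;;
     If (And (Equal (Reg ''done'') (Const 0)) (Equal (colour ''e'') (colour ''g'')))
       (round (Reg ''f'') (Reg ''g'')) Skip ;;
     round (Reg ''f'') (Reg ''g'') ;; round (Reg ''g'') (Reg ''f'') ;;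
     round (Reg ''e'') (Reg ''g'') ;; round (Reg ''f'') (Reg ''g'')"

definition repair :: com where
  "repair = for_nbr ''l'' (Put ''mark'' (Get ''adj'' (Reg ''k'')) (Const 1)) ;; scan_gap ;;
     If (Equal (Reg ''gap'') (Const 0)) find_far Skip ;; make_diff ;;
     If (Equal (Reg ''gap'') (Const 0)) finish_swap finish_gap"

definition partition_program :: com where
  "partition_program = prepare ;; If (Equal (Reg ''done'') (Const 0)) repair Skip"

lemma wregs_round [simp]: "wregs (round e f) = {''wi'', ''wj'', ''fin'', ''v'', ''h'', ''k'', ''c'', ''i'', ''done''}"
  and warrs_round [simp]: "warrs (round e f) = {''cnt'', ''part''}"
  by (auto simp: round_def)

lemma wregs_scan_gap [simp]: "wregs scan_gap = {''lo'', ''gap'', ''j'', ''a'', ''b'', ''last''}"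
  and warrs_scan_gap [simp]: "warrs scan_gap = {}"
  by (auto simp: scan_gap_def)

lemma wregs_count_inside [simp]: "wregs count_inside = {''u'', ''m''}"
  and warrs_count_inside [simp]: "warrs count_inside = {}"
  by (auto simp: count_inside_def)

lemma wregs_find_far [simp]: "wregs find_far = {''j'', ''v'', ''m'', ''k'', ''u'', ''q'', ''a'', ''b''}"
  and warrs_find_far [simp]: "warrs find_far = {''mk''}"
  by (auto simp: find_far_def)

lemma wregs_make_diff [simp]: "wregs make_diff =
    {''j'', ''d'', ''wi'', ''wj'', ''fin'', ''v'', ''h'', ''k'', ''c'', ''i'', ''done''}"
  and warrs_make_diff [simp]: "warrs make_diff = {''cnt'', ''part''}"
  by (auto simp: make_diff_def)

text \<open>For scans that keep the last index with property \<open>P\<close>. The register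
  \<open>y\<close> has arbitrary contents at first, so such an index must be known to exist.\<close>

lemma wp_for_range_last:
  assumes x: "x \<notin> wregs c" "y \<noteq> x" and le: "val e \<sigma> \<le> m" "m \<le> B"
    and f: "\<And>\<tau>. frame (for_range x e f c) \<sigma> \<tau> \<Longrightarrow> val f \<tau> = m"
    and step: "\<And>i \<tau>. val e \<sigma> \<le> i \<Longrightarrow> i < m \<Longrightarrow> reg \<tau> x = i \<Longrightarrow> frame (for_range x e f c) \<sigma> \<tau> \<Longrightarrow>
      wp B c \<tau> (\<lambda>t \<tau>'. reg \<tau>' y = (if P i then i else reg \<tau> y) \<and> t \<le> T i)"
    and ex: "\<exists>i. val e \<sigma> \<le> i \<and> i < m \<and> P i"
  shows "wp B (for_range x e f c) \<sigma> (\<lambda>t \<tau>. val e \<sigma> \<le> reg \<tau> y \<and> reg \<tau> y < m \<and> P (reg \<tau> y) \<and>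
    t \<le> (\<Sum>i = val e \<sigma>..<m. T i + 2) + 2)"
proof -
  let ?I = "\<lambda>j \<tau>. (\<exists>i. val e \<sigma> \<le> i \<and> i < j \<and> P i) \<longrightarrow> val e \<sigma> \<le> reg \<tau> y \<and> reg \<tau> y < j \<and> P (reg \<tau> y)"
  have "wp B (for_range x e f c) \<sigma> (\<lambda>t \<tau>. ?I m \<tau> \<and> t \<le> (\<Sum>i = val e \<sigma>..<m. T i + 2) + 2)"
  proof (rule wp_for_range[where I = ?I], goal_cases)
    case (7 i \<tau>)
    from step[OF 7(1,2,4,5)] show ?case
      by (rule wp_mono) (use 7 in \<open>auto simp: less_Suc_eq split: if_splits\<close>)
  qed (use x le f in auto)
  then show ?thesis by (rule wp_mono) (use ex in blast)
qed

context route
begin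

section \<open>Rounds and scans on the machine\<close>

lemma tip_less: "tip < n" using zs_n[of K] by (simp add: tip_def)

lemma wp_round:
  assumes tr: "tracks st vs \<sigma>" and hole: "snd (foldl mv st vs) = tip"
    and ord: "\<And>k. k < length zs \<Longrightarrow> arr \<sigma> ''ord'' k = zs ! k" and l: "reg \<sigma> ''l'' = tip"
    and i: "val e \<sigma> = i" and j: "val f (set_reg ''wi'' i \<sigma>) = j" and ij: "i \<in> NI" "j \<in> NI"
  shows "wp B (round e f) \<sigma> (\<lambda>t \<tau>. tracks st (vs @ seg i j @ [tip]) \<tau> \<and> t \<le> 80 * dsum {..<n})"
proof -
  have K: "i < K" "j < K" using ij NI_less by auto
  have "wp B (walk e f) \<sigma> (\<lambda>t \<tau>. tracks st (vs @ map ((!) zs) (idx i j)) \<tau> \<and> t \<le> 30 * dsum {..<n} + 10)"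
  proof (rule wp_walk[OF tr i j])
    show "zs ! i \<in> nb (snd (foldl mv st vs))" using ij hole by (simp add: NI_def)
    show "\<And>k. min i j \<le> k \<Longrightarrow> k < max i j \<Longrightarrow> zs ! Suc k \<in> nb (zs ! k)" using path K by auto
  qed (use ord dist zs_less K K_less in auto)
  then show ?thesis
    unfolding round_def wp_Seq seg_def[symmetric]
  proof (rule wp_mono_frame, goal_cases)
    case (1 t \<tau>)
    then have tr': "tracks st (vs @ seg i j) \<tau>" and t: "t \<le> 30 * dsum {..<n} + 10" by auto
    show ?case
    proof (cases "reg \<tau> ''done'' = 0")
      case True
      let ?\<tau> = "set_reg ''v'' tip \<tau>"
      have l': "reg \<tau> ''l'' = tip" using 1(2) l by (simp add: frame_def)
      have "snd (foldl mv st (vs @ seg i j)) = zs ! j"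
        by (subst snd_foldl_mv) (simp_all add: seg_def last_map)
      then have "reg \<tau> ''h'' = zs ! j" using tracks_hole[OF tr' True] by simp
      moreover have "tip \<in> nb (zs ! j)" using ij nb_sym by (simp add: NI_def)
      ultimately have "wp B step_hole ?\<tau> (\<lambda>t \<tau>. tracks st ((vs @ seg i j) @ [tip]) \<tau> \<and> t \<le> 23 * (deg tip + 1))"
        using tr' True by (intro wp_step_hole) auto
      then have "wp B step_hole ?\<tau> (\<lambda>t' \<tau>. tracks st (vs @ seg i j @ [tip]) \<tau> \<and> t + (1 + t' + 1) \<le> 80 * dsum {..<n})"
        by (rule wp_mono) (use t deg_le_dsum[OF tip_less] dsum_ge in auto)
      then show ?thesis using True l' tip_less B_ge unfolding wp_If
        by (simp del: wp_Seq) (intro wp_Assign_Seq[where k = tip]; simp)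
    next
      case False
      then show ?thesis using tracks_cong_done[OF tr' False] t dsum_ge by simp
    qed
  qed
qed

lemma wp_scan_gap:
  assumes ord: "\<And>k. k < length zs \<Longrightarrow> arr \<sigma> ''ord'' k = zs ! k" and len: "reg \<sigma> ''len'' = Suc K"
    and mark: "\<And>k. k < K \<Longrightarrow> arr \<sigma> ''mark'' (zs ! k) = (if k \<in> NI then 1 else 0)" and Kn: "Suc K \<le> n" and ne: "NI \<noteq> {}"
  shows "wp B scan_gap \<sigma> (\<lambda>t \<tau>. t \<le> 20 * dsum {..<n} \<and> reg \<tau> ''lo'' \<in> NI \<and> (\<forall>i\<in>NI. reg \<tau> ''lo'' \<le> i) \<and>
    (reg \<tau> ''gap'' = 0 \<and> {reg \<tau> ''lo''..<K} \<subseteq> NI \<or>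
     reg \<tau> ''gap'' = 1 \<and> reg \<tau> ''a'' \<in> NI \<and> reg \<tau> ''b'' \<in> NI \<and> Suc (reg \<tau> ''a'') < reg \<tau> ''b'' \<and>
       (\<forall>i\<in>NI. \<not> (reg \<tau> ''a'' < i \<and> i < reg \<tau> ''b''))))"
proof -
  let ?L = "for_range ''j'' (Const 0) (Minus (Reg ''len'') (Const 1))
       (If (Equal (Get ''mark'' (vtx ''j'')) (Const 1))
          (If (Equal (Reg ''lo'') (Reg ''len'')) (Assign ''lo'' (Reg ''j''))
             (If (Less (Plus (Reg ''last'') (Const 1)) (Reg ''j''))
                (Assign ''gap'' (Const 1) ;; Assign ''a'' (Reg ''last'') ;; Assign ''b'' (Reg ''j'')) Skip) ;;
           Assign ''last'' (Reg ''j''))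
          Skip)"
  let ?\<sigma> = "set_reg ''gap'' 0 (set_reg ''lo'' (Suc K) \<sigma>)"
  \<comment> \<open>What is known when \<open>l\<close> is the last neighbour index met: either no
    gap between \<open>lo\<close> and \<open>l\<close>, or a recorded gap.\<close>
  define G where "G = (\<lambda>(\<tau> :: state) l.
     reg \<tau> ''gap'' = 0 \<and> (\<forall>i. reg \<tau> ''lo'' \<le> i \<and> i \<le> l \<longrightarrow> i \<in> NI) \<or>
     reg \<tau> ''gap'' = 1 \<and> reg \<tau> ''a'' \<in> NI \<and> reg \<tau> ''b'' \<in> NI \<and> Suc (reg \<tau> ''a'') < reg \<tau> ''b'' \<and>
       (\<forall>i\<in>NI. \<not> (reg \<tau> ''a'' < i \<and> i < reg \<tau> ''b'')))"
  define I where "I = (\<lambda>j (\<tau> :: state).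
     (reg \<tau> ''lo'' = Suc K \<and> (\<forall>i\<in>NI. j \<le> i) \<and> reg \<tau> ''gap'' = 0) \<or>
     (reg \<tau> ''lo'' \<in> NI \<and> reg \<tau> ''lo'' \<le> reg \<tau> ''last'' \<and> reg \<tau> ''last'' \<in> NI \<and> reg \<tau> ''last'' < j \<and>
      (\<forall>i\<in>NI. reg \<tau> ''lo'' \<le> i) \<and> (\<forall>i\<in>NI. i < j \<longrightarrow> i \<le> reg \<tau> ''last'') \<and> G \<tau> (reg \<tau> ''last'')))"
  have "wp B ?L ?\<sigma> (\<lambda>t \<tau>. I K \<tau> \<and> t \<le> (\<Sum>i = val (Const 0) ?\<sigma>..<K. 8 + 2) + 2)"
  proof (rule wp_for_range[where I = I], goal_cases)
    case (7 j \<tau>)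
    have e: "arr \<tau> ''ord'' j = zs ! j" "reg \<tau> ''len'' = Suc K" "arr \<tau> ''mark'' (zs ! j) = (if j \<in> NI then 1 else 0)"
      using 7 ord mark K_less len by (auto simp: frame_def)
    show ?case
    proof (cases "j \<in> NI")
      case False
      then have "I (Suc j) \<tau>" using 7(3) unfolding I_def by (auto simp: less_Suc_eq Suc_le_eq le_less)
      then show ?thesis using False e 7(4) by simp
    next
      case True
      from 7(3) consider "reg \<tau> ''lo'' = Suc K" "\<forall>i\<in>NI. j \<le> i" "reg \<tau> ''gap'' = 0"
        | "reg \<tau> ''lo'' \<in> NI" "reg \<tau> ''lo'' \<le> reg \<tau> ''last''" "reg \<tau> ''last'' \<in> NI" "reg \<tau> ''last'' < j"
          "\<forall>i\<in>NI. reg \<tau> ''lo'' \<le> i" "\<forall>i\<in>NI. i < j \<longrightarrow> i \<le> reg \<tau> ''last''" "G \<tau> (reg \<tau> ''last'')"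
        unfolding I_def by (elim disjE conjE)
      then show ?thesis
      proof cases
        case 1
        then have "I (Suc j) (set_reg ''last'' j (set_reg ''lo'' j \<tau>))"
          using True by (auto simp: I_def G_def less_Suc_eq)
        then show ?thesis using 1 e True 7 Kn B_ge by simp
      next
        case 2
        have ne: "reg \<tau> ''lo'' \<noteq> Suc K" using 2(1) NI_less by fastforce
        show ?thesis
        proof (cases "Suc (reg \<tau> ''last'') < j")
          case gap: True
          let ?\<tau> = "set_reg ''last'' j (set_reg ''b'' j (set_reg ''a'' (reg \<tau> ''last'') (set_reg ''gap'' 1 \<tau>)))"
          have "\<not> (reg \<tau> ''last'' < i \<and> i < j)" if "i \<in> NI" for i using 2(6) that by fastforce
          then have "G ?\<tau> j" using 2 True gap by (auto simp: G_def)
          then have "I (Suc j) ?\<tau>" using 2 True by (auto simp: I_def less_Suc_eq)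
          then show ?thesis using 2 ne e True gap 7 Kn B_ge by simp
        next
          case False
          then have "j = Suc (reg \<tau> ''last'')" using 2(4) by simp
          then have "G (set_reg ''last'' j \<tau>) j" using 2(7) True by (auto simp: G_def le_Suc_eq)
          then have "I (Suc j) (set_reg ''last'' j \<tau>)" using 2 True by (auto simp: I_def less_Suc_eq)
          then show ?thesis using False ne e True 7 Kn B_ge by simp
        qed
      qed
    qed
  qed (use Kn B_ge len in \<open>auto simp: I_def G_def frame_def\<close>)
  then have "wp B ?L ?\<sigma> (\<lambda>t \<tau>. 1 + (1 + t) \<le> 20 * dsum {..<n} \<and> reg \<tau> ''lo'' \<in> NI \<and> (\<forall>i\<in>NI. reg \<tau> ''lo'' \<le> i) \<and>
    (reg \<tau> ''gap'' = 0 \<and> {reg \<tau> ''lo''..<K} \<subseteq> NI \<or>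
     reg \<tau> ''gap'' = 1 \<and> reg \<tau> ''a'' \<in> NI \<and> reg \<tau> ''b'' \<in> NI \<and> Suc (reg \<tau> ''a'') < reg \<tau> ''b'' \<and>
       (\<forall>i\<in>NI. \<not> (reg \<tau> ''a'' < i \<and> i < reg \<tau> ''b''))))"
  proof (rule wp_mono, goal_cases)
    case (1 t \<tau>)
    obtain i where i: "i \<in> NI" using ne by blast
    then have "0 < K" using NI_less by fastforce
    \<comment> \<open>The predecessor of the tip on the path is one of its neighbours, so a scan
      without gaps makes the block reach up to the tip.\<close>
    then have K1: "K - 1 \<in> NI" using pred_NI by blast
    have "\<not> K \<le> i" using NI_less[OF i] by simp
    then have "\<not> (\<forall>i\<in>NI. K \<le> i)" using i by blast
    then have I: "reg \<tau> ''lo'' \<in> NI" "\<forall>i\<in>NI. reg \<tau> ''lo'' \<le> i" "reg \<tau> ''last'' \<in> NI"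
       "\<forall>i\<in>NI. i < K \<longrightarrow> i \<le> reg \<tau> ''last''" "G \<tau> (reg \<tau> ''last'')"
      using 1 unfolding I_def by blast+
    have "reg \<tau> ''last'' = K - 1" using I(3,4) K1 NI_less \<open>0 < K\<close> by fastforce
    then have "{reg \<tau> ''lo''..<K} \<subseteq> NI" if "\<forall>i. reg \<tau> ''lo'' \<le> i \<and> i \<le> reg \<tau> ''last'' \<longrightarrow> i \<in> NI"
      using that by auto
    moreover have "n \<le> dsum {..<n}" by (simp add: dsum_def sum.distrib sum_Suc)
    ultimately show ?case using 1 I Kn n_ge unfolding G_def by auto
  qed
  then show ?thesis unfolding scan_gap_def using Kn B_ge len
    by (intro wp_Assign_Seq[where k = "Suc K"] wp_Assign_Seq[where k = 0]) auto
qed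

lemma wp_mark:
  assumes inp: "input n E p \<sigma>" and v: "reg \<sigma> x = v" "v < n" "x \<noteq> ''k''" and A: "A \<notin> {''off'', ''adj''}"
  shows "wp B (for_nbr x (Put A (Get ''adj'' (Reg ''k'')) (Const 1))) \<sigma>
    (\<lambda>t \<tau>. (\<forall>u. arr \<tau> A u = (if u \<in> nb v then 1 else arr \<sigma> A u)) \<and> t \<le> (1 + 2) * deg v + 2)"
proof (rule wp_for_nbr[where I = "\<lambda>D \<tau>. \<forall>u. arr \<tau> A u = (if u \<in> D then 1 else arr \<sigma> A u)", OF inp v(1,2)], goal_cases)
  case (8 D u \<tau>)
  have "u < n" using 8 nb_less by blast
  then show ?case using 8 B_ge by auto
qed (use v A in auto)

text \<open>Otherwise every vertex of the block from \<open>lo\<close> to the tip is adjacent to its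
  \<open>\<Delta>\<close> other vertices. This exhausts its degree, so the block is closed under
  neighbours, hence the whole graph, and the graph is complete.\<close>

lemma far_exists:
  assumes NI: "NI = {lo..<K}" and lo: "lo < K" and deg: "deg tip = \<Delta>"
  shows "\<exists>q. lo \<le> q \<and> q < K \<and> card (nb (zs ! q) \<inter> (!) zs ` {lo..K}) < K - lo"
proof (rule ccontr)
  assume no: "\<not> ?thesis"
  let ?C = "(!) zs ` {lo..K}"
  have \<Delta>: "K - lo = \<Delta>" using card_NI deg by (simp add: NI)
  have full: "nb (zs ! q) \<subseteq> ?C \<and> deg (zs ! q) = \<Delta>" if q: "lo \<le> q" "q \<le> K" for q
  proof (cases "q = K")
    case True
    have "nb tip \<subseteq> ?C" unfolding nb_tip NI by auto
    then show ?thesis using True deg by (simp add: tip_def)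
  next
    case False
    then have qK: "q < K" using q by simp
    have "deg (zs ! q) \<le> \<Delta>" using deg_le zs_n[of q] q by simp
    moreover have "\<not> card (nb (zs ! q) \<inter> ?C) < K - lo" using no q qK by blast
    then have "\<Delta> \<le> card (nb (zs ! q) \<inter> ?C)" using \<Delta> by simp
    moreover have "card (nb (zs ! q) \<inter> ?C) \<le> deg (zs ! q)" unfolding deg_def by (intro card_mono) auto
    ultimately have "card (nb (zs ! q) \<inter> ?C) = card (nb (zs ! q))" "deg (zs ! q) = \<Delta>" by (auto simp: deg_def)
    then have "nb (zs ! q) \<inter> ?C = nb (zs ! q)" by (intro card_subset_eq) auto
    then show ?thesis using \<open>deg (zs ! q) = \<Delta>\<close> by blast
  qed
  have C: "?C = {..<n}"
  proof (rule nb_closed_set)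
    show "?C \<noteq> {}" using lo by auto
    show "?C \<subseteq> {..<n}" using zs_n by auto
    show "\<And>u v. u \<in> ?C \<Longrightarrow> v \<in> nb u \<Longrightarrow> v \<in> ?C" using full by fastforce
  qed
  have inj: "inj_on ((!) zs) {lo..K}" by (rule inj_onI) (use zs_eq in auto)
  have "n = Suc \<Delta>" using arg_cong[OF C, of card] card_image[OF inj] \<Delta> lo by simp
  have "complete_graph {..<n} E"
    unfolding complete_graph_def
  proof (intro ballI impI)
    fix u v assume uv: "u \<in> {..<n}" "v \<in> {..<n}" "u \<noteq> v"
    then have "v \<in> ?C" using C by simp
    then obtain q where q: "lo \<le> q" "q \<le> K" "v = zs ! q" by auto
    have "nb v \<subseteq> {..<n} - {v}" using nb_subset nb_irrefl by blast
    moreover have "card ({..<n} - {v}) = card (nb v)" using full[OF q(1,2)] q(3) \<open>n = Suc \<Delta>\<close> uv by (simp add: deg_def)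
    ultimately have "nb v = {..<n} - {v}" by (intro card_subset_eq) auto
    then have "u \<in> nb v" using uv by blast
    then show "{u, v} \<in> E" by (simp add: nb_def neighbours_def)
  qed
  then show False using not_complete by simp
qed

text \<open>Otherwise membership in the closed neighbourhood of \<open>zs ! q\<close> is constant
  along the neighbours of the tip. It holds at \<open>q\<close>, so \<open>zs ! q\<close> would be
  adjacent to all other vertices of the block, including the tip.\<close>

lemma boundary_exists:
  assumes NI: "NI = {lo..<K}" and q: "lo \<le> q" "q < K" "card (nb (zs ! q) \<inter> (!) zs ` {lo..K}) < K - lo"
  defines "M \<equiv> insert (zs ! q) (nb (zs ! q))"
  shows "\<exists>a. lo \<le> a \<and> a < K - 1 \<and> (zs ! a \<in> M) \<noteq> (zs ! Suc a \<in> M)"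
proof (rule ccontr)
  assume no: "\<not> ?thesis"
  have eq: "zs ! (lo + d) \<in> M \<longleftrightarrow> zs ! lo \<in> M" if "lo + d < K" for d
    using that
  proof (induction d)
    case (Suc d)
    then have "zs ! (lo + d) \<in> M \<longleftrightarrow> zs ! Suc (lo + d) \<in> M" using no by auto
    then show ?case using Suc by simp
  qed simp
  have all: "zs ! i \<in> M" if "lo \<le> i" "i < K" for i
  proof -
    have "zs ! q \<in> M" by (simp add: M_def)
    then have "zs ! lo \<in> M" using eq[of "q - lo"] q(1,2) by simp
    then show ?thesis using eq[of "i - lo"] that by simp
  qed
  have "q \<in> NI" using q NI by simp
  then have "zs ! q \<in> nb tip" by (simp add: NI_def)
  then have "tip \<in> nb (zs ! q)" using nb_sym by blast
  then have "(!) zs ` ({lo..K} - {q}) \<subseteq> nb (zs ! q) \<inter> (!) zs ` {lo..K}"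
  proof (intro subsetI)
    fix u assume "u \<in> (!) zs ` ({lo..K} - {q})"
    then obtain i where "u = zs ! i" "i \<in> {lo..K} - {q}" by (rule imageE)
    then have i: "u = zs ! i" "lo \<le> i" "i \<le> K" "i \<noteq> q" by auto
    have "zs ! i \<in> nb (zs ! q)"
    proof (cases "i = K")
      case False
      then show ?thesis using all[of i] i zs_eq[of i q] q by (simp add: M_def)
    qed (use \<open>tip \<in> _\<close> in \<open>simp add: tip_def\<close>)
    then show "u \<in> nb (zs ! q) \<inter> (!) zs ` {lo..K}" using i by simp
  qed
  then have "card ((!) zs ` ({lo..K} - {q})) \<le> card (nb (zs ! q) \<inter> (!) zs ` {lo..K})" by (intro card_mono) auto
  moreover have "inj_on ((!) zs) ({lo..K} - {q})" by (rule inj_onI) (use zs_eq in auto)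
  from card_image[OF this] have "card ((!) zs ` ({lo..K} - {q})) = K - lo" using q by simp
  ultimately show False using q(3) by simp
qed

lemma wp_find_far:
  assumes inp: "input n E p \<sigma>"
    and ord: "\<And>k. k < length zs \<Longrightarrow> arr \<sigma> ''ord'' k = zs ! k" and pos: "\<And>k. k < length zs \<Longrightarrow> arr \<sigma> ''pos'' (zs ! k) = k"
    and V: "set zs = {..<n}" and len: "reg \<sigma> ''len'' = Suc K" and mk: "\<And>v. v < n \<Longrightarrow> arr \<sigma> ''mk'' v = 0"
    and lo: "reg \<sigma> ''lo'' = lo" "lo < K" and NI: "NI = {lo..<K}" and deg: "deg tip = \<Delta>"
  shows "wp B find_far \<sigma> (\<lambda>t \<tau>. t \<le> 60 * dsum {..<n} \<and> reg \<tau> ''q'' \<in> NI \<and> lo \<le> reg \<tau> ''a'' \<and> Suc (reg \<tau> ''a'') < K \<and>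
    reg \<tau> ''b'' = Suc (reg \<tau> ''a'') \<and>
    (zs ! reg \<tau> ''a'' \<in> insert (zs ! reg \<tau> ''q'') (nb (zs ! reg \<tau> ''q''))) \<noteq>
    (zs ! Suc (reg \<tau> ''a'') \<in> insert (zs ! reg \<tau> ''q'') (nb (zs ! reg \<tau> ''q''))))"
proof -
  have Kn: "Suc K \<le> n" using K_less distinct_card[OF dist] V by simp
  define C where "C = (!) zs ` {lo..K}"
  define bad where "bad = (\<lambda>i. card (nb (zs ! i) \<inter> C) < K - lo)"
  \<comment> \<open>Since \<open>pos\<close> inverts \<open>ord\<close>, membership in the block
    becomes an interval test on positions.\<close>
  have posC: "lo \<le> arr \<sigma> ''pos'' u \<and> arr \<sigma> ''pos'' u < Suc K \<longleftrightarrow> u \<in> C" if u: "u < n" for u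
  proof -
    obtain k where k: "k < length zs" "u = zs ! k" using u V by (metis in_set_conv_nth lessThan_iff)
    have "u \<in> C \<longleftrightarrow> k \<in> {lo..K}"
      using k dist K_less by (auto simp: C_def nth_eq_iff_index_eq)
    then show ?thesis using pos[OF k(1)] k(2) by auto
  qed
  let ?c1 = "Assign ''v'' (vtx ''j'') ;; Assign ''m'' (Const 0) ;; for_nbr ''v'' count_inside ;;
        If (Less (Plus (Plus (Reg ''m'') (Reg ''lo'')) (Const 1)) (Reg ''len'')) (Assign ''q'' (Reg ''j'')) Skip"
  let ?L1 = "for_range ''j'' (Reg ''lo'') (Minus (Reg ''len'') (Const 1)) ?c1"
  let ?T1 = "\<lambda>i. 5 * deg (zs ! i) + 6"
  have L1: "wp B ?L1 \<sigma> (\<lambda>t \<tau>. val (Reg ''lo'') \<sigma> \<le> reg \<tau> ''q'' \<and> reg \<tau> ''q'' < K \<and> bad (reg \<tau> ''q'') \<and>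
      t \<le> (\<Sum>i = val (Reg ''lo'') \<sigma>..<K. ?T1 i + 2) + 2)"
  proof (rule wp_for_range_last)
    show "\<exists>i. val (Reg ''lo'') \<sigma> \<le> i \<and> i < K \<and> bad i"
      using far_exists[OF NI lo(2) deg] lo by (auto simp: bad_def C_def)
  next
    fix i \<tau> assume i: "val (Reg ''lo'') \<sigma> \<le> i" "i < K" "reg \<tau> ''j'' = i" and fr: "frame ?L1 \<sigma> \<tau>"
    have e: "arr \<tau> ''ord'' i = zs ! i" "reg \<tau> ''len'' = Suc K" "arr \<tau> ''pos'' = arr \<sigma> ''pos''" "reg \<tau> ''lo'' = lo"
      using fr ord i K_less len lo by (auto simp: frame_def)
    let ?v = "zs ! i"
    have vn: "?v < n" using zs_n[of i] i by simp
    let ?\<tau> = "set_reg ''m'' 0 (set_reg ''v'' ?v \<tau>)"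
    have inp': "input n E p ?\<tau>" using inp fr by (auto simp: input_def frame_def)
    let ?I = "\<lambda>D \<tau>. reg \<tau> ''m'' = card (D \<inter> C)"
    have "wp B (for_nbr ''v'' count_inside) ?\<tau> (\<lambda>t \<tau>. ?I (nb ?v) \<tau> \<and> t \<le> (3 + 2) * deg ?v + 2)"
    proof (rule wp_for_nbr[where I = ?I, OF inp'], goal_cases)
      case (10 D u \<tau>')
      have un: "u < n" using 10 nb_less by blast
      have e': "arr \<tau>' ''pos'' = arr \<sigma> ''pos''" "reg \<tau>' ''lo'' = lo" "reg \<tau>' ''len'' = Suc K"
        using 10(6) e by (auto simp: frame_def)
      have fin: "finite (D \<inter> C)" by (simp add: C_def)
      have cle: "card (D \<inter> C) \<le> n"
      proof -
        have "D \<inter> C \<subseteq> {..<n}" using 10(1) nb_subset by blast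
        from card_mono[OF _ this] show ?thesis by simp
      qed
      obtain k where "k < length zs" "u = zs ! k" using un V by (metis in_set_conv_nth lessThan_iff)
      then have pB: "arr \<sigma> ''pos'' u < n" using pos[of k] distinct_card[OF dist] V by simp
      show ?case
      proof (cases "u \<in> C")
        case True
        then have "card (insert u D \<inter> C) = Suc (card (D \<inter> C))" using 10(3) fin by simp
        then show ?thesis using True posC[OF un] 10(4,5) e' pB cle B_ge by (simp add: count_inside_def)
      next
        case False
        then have "card (insert u D \<inter> C) = card (D \<inter> C)" by simp
        moreover have "\<not> (\<not> arr \<sigma> ''pos'' u < lo \<and> arr \<sigma> ''pos'' u < Suc K)"
          using False posC[OF un] by (auto simp: not_less)
        ultimately show ?thesis using 10(4,5) e' pB B_ge unfolding count_inside_def by simp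
      qed
    qed (use vn in auto)
    then have "wp B (for_nbr ''v'' count_inside ;;
        If (Less (Plus (Plus (Reg ''m'') (Reg ''lo'')) (Const 1)) (Reg ''len'')) (Assign ''q'' (Reg ''j'')) Skip) ?\<tau>
        (\<lambda>t \<tau>'. reg \<tau>' ''q'' = (if bad i then i else reg \<tau> ''q'') \<and> 1 + (1 + t) \<le> ?T1 i)"
      unfolding wp_Seq
    proof (rule wp_mono_frame, goal_cases)
      case (1 t \<tau>')
      have e': "reg \<tau>' ''lo'' = lo" "reg \<tau>' ''len'' = Suc K" "reg \<tau>' ''j'' = i" "reg \<tau>' ''q'' = reg \<tau> ''q''"
        using 1(2) e i by (auto simp: frame_def)
      have "reg \<tau>' ''m'' + lo + 1 < Suc K \<longleftrightarrow> bad i" using 1(1) lo(2) by (auto simp: bad_def)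
      then show ?case using 1(1) e' i Kn B_ge by simp
    qed
    then show "wp B ?c1 \<tau> (\<lambda>t \<tau>'. reg \<tau>' ''q'' = (if bad i then i else reg \<tau> ''q'') \<and> t \<le> ?T1 i)"
      using e i vn B_ge by (intro wp_Assign_Seq[where k = ?v] wp_Assign_Seq[where k = 0]) auto
  qed (use Kn B_ge len lo in \<open>auto simp: frame_def\<close>)
  have T1: "(\<Sum>i = lo..<K. ?T1 i + 2) \<le> 8 * dsum {..<n}"
  proof -
    have inj: "inj_on ((!) zs) {lo..<K}" by (rule inj_onI) (use zs_eq in auto)
    have "(\<Sum>i = lo..<K. ?T1 i + 2) \<le> (\<Sum>i = lo..<K. 8 * (deg (zs ! i) + 1))" by (rule sum_mono) simp
    also have "\<dots> = 8 * dsum ((!) zs ` {lo..<K})"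
      unfolding dsum_def sum_distrib_left by (simp add: sum.reindex[OF inj])
    also have "\<dots> \<le> 8 * dsum {..<n}" using zs_n by (intro mult_le_mono2 dsum_mono) auto
    finally show ?thesis .
  qed
  let ?b = "Equal (Get ''mk'' (vtx ''j'')) (Get ''mk'' (Get ''ord'' (Plus (Reg ''j'') (Const 1))))"
  let ?L2 = "for_range ''j'' (Reg ''lo'') (Minus (Reg ''len'') (Const 2)) (If ?b Skip (Assign ''a'' (Reg ''j'')))"
  let ?Q = "\<lambda>t \<tau>. t \<le> 60 * dsum {..<n} \<and> reg \<tau> ''q'' \<in> NI \<and> lo \<le> reg \<tau> ''a'' \<and> Suc (reg \<tau> ''a'') < K \<and>
    reg \<tau> ''b'' = Suc (reg \<tau> ''a'') \<and>
    (zs ! reg \<tau> ''a'' \<in> insert (zs ! reg \<tau> ''q'') (nb (zs ! reg \<tau> ''q''))) \<noteq>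
    (zs ! Suc (reg \<tau> ''a'') \<in> insert (zs ! reg \<tau> ''q'') (nb (zs ! reg \<tau> ''q'')))"
  show ?thesis
    unfolding find_far_def wp_Seq[of _ ?L1]
  proof (rule wp_mono_frame[OF L1], goal_cases)
    case (1 t1 \<tau>1)
    define q where "q = reg \<tau>1 ''q''"
    let ?v = "zs ! q"
    have q: "lo \<le> q" "q < K" "bad q" and t1: "t1 \<le> 8 * dsum {..<n} + 2"
      using 1(1) lo T1 by (auto simp: q_def)
    have e1: "arr \<tau>1 = arr \<sigma>" "reg \<tau>1 ''len'' = Suc K" "reg \<tau>1 ''lo'' = lo"
      using 1(2) len lo by (auto simp: frame_def)
    have vn: "?v < n" using zs_n[of q] q by simp
    define M where "M = insert ?v (nb ?v)"
    let ?\<tau>1 = "set_reg ''v'' ?v \<tau>1"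
    have inp1: "input n E p ?\<tau>1" using inp 1(2) by (auto simp: input_def frame_def)
    let ?F = "for_nbr ''v'' (Put ''mk'' (Get ''adj'' (Reg ''k'')) (Const 1))"
    have F: "wp B ?F ?\<tau>1 (\<lambda>t \<tau>. (\<forall>u. arr \<tau> ''mk'' u = (if u \<in> nb ?v then 1 else arr ?\<tau>1 ''mk'' u)) \<and> t \<le> (1 + 2) * deg ?v + 2)"
      by (rule wp_mark[OF inp1]) (use vn in auto)
    have "wp B (?F ;; Put ''mk'' (Reg ''v'') (Const 1) ;; ?L2 ;; Assign ''b'' (Plus (Reg ''a'') (Const 1))) ?\<tau>1
       (\<lambda>t. ?Q (t1 + (1 + t)))"
      unfolding wp_Seq[of _ ?F]
    proof (rule wp_mono_frame[OF F], goal_cases)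
      case (1 t2 \<tau>2)
      let ?\<tau>2 = "set_arr ''mk'' ?v 1 \<tau>2"
      have t2: "t2 \<le> 3 * dsum {..<n} + 2" using 1(1) deg_le_dsum[OF vn] by simp
      have e2: "reg \<tau>2 ''v'' = ?v" "arr \<tau>2 ''ord'' = arr \<sigma> ''ord''" "reg \<tau>2 ''len'' = Suc K" "reg \<tau>2 ''lo'' = lo" "reg \<tau>2 ''q'' = q"
        using 1(2) e1 by (auto simp: frame_def q_def)
      have mk2: "arr ?\<tau>2 ''mk'' u = (if u \<in> M then 1 else 0)" if "u < n" for u
        using 1(1) mk[OF that] e1 by (auto simp: M_def)
      let ?P = "\<lambda>a. (zs ! a \<in> M) \<noteq> (zs ! Suc a \<in> M)"
      have L2: "wp B ?L2 ?\<tau>2 (\<lambda>t \<tau>. val (Reg ''lo'') ?\<tau>2 \<le> reg \<tau> ''a'' \<and> reg \<tau> ''a'' < K - 1 \<and> ?P (reg \<tau> ''a'') \<and>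
          t \<le> (\<Sum>i = val (Reg ''lo'') ?\<tau>2..<K - 1. 2 + 2) + 2)"
      proof (rule wp_for_range_last)
        show "\<exists>i. val (Reg ''lo'') ?\<tau>2 \<le> i \<and> i < K - 1 \<and> ?P i"
          using boundary_exists[OF NI q(1,2)] q(3) e2 unfolding bad_def C_def M_def by simp
      next
        fix i \<tau> assume i: "val (Reg ''lo'') ?\<tau>2 \<le> i" "i < K - 1" "reg \<tau> ''j'' = i" and fr: "frame ?L2 ?\<tau>2 \<tau>"
        have o: "arr \<tau> ''ord'' = arr \<sigma> ''ord''" "arr \<tau> ''mk'' = arr ?\<tau>2 ''mk''" using fr e2 by (auto simp: frame_def)
        have o2: "arr \<tau> ''ord'' i = zs ! i" "arr \<tau> ''ord'' (Suc i) = zs ! Suc i"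
          unfolding o(1) using ord i(2) K_less by auto
        have m: "arr \<tau> ''mk'' (zs ! i) = (if zs ! i \<in> M then 1 else 0)"
          "arr \<tau> ''mk'' (zs ! Suc i) = (if zs ! Suc i \<in> M then 1 else 0)"
          unfolding o(2) using mk2 zs_n[of i] zs_n[of "Suc i"] i(2) by auto
        have tst: "test ?b \<tau> \<longleftrightarrow> \<not> ?P i" using o2 m i(3) by auto
        show "wp B (If ?b Skip (Assign ''a'' (Reg ''j''))) \<tau>
            (\<lambda>t \<tau>'. reg \<tau>' ''a'' = (if ?P i then i else reg \<tau> ''a'') \<and> t \<le> 2)"
          unfolding wp_If tst using i Kn B_ge by auto
      qed (use Kn B_ge e2 lo in \<open>auto simp: frame_def\<close>)
      have "wp B (?L2 ;; Assign ''b'' (Plus (Reg ''a'') (Const 1))) ?\<tau>2 (\<lambda>t. ?Q (t1 + (1 + (t2 + (1 + t)))))"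
        unfolding wp_Seq[of _ ?L2]
      proof (rule wp_mono_frame[OF L2], goal_cases)
        case (1 t3 \<tau>3)
        have "(\<Sum>i = lo..<K - 1. 2 + 2 :: nat) \<le> 4 * n" using Kn by simp
        moreover have "n \<le> dsum {..<n}" by (simp add: dsum_def sum.distrib sum_Suc)
        ultimately have t3: "t3 \<le> 4 * dsum {..<n} + 2" using 1(1) e2 by simp
        have q3: "reg \<tau>3 ''q'' = q" using 1(2) e2 by (simp add: frame_def)
        have qNI: "q \<in> NI" using q NI by simp
        have a3: "lo \<le> reg \<tau>3 ''a''" "Suc (reg \<tau>3 ''a'') < K" "?P (reg \<tau>3 ''a'')" using 1(1) e2 by auto
        have "t1 + (1 + (t2 + (1 + (t3 + 1)))) \<le> 60 * dsum {..<n}" using t1 t2 t3 dsum_ge by linarith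
        then show ?case using a3 q3 qNI Kn B_ge by (simp add: M_def)
      qed
      then show ?case using e2 vn B_ge unfolding wp_Seq[of _ "Put _ _ _"] wp_Put by (simp del: wp_Seq)
    qed
    then show ?case using e1 ord[of q] q K_less vn B_ge by (intro wp_Assign_Seq[where k = ?v]) (auto simp: q_def)
  qed
qed

section \<open>Composing rotations into scripts\<close>

definition env :: "state \<Rightarrow> bool" where
  "env \<sigma> \<longleftrightarrow> (\<forall>k<length zs. arr \<sigma> ''ord'' k = zs ! k) \<and> reg \<sigma> ''l'' = tip"

lemma wp_round_regs:
  assumes tr: "tracks st vs \<sigma>" and hole: "snd (foldl mv st vs) = tip" and env: "env \<sigma>"
    and ij: "reg \<sigma> y = i" "reg \<sigma> z = j" "i \<in> NI" "j \<in> NI" "z \<noteq> ''wi''"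
  shows "wp B (round (Reg y) (Reg z)) \<sigma> (\<lambda>t \<tau>. tracks st (vs @ seg i j @ [tip]) \<tau> \<and>
    snd (foldl mv st (vs @ seg i j @ [tip])) = tip \<and> t \<le> 80 * dsum {..<n} \<and> env \<tau> \<and>
    frame (round (Reg y) (Reg z)) \<sigma> \<tau>)"
proof (rule wp_mono_frame[OF wp_round[OF tr hole _ _ _ _ ij(3,4)]], goal_cases)
  case (5 t \<tau>)
  have "snd (foldl mv st (vs @ seg i j @ [tip])) = tip" by (subst snd_foldl_mv) auto
  then show ?case using 5 env by (auto simp: env_def frame_def simp del: foldl_append)
qed (use env ij in \<open>auto simp: env_def\<close>)

text \<open>The way an unfinished run is exploited: each initial part of the script has led to a
  jammed configuration.\<close>

lemma tracks_prefix: "tracks st (us @ vs) \<sigma> \<Longrightarrow> reg \<sigma> ''done'' = 0 \<Longrightarrow> jam (foldl mv st us)"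
  unfolding tracks_def by (elim conjE disjE) (simp, drule spec[of _ "length us"], simp)

lemma rnd_self: "i < K \<Longrightarrow> x tip = n \<Longrightarrow> rnd x i i = x"
proof
  fix u assume i: "i < K" "x tip = n"
  show "rnd x i i u = x u"
    using rnd_other[where x = x, OF i(1,1,2), of u] rnd_last[where x = x, OF i(1,1,2)] by (cases "u = zs ! i") auto
qed

text \<open>The colouring \<open>y\<close> is quantified so that the conclusion also covers a run in
  which the hole was filled; \<open>y\<close> is then a fiction that lets the next phase go
  on.\<close>

lemma wp_make_diff:
  assumes tr: "tracks (x, tip) [] \<sigma>" "reg \<sigma> ''done'' = 0" and env: "env \<sigma>" and len: "reg \<sigma> ''len'' = Suc K" "Suc K \<le> n"
    and mark: "\<And>k. k < K \<Longrightarrow> arr \<sigma> ''mark'' (zs ! k) = (if k \<in> NI then 1 else 0)"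
    and lo: "reg \<sigma> ''lo'' = lo" "lo \<in> NI" "\<And>i. i \<in> NI \<Longrightarrow> lo \<le> i"
    and ab: "reg \<sigma> ''a'' = a" "reg \<sigma> ''b'' = b" "a \<in> NI" "b \<in> NI" "a < b"
      "\<And>m. m \<in> NI \<Longrightarrow> a < m \<Longrightarrow> m < b \<Longrightarrow> False"
  shows "wp B make_diff \<sigma> (\<lambda>t \<tau>. t \<le> 100 * dsum {..<n} \<and> env \<tau> \<and>
    (\<exists>y. tracks (y, tip) [] \<tau> \<and> (reg \<tau> ''done'' = 0 \<longrightarrow> arr \<tau> ''part'' = y) \<and> y (zs ! a) \<noteq> y (zs ! b)))"
proof -
  have part: "arr \<sigma> ''part'' = x" and jam: "jam (x, tip)" using tr by (auto simp: tracks_def)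
  have xl: "x tip = n" using jam_hole_value[OF jam] .
  have K: "a < K" "b < K" "lo < K" using ab lo NI_less by auto
  define good where "good = (\<lambda>i. i \<in> NI \<and> x (zs ! i) \<noteq> (if a < i then x (zs ! a) else x (zs ! b)))"
  let ?b = "And (Equal (Get ''mark'' (vtx ''j'')) (Const 1))
              (And (Not (And (Less (Reg ''a'') (Reg ''j'')) (Equal (colour ''j'') (colour ''a''))))
                 (Not (And (Not (Less (Reg ''a'') (Reg ''j''))) (Equal (colour ''j'') (colour ''b'')))))"
  let ?L = "for_range ''j'' (Reg ''lo'') (Minus (Reg ''len'') (Const 1)) (If ?b (Assign ''d'' (Reg ''j'')) Skip)"
  let ?R = "If (Less (Reg ''a'') (Reg ''d'')) (round (Reg ''d'') (Reg ''b'')) (round (Reg ''d'') (Reg ''a''))"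
  have L: "wp B ?L \<sigma> (\<lambda>t \<tau>. val (Reg ''lo'') \<sigma> \<le> reg \<tau> ''d'' \<and> reg \<tau> ''d'' < K \<and> good (reg \<tau> ''d'') \<and>
      t \<le> (\<Sum>i = val (Reg ''lo'') \<sigma>..<K. 2 + 2) + 2)"
  proof (rule wp_for_range_last)
    have "stuck x tip" using jam by (simp add: jam_def)
    from stuck_not_mono[OF this tip_less, of "x (zs ! a)"]
    obtain i where i: "i \<in> NI" "x (zs ! i) \<noteq> x (zs ! a)" by (auto simp: nb_tip)
    \<comment> \<open>For \<open>a < i\<close> the index \<open>i\<close> is good. Otherwise, if the
      colours at \<open>i\<close> and \<open>b\<close> agree, the colour at \<open>b\<close> differs
      from that at \<open>a\<close>, and \<open>b\<close> itself is good.\<close>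
    have "good i \<or> good b" using i ab(4,5) by (auto simp: good_def)
    then show "\<exists>i. val (Reg ''lo'') \<sigma> \<le> i \<and> i < K \<and> good i" using lo i(1) ab(4) NI_less by auto
  next
    fix i \<tau> assume i: "val (Reg ''lo'') \<sigma> \<le> i" "i < K" "reg \<tau> ''j'' = i" and fr: "frame ?L \<sigma> \<tau>"
    have o: "arr \<tau> = arr \<sigma>" "reg \<tau> ''a'' = a" "reg \<tau> ''b'' = b" using fr ab by (auto simp: frame_def)
    have "arr \<sigma> ''ord'' i = zs ! i" "arr \<sigma> ''ord'' a = zs ! a" "arr \<sigma> ''ord'' b = zs ! b"
      using env i K K_less by (auto simp: env_def)
    then have tst: "test ?b \<tau> \<longleftrightarrow> good i" using o i mark[OF i(2)] part by (auto simp: good_def)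
    show "wp B (If ?b (Assign ''d'' (Reg ''j'')) Skip) \<tau>
        (\<lambda>t \<tau>'. reg \<tau>' ''d'' = (if good i then i else reg \<tau> ''d'') \<and> t \<le> 2)"
      unfolding wp_If tst using i len B_ge by auto
  qed (use len B_ge lo K in \<open>auto simp: frame_def\<close>)
  show ?thesis
    unfolding make_diff_def wp_Seq[of _ ?L]
  proof (rule wp_mono_frame[OF L], goal_cases)
    case (1 t1 \<tau>1)
    define d where "d = reg \<tau>1 ''d''"
    have d: "d < K" "good d" using 1(1) by (auto simp: d_def)
    then have dNI: "d \<in> NI" by (simp add: good_def)
    have "(\<Sum>i = lo..<K. 2 + 2 :: nat) \<le> 4 * n" using len by simp
    moreover have "n \<le> dsum {..<n}" by (simp add: dsum_def sum.distrib sum_Suc)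
    ultimately have t1: "t1 \<le> 4 * dsum {..<n} + 2" using 1(1) lo by simp
    have e1: "arr \<tau>1 = arr \<sigma>" "reg \<tau>1 ''a'' = a" "reg \<tau>1 ''b'' = b" "reg \<tau>1 ''d'' = d" "reg \<tau>1 ''done'' = 0"
      using 1(2) ab tr by (auto simp: frame_def d_def)
    have env1: "env \<tau>1" using env 1(2) by (auto simp: env_def frame_def)
    have "reg \<tau>1 ''h'' = reg \<sigma> ''h''" "reg \<tau>1 ''n'' = reg \<sigma> ''n''" "reg \<tau>1 ''s'' = reg \<sigma> ''s''"
      using 1(2) by (auto simp: frame_def)
    then have tr1: "tracks (x, tip) [] \<tau>1" using tr e1 by (auto simp: tracks_def ready_def input_def)
    \<comment> \<open>The end of the pair on the side of \<open>d\<close>; no neighbour of the tip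
      lies strictly between \<open>a\<close> and \<open>b\<close>, so the rotation misses the other
      end.\<close>
    define g where "g = (if a < d then b else a)"
    have gNI: "g \<in> NI" "g < K" using ab K by (auto simp: g_def)
    let ?y = "rnd x d g"
    have y: "?y (zs ! a) \<noteq> ?y (zs ! b)"
    proof (cases "a < d")
      case True
      then have "b \<le> d" using ab(6)[OF dNI] by fastforce
      then have "?y (zs ! a) = x (zs ! a)" using ab(5) True K d
        by (intro rnd_other_nth[where x = x, OF d(1) gNI(2) xl]) (auto simp: g_def)
      moreover have "?y (zs ! b) = x (zs ! d)" using rnd_last[where x = x, OF d(1) gNI(2) xl] True by (simp add: g_def)
      ultimately show ?thesis using d(2) True by (auto simp: good_def)
    next
      case False
      then have "?y (zs ! b) = x (zs ! b)" using ab(5) K d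
        by (intro rnd_other_nth[where x = x, OF d(1) gNI(2) xl]) (auto simp: g_def)
      moreover have "?y (zs ! a) = x (zs ! d)" using rnd_last[where x = x, OF d(1) gNI(2) xl] False by (simp add: g_def)
      ultimately show ?thesis using d(2) False by (auto simp: good_def)
    qed
    have W: "wp B (round (Reg ''d'') (Reg r)) \<tau>1 (\<lambda>t \<tau>. t1 + (t + 1) \<le> 100 * dsum {..<n} \<and> env \<tau> \<and>
      (\<exists>y. tracks (y, tip) [] \<tau> \<and> (reg \<tau> ''done'' = 0 \<longrightarrow> arr \<tau> ''part'' = y) \<and> y (zs ! a) \<noteq> y (zs ! b)))"
      if "reg \<tau>1 r = g" "r \<noteq> ''wi''" for r
    proof (rule wp_mono[OF wp_round_regs[OF tr1 _ env1 e1(4) that(1) dNI gNI(1) that(2)]], goal_cases)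
      case (2 t \<tau>)
      then have tr2: "tracks (x, tip) (seg d g @ [tip]) \<tau>" by simp
      have fd: "foldl mv (x, tip) (seg d g @ [tip]) = (?y, tip)" using foldl_rnd[where x = x, OF d(1) gNI(2) xl] .
      have "\<exists>y. tracks (y, tip) [] \<tau> \<and> (reg \<tau> ''done'' = 0 \<longrightarrow> arr \<tau> ''part'' = y) \<and> y (zs ! a) \<noteq> y (zs ! b)"
      proof (cases "reg \<tau> ''done'' = 0")
        case True
        then have "(arr \<tau> ''part'', reg \<tau> ''h'') = (?y, tip)" using tr2 fd by (auto simp: tracks_def)
        then show ?thesis using tracks_reset[OF tr2] y by auto
      next
        case False
        then have "tracks (?y, tip) [] \<tau>" by (rule tracks_cong_done[OF tr2])
        then show ?thesis using y False by (intro exI[of _ ?y]) simp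
      qed
      then show ?case using 2 t1 dsum_ge by auto
    qed simp
    show ?case
    proof (cases "a < d")
      case True
      then show ?thesis unfolding wp_If using W[of "''b''"] e1 by (simp add: g_def)
    next
      case False
      then show ?thesis unfolding wp_If using W[of "''a''"] e1 by (simp add: g_def)
    qed
  qed
qed

lemma wp_finish_swap:
  assumes tr: "tracks (x, tip) [] \<sigma>" and env: "env \<sigma>"
    and r: "reg \<sigma> ''a'' = a" "reg \<sigma> ''b'' = Suc a" "reg \<sigma> ''q'' = q" "a \<in> NI" "Suc a \<in> NI" "q \<in> NI"
    and bd: "(zs ! a \<in> insert (zs ! q) (nb (zs ! q))) \<noteq> (zs ! Suc a \<in> insert (zs ! q) (nb (zs ! q)))"
    and diff: "x (zs ! a) \<noteq> x (zs ! Suc a)"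
  shows "wp B finish_swap \<sigma> (\<lambda>t \<tau>. t \<le> 240 * dsum {..<n} \<and> partial (arr \<tau> ''part'') {..<n})"
proof -
  have K: "a < K" "Suc a < K" "q < K" using r NI_less by auto
  have s0: "snd (foldl mv (x, tip) []) = tip" by simp
  show ?thesis
    unfolding finish_swap_def wp_Seq
  proof (rule wp_mono[OF wp_round_regs[OF tr s0 env r(3,3,6,6)]], simp, elim conjE, goal_cases)
    case (1 t1 \<tau>1)
    then have r1: "reg \<tau>1 ''a'' = a" "reg \<tau>1 ''b'' = Suc a" "reg \<tau>1 ''q'' = q" using r by (auto simp: frame_def)
    note t1 = 1(3)
    show ?case
    proof (rule wp_mono[OF wp_round_regs[OF 1(1,2,4) r1(1,2) r(4,5)]], simp, elim conjE, goal_cases)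
      case (1 t2 \<tau>2)
      then have r2: "reg \<tau>2 ''q'' = q" using r1 by (auto simp: frame_def)
      note t2 = 1(3)
      show ?case
      proof (rule wp_mono[OF wp_round_regs[OF 1(1,2,4) r2 r2 r(6,6)]], simp, elim conjE, goal_cases)
        case (1 t3 \<tau>3)
        let ?v = "zs ! q"
        have "reg \<tau>3 ''done'' \<noteq> 0"
        proof
          assume d0: "reg \<tau>3 ''done'' = 0"
          have "jam (foldl mv (x, tip) [])"
            by (rule tracks_prefix[of _ "[]" _ \<tau>3, OF _ d0]) (use 1(1) in simp)
          then have x: "jam (x, tip)" by simp
          have xl: "x tip = n" using jam_hole_value[OF x] .
          have f1: "foldl mv (x, tip) (seg q q @ [tip]) = (x, tip)"
            using foldl_rnd[where x = x, OF K(3,3) xl] rnd_self[where x = x, OF K(3) xl] by simp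
          have f2: "foldl mv (x, tip) (seg a (Suc a) @ [tip]) = (rnd x a (Suc a), tip)"
            using foldl_rnd[where x = x, OF K(1,2) xl] .
          \<comment> \<open>The two looks from \<open>?v\<close>: the prefix that ends when the hole
            first stands there, and below the prefix that lacks only the final return to the
            tip.\<close>
          have "jam (foldl mv (x, tip) [?v])"
            by (rule tracks_prefix[of _ _ "[tip] @ (seg a (Suc a) @ [tip]) @ (seg q q @ [tip])", OF _ d0])
              (use 1(1) in \<open>simp add: seg_def\<close>)
          moreover have "jam (foldl mv (x, tip) ((seg q q @ [tip]) @ (seg a (Suc a) @ [tip]) @ [?v]))"
            by (rule tracks_prefix[of _ _ "[tip]", OF _ d0]) (use 1(1) in \<open>simp add: seg_def\<close>)
          then have "jam (foldl mv (foldl mv (foldl mv (x, tip) (seg q q @ [tip])) (seg a (Suc a) @ [tip])) [?v])"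
            by (simp only: foldl_append)
          then have "jam (mv (rnd x a (Suc a), tip) ?v)" unfolding f1 f2 by (simp only: foldl.simps)
          ultimately show False using swap_contradiction[OF x r(4-6) diff bd] by simp
        qed
        then have "partial (arr \<tau>3 ''part'') {..<n}" using 1(1) by (auto simp: tracks_def)
        then show ?case using 1(3) t1 t2 by simp
      qed
    qed
  qed
qed

lemma wp_finish_gap:
  assumes tr: "tracks (x, tip) [] \<sigma>" "reg \<sigma> ''done'' = 0 \<longrightarrow> arr \<sigma> ''part'' = x" and env: "env \<sigma>"
    and len: "reg \<sigma> ''len'' = Suc K" "Suc K \<le> n"
    and lo: "reg \<sigma> ''lo'' = lo" "lo \<in> NI" "\<And>i. i \<in> NI \<Longrightarrow> lo \<le> i" and card: "3 \<le> card NI"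
    and ab: "reg \<sigma> ''a'' = a" "reg \<sigma> ''b'' = b" "a \<in> NI" "b \<in> NI" "Suc a < b"
      "\<And>m. m \<in> NI \<Longrightarrow> a < m \<Longrightarrow> m < b \<Longrightarrow> False"
    and diff: "x (zs ! a) \<noteq> x (zs ! b)"
  shows "wp B finish_gap \<sigma> (\<lambda>t \<tau>. t \<le> 500 * dsum {..<n} \<and> partial (arr \<tau> ''part'') {..<n})"
proof -
  have K: "a < K" "b < K" "lo < K" using ab lo NI_less by auto
  \<comment> \<open>If \<open>lo\<close> lies before the gap, it serves as \<open>e\<close>.
    Otherwise the gap starts at \<open>lo\<close>, and \<open>e\<close> is the last neighbour of the
    tip, with index \<open>K - 1\<close>.\<close>
  define f g e where "f = (if lo < a then b else a)" and "g = (if lo < a then a else b)"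
    and "e = (if lo < a then lo else K - 1)"
  have K1: "K - 1 \<in> NI" using pred_NI K by simp
  have fge: "f \<in> NI" "g \<in> NI" "e \<in> NI" using ab lo K1 by (auto simp: f_def g_def e_def)
  have fgeK: "f < K" "g < K" "e < K" using fge NI_less by auto
  have gap: "\<And>m. m \<in> NI \<Longrightarrow> min f g < m \<Longrightarrow> m < max f g \<Longrightarrow> False"
    using ab(5,6) by (auto simp: f_def g_def split: if_splits)
  have wide: "Suc f < g \<and> g < e \<or> Suc g < f \<and> e < g"
  proof (cases "lo < a")
    case False
    then have "a = lo" using lo(3)[OF ab(3)] by simp
    \<comment> \<open>The tip has at least three neighbours, so when \<open>a\<close> is the first
      one, some neighbour lies beyond \<open>b\<close>.\<close>
    have "\<not> NI \<subseteq> {a, b}"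
    proof
      assume "NI \<subseteq> {a, b}"
      then have "card NI \<le> card {a, b}" by (intro card_mono) auto
      also have "\<dots> \<le> 2" by (cases "a = b") auto
      finally show False using card by simp
    qed
    then obtain i where i: "i \<in> NI" "i \<noteq> a" "i \<noteq> b" by auto
    then have "b < i" using lo(3)[OF i(1)] ab(6)[OF i(1)] \<open>a = lo\<close> by fastforce
    then have "b < K - 1" using NI_less[OF i(1)] by simp
    then show ?thesis using False ab(5) by (simp add: f_def g_def e_def)
  qed (use ab(5) in \<open>auto simp: f_def g_def e_def\<close>)
  have dfg: "x (zs ! f) \<noteq> x (zs ! g)" using diff by (auto simp: f_def g_def)
  let ?\<sigma> = "set_reg ''e'' e (set_reg ''g'' g (set_reg ''f'' f \<sigma>))"
  have r: "reg ?\<sigma> ''f'' = f" "reg ?\<sigma> ''g'' = g" "reg ?\<sigma> ''e'' = e" by auto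
  have tr0: "tracks (x, tip) [] ?\<sigma>" using tr(1) by simp
  have env0: "env ?\<sigma>" using env by (simp add: env_def)
  have s0: "snd (foldl mv (y, tip) []) = tip" for y by simp
  let ?A = "If (Less (Reg ''lo'') (Reg ''a''))
       (Assign ''f'' (Reg ''b'') ;; Assign ''g'' (Reg ''a'') ;; Assign ''e'' (Reg ''lo''))
       (Assign ''f'' (Reg ''a'') ;; Assign ''g'' (Reg ''b'') ;; Assign ''e'' (Minus (Reg ''len'') (Const 2)))"
  let ?C = "If (And (Equal (Reg ''done'') (Const 0)) (Equal (colour ''e'') (colour ''g''))) (round (Reg ''f'') (Reg ''g'')) Skip"
  have A: "wp B ?A \<sigma> (\<lambda>t \<tau>. t = 4 \<and> \<tau> = ?\<sigma>)"
    using ab lo len K B_ge by (auto simp: f_def g_def e_def)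
  have C: "wp B ?C ?\<sigma> (\<lambda>t \<tau>. t \<le> 80 * dsum {..<n} + 2 \<and> env \<tau> \<and> reg \<tau> ''f'' = f \<and> reg \<tau> ''g'' = g \<and> reg \<tau> ''e'' = e \<and>
      (\<exists>y. tracks (y, tip) [] \<tau> \<and> y (zs ! e) \<noteq> y (zs ! g)))"
  proof (cases "reg \<sigma> ''done'' = 0")
    case True
    have px: "arr \<sigma> ''part'' = x" using tr True by blast
    have jam: "jam (x, tip)" using tracks_prefix[of "(x, tip)" "[]" "[]" \<sigma>] tr True by simp
    have xl: "x tip = n" using jam_hole_value[OF jam] .
    have o: "arr \<sigma> ''ord'' e = zs ! e" "arr \<sigma> ''ord'' g = zs ! g" using env fgeK K_less by (auto simp: env_def)
    show ?thesis
    proof (cases "x (zs ! e) = x (zs ! g)")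
      case False
      then show ?thesis using o px tr0 env0 by auto
    next
      case eq: True
      \<comment> \<open>This rotation puts the colour of \<open>f\<close> on \<open>g\<close> and
        does not touch \<open>e\<close>.\<close>
      let ?y = "rnd x f g"
      have y: "?y (zs ! e) \<noteq> ?y (zs ! g)"
      proof -
        have "?y (zs ! g) = x (zs ! f)" using rnd_last[where x = x, OF fgeK(1,2) xl] .
        moreover have "?y (zs ! e) = x (zs ! e)"
          by (rule rnd_other_nth[where x = x, OF fgeK(1,2) xl]) (use wide fgeK in auto)
        ultimately show ?thesis using dfg eq by simp
      qed
      have "wp B (round (Reg ''f'') (Reg ''g'')) ?\<sigma> (\<lambda>t \<tau>. t + 1 \<le> 80 * dsum {..<n} + 2 \<and> env \<tau> \<and>
        reg \<tau> ''f'' = f \<and> reg \<tau> ''g'' = g \<and> reg \<tau> ''e'' = e \<and>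
        (\<exists>y. tracks (y, tip) [] \<tau> \<and> y (zs ! e) \<noteq> y (zs ! g)))"
      proof (rule wp_mono[OF wp_round_regs[OF tr0 s0 env0 r(1,2) fge(1,2)]], simp, elim conjE, goal_cases)
        case (1 t \<tau>)
        then have tr2: "tracks (x, tip) (seg f g @ [tip]) \<tau>" by simp
        have fd: "foldl mv (x, tip) (seg f g @ [tip]) = (?y, tip)" using foldl_rnd[where x = x, OF fgeK(1,2) xl] .
        have "tracks (?y, tip) [] \<tau>"
        proof (cases "reg \<tau> ''done'' = 0")
          case True
          then have "(arr \<tau> ''part'', reg \<tau> ''h'') = (?y, tip)" using tr2 fd by (auto simp: tracks_def)
          then show ?thesis using tracks_reset[OF tr2] by simp
        qed (rule tracks_cong_done[OF tr2])
        moreover have "reg \<tau> ''f'' = f" "reg \<tau> ''g'' = g" "reg \<tau> ''e'' = e" using 1(5) by (auto simp: frame_def)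
        ultimately show ?case using 1(3,4) y by auto
      qed
      then show ?thesis unfolding wp_If using o px eq True by simp
    qed
  next
    case False
    \<comment> \<open>The hole is already filled, so \<open>tracks\<close> accepts any start; a
      dummy colouring that separates \<open>e\<close> from \<open>g\<close> meets the claim.\<close>
    define y :: "nat \<Rightarrow> nat" where "y = (\<lambda>u. if u = zs ! e then 0 else 1)"
    have ne: "zs ! g \<noteq> zs ! e" using zs_eq[of g e] fgeK wide by auto
    have "tracks (y, tip) [] ?\<sigma>" using tracks_cong_done[OF tr(1) False] by simp
    moreover have "y (zs ! e) \<noteq> y (zs ! g)" using ne by (simp add: y_def)
    ultimately show ?thesis unfolding wp_If using False env0 by auto
  qed
  show ?thesis
    unfolding finish_gap_def wp_Seq[of _ ?A] wp_Seq[of _ ?C]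
  proof (rule wp_mono[OF A], elim conjE, hypsubst, rule wp_mono[OF C], elim conjE exE, goal_cases)
    case (1 _ _ t0 \<tau>0 y)
    note t0 = 1(1) and r0 = 1(3-5) and dy = 1(7)
    show ?case
      unfolding wp_Seq
    proof (rule wp_mono[OF wp_round_regs[OF 1(6) s0 1(2) r0(1,2) fge(1,2)]], simp, elim conjE, goal_cases)
      case (1 t1 \<tau>1)
      then have r1: "reg \<tau>1 ''f'' = f" "reg \<tau>1 ''g'' = g" "reg \<tau>1 ''e'' = e" using r0 by (auto simp: frame_def)
      note t1 = 1(3)
      show ?case
      proof (rule wp_mono[OF wp_round_regs[OF 1(1,2,4) r1(2,1) fge(2,1)]], simp, elim conjE, goal_cases)
        case (1 t2 \<tau>2)
        then have r2: "reg \<tau>2 ''f'' = f" "reg \<tau>2 ''g'' = g" "reg \<tau>2 ''e'' = e" using r1 by (auto simp: frame_def)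
        note t2 = 1(3)
        show ?case
        proof (rule wp_mono[OF wp_round_regs[OF 1(1,2,4) r2(3,2) fge(3,2)]], simp, elim conjE, goal_cases)
          case (1 t3 \<tau>3)
          then have r3: "reg \<tau>3 ''f'' = f" "reg \<tau>3 ''g'' = g" using r2 by (auto simp: frame_def)
          note t3 = 1(3)
          show ?case
          proof (rule wp_mono[OF wp_round_regs[OF 1(1,2,4) r3 fge(1,2)]], simp, elim conjE, goal_cases)
            case (1 t4 \<tau>4)
            let ?s = "\<lambda>i j. seg i j @ [tip]"
            have tr4: "tracks (y, tip) (?s f g @ ?s g f @ ?s e g @ ?s f g) \<tau>4" using 1(1) by simp
            have "reg \<tau>4 ''done'' \<noteq> 0"
            proof
              assume d0: "reg \<tau>4 ''done'' = 0"
              have "jam (foldl mv (y, tip) [])"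
                by (rule tracks_prefix[of _ "[]" _ \<tau>4, OF _ d0]) (use tr4 in simp)
              then have x: "jam (y, tip)" by simp
              have yl: "y tip = n" using jam_hole_value[OF x] .
              note rl = rnd_tip[where x = y, OF _ _ yl]
              have f1: "foldl mv (y, tip) (?s f g) = (rnd y f g, tip)" using foldl_rnd[where x = y, OF fgeK(1,2) yl] .
              \<comment> \<open>The second round undoes the first, so the third starts from
                \<open>y\<close> again, as \<open>gap_contradiction\<close> requires.\<close>
              have f2: "foldl mv (rnd y f g, tip) (?s g f) = (y, tip)"
                using foldl_rnd[where x = "rnd y f g", OF fgeK(2,1) rl[OF fgeK(1,2)]]
                  rnd_inverse[where x = y, OF fgeK(1,2) yl] by simp
              have f3: "foldl mv (y, tip) (?s e g) = (rnd y e g, tip)" using foldl_rnd[where x = y, OF fgeK(3,2) yl] .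
              have f4: "foldl mv (rnd y e g, tip) (?s f g) = (rnd (rnd y e g) f g, tip)"
                using foldl_rnd[where x = "rnd y e g", OF fgeK(1,2) rl[OF fgeK(3,2)]] .
              have "jam (foldl mv (y, tip) (?s f g))" by (rule tracks_prefix[OF tr4 d0])
              then have j1: "jam (rnd y f g, tip)" unfolding f1 .
              have "jam (foldl mv (y, tip) (?s f g @ ?s g f @ ?s e g))"
                by (rule tracks_prefix[of _ _ "?s f g", OF _ d0]) (use tr4 in simp)
              then have "jam (foldl mv (foldl mv (foldl mv (y, tip) (?s f g)) (?s g f)) (?s e g))"
                by (simp only: foldl_append)
              then have j2: "jam (rnd y e g, tip)" unfolding f1 f2 f3 .
              have "jam (foldl mv (y, tip) (?s f g @ ?s g f @ ?s e g @ ?s f g))"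
                by (rule tracks_prefix[of _ _ "[]", OF _ d0]) (use tr4 in simp)
              then have "jam (foldl mv (foldl mv (foldl mv (foldl mv (y, tip) (?s f g)) (?s g f)) (?s e g)) (?s f g))"
                by (simp only: foldl_append)
              then have j3: "jam (rnd (rnd y e g) f g, tip)" unfolding f1 f2 f3 f4 .
              show False using gap_contradiction[OF x fge gap wide dy j1 j2 j3] .
            qed
            then have "partial (arr \<tau>4 ''part'') {..<n}" using 1(1) by (auto simp: tracks_def)
            then show ?case using 1(3) t0 t1 t2 t3 dsum_ge by simp
          qed
        qed
      qed
    qed
  qed
qed

section \<open>Assembling the repair phase\<close>

lemma tracks_frame:
  assumes "tracks st vs \<sigma>" "frame c \<sigma> \<tau>" "wregs c \<inter> {''n'', ''s'', ''h'', ''done''} = {}"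
    "warrs c \<inter> {''off'', ''adj'', ''p'', ''cnt'', ''part''} = {}"
  shows "tracks st vs \<tau>"
proof -
  have "reg \<tau> y = reg \<sigma> y" if "y \<in> {''n'', ''s'', ''h'', ''done''}" for y
    using assms(2,3) that unfolding frame_def by blast
  moreover have "arr \<tau> y = arr \<sigma> y" if "y \<in> {''off'', ''adj'', ''p'', ''cnt'', ''part''}" for y
    using assms(2,4) that unfolding frame_def by blast
  ultimately show ?thesis using assms(1) by (simp add: tracks_def ready_def input_def)
qed

text \<open>The common result of both searches. In either case \<open>a\<close> and \<open>b\<close>
  are successive neighbours of the tip, which is all that \<open>make_diff\<close> needs; the last
  clause holds the data for the script chosen by \<open>gap\<close>.\<close>

definition located :: "state \<Rightarrow> bool" where
  "located \<tau> \<longleftrightarrow> (let a = reg \<tau> ''a''; b = reg \<tau> ''b''; M = insert (zs ! reg \<tau> ''q'') (nb (zs ! reg \<tau> ''q'')) in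
     a \<in> NI \<and> b \<in> NI \<and> a < b \<and> (\<forall>m\<in>NI. \<not> (a < m \<and> m < b)) \<and>
     (if reg \<tau> ''gap'' = 0 then b = Suc a \<and> reg \<tau> ''q'' \<in> NI \<and> (zs ! a \<in> M) \<noteq> (zs ! Suc a \<in> M) else Suc a < b))"

lemma wp_locate:
  assumes ls: "listed zs \<sigma>" "set zs = {..<n}" and len: "reg \<sigma> ''len'' = Suc K" and env: "env \<sigma>"
    and tr: "tracks (x, tip) [] \<sigma>" "reg \<sigma> ''done'' = 0"
    and mark: "\<And>v. v < n \<Longrightarrow> arr \<sigma> ''mark'' v = 0 \<and> arr \<sigma> ''mk'' v = 0"
  shows "wp B (for_nbr ''l'' (Put ''mark'' (Get ''adj'' (Reg ''k'')) (Const 1)) ;; scan_gap ;;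
     If (Equal (Reg ''gap'') (Const 0)) find_far Skip) \<sigma> (\<lambda>t \<tau>. t \<le> 90 * dsum {..<n} \<and> env \<tau> \<and>
     tracks (x, tip) [] \<tau> \<and> reg \<tau> ''done'' = 0 \<and> reg \<tau> ''len'' = Suc K \<and>
     (\<forall>k<K. arr \<tau> ''mark'' (zs ! k) = (if k \<in> NI then 1 else 0)) \<and>
     reg \<tau> ''lo'' \<in> NI \<and> (\<forall>i\<in>NI. reg \<tau> ''lo'' \<le> i) \<and> located \<tau>)"
    (is "wp B (?P ;; scan_gap ;; ?R) \<sigma> ?Q")
proof -
  note D = listedD[OF ls(1)]
  have inp: "input n E p \<sigma>" and jam: "jam (x, tip)" using tr by (auto simp: tracks_def ready_def)
  have deg: "deg tip = \<Delta>" using jam stuck_deg tip_less by (auto simp: jam_def)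
  have ne: "NI \<noteq> {}" using card_NI deg Delta_ge by auto
  have Kn: "Suc K \<le> n" using K_less distinct_card[OF dist] ls(2) by simp
  have l: "reg \<sigma> ''l'' = tip" using env by (simp add: env_def)
  have M: "wp B ?P \<sigma> (\<lambda>t \<tau>. (\<forall>u. arr \<tau> ''mark'' u = (if u \<in> nb tip then 1 else arr \<sigma> ''mark'' u)) \<and> t \<le> (1 + 2) * deg tip + 2)"
    by (rule wp_mark[OF inp l tip_less]) auto
  show ?thesis
    unfolding wp_Seq
  proof (rule wp_mono_frame[OF M], goal_cases)
    case (1 t1 \<tau>1)
    note fr1 = 1(2)
    have mark1: "arr \<tau>1 ''mark'' (zs ! k) = (if k \<in> NI then 1 else 0)" if "k < K" for k
      using 1(1) mark[of "zs ! k"] zs_n[of k] that by (simp add: NI_def)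
    have t1: "t1 \<le> 3 * dsum {..<n} + 2" using 1(1) deg_le_dsum[OF tip_less] by simp
    have tr1: "tracks (x, tip) [] \<tau>1" by (rule tracks_frame[OF tr(1) fr1]) auto
    have e1: "arr \<tau>1 ''ord'' = arr \<sigma> ''ord''" "arr \<tau>1 ''pos'' = arr \<sigma> ''pos''" "arr \<tau>1 ''mk'' = arr \<sigma> ''mk''"
      "reg \<tau>1 ''len'' = Suc K" "reg \<tau>1 ''l'' = tip" "reg \<tau>1 ''done'' = 0"
      using fr1 len l tr by (auto simp: frame_def)
    have S: "wp B scan_gap \<tau>1 (\<lambda>t \<tau>. t \<le> 20 * dsum {..<n} \<and> reg \<tau> ''lo'' \<in> NI \<and> (\<forall>i\<in>NI. reg \<tau> ''lo'' \<le> i) \<and>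
      (reg \<tau> ''gap'' = 0 \<and> {reg \<tau> ''lo''..<K} \<subseteq> NI \<or>
       reg \<tau> ''gap'' = 1 \<and> reg \<tau> ''a'' \<in> NI \<and> reg \<tau> ''b'' \<in> NI \<and> Suc (reg \<tau> ''a'') < reg \<tau> ''b'' \<and>
       (\<forall>i\<in>NI. \<not> (reg \<tau> ''a'' < i \<and> i < reg \<tau> ''b''))))"
      using mark1 Kn ne D(5) e1 by (intro wp_scan_gap) auto
    show ?case
    proof (rule wp_mono_frame[OF S], elim conjE, goal_cases)
      case (1 t2 \<tau>2)
      have t2: "t2 \<le> 20 * dsum {..<n}" and fr2: "frame scan_gap \<tau>1 \<tau>2"
        and lo2: "reg \<tau>2 ''lo'' \<in> NI" "\<forall>i\<in>NI. reg \<tau>2 ''lo'' \<le> i"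
        and G: "reg \<tau>2 ''gap'' = 0 \<and> {reg \<tau>2 ''lo''..<K} \<subseteq> NI \<or>
       reg \<tau>2 ''gap'' = 1 \<and> reg \<tau>2 ''a'' \<in> NI \<and> reg \<tau>2 ''b'' \<in> NI \<and> Suc (reg \<tau>2 ''a'') < reg \<tau>2 ''b'' \<and>
       (\<forall>i\<in>NI. \<not> (reg \<tau>2 ''a'' < i \<and> i < reg \<tau>2 ''b''))" by fact+
      have tr2: "tracks (x, tip) [] \<tau>2" by (rule tracks_frame[OF tr1 fr2]) auto
      have e2: "arr \<tau>2 = arr \<tau>1" "reg \<tau>2 ''len'' = Suc K" "reg \<tau>2 ''l'' = tip" "reg \<tau>2 ''done'' = 0"
        using fr2 e1 by (auto simp: frame_def)
      have env2: "env \<tau>2" using e1 e2 D(5) by (simp add: env_def)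
      show ?case
      proof (cases "reg \<tau>2 ''gap'' = 0")
        case False
        then have "located \<tau>2" using G by (auto simp: located_def Let_def)
        then show ?thesis using False lo2 t1 t2 tr2 e2 env2 mark1 dsum_ge by simp
      next
        case True
        define lo where "lo = reg \<tau>2 ''lo''"
        have lo: "reg \<tau>2 ''lo'' = lo" "lo < K" using lo2 NI_less by (auto simp: lo_def)
        have NI: "NI = {lo..<K}" using G True lo2 NI_less by (auto simp: lo_def)
        have inp2: "input n E p \<tau>2" using tr2 by (simp add: tracks_def ready_def)
        have "wp B find_far \<tau>2 (\<lambda>t \<tau>. t \<le> 60 * dsum {..<n} \<and> reg \<tau> ''q'' \<in> NI \<and> lo \<le> reg \<tau> ''a'' \<and> Suc (reg \<tau> ''a'') < K \<and>
          reg \<tau> ''b'' = Suc (reg \<tau> ''a'') \<and>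
          (zs ! reg \<tau> ''a'' \<in> insert (zs ! reg \<tau> ''q'') (nb (zs ! reg \<tau> ''q''))) \<noteq>
          (zs ! Suc (reg \<tau> ''a'') \<in> insert (zs ! reg \<tau> ''q'') (nb (zs ! reg \<tau> ''q''))))"
          using D(5,6) e1 e2 mark by (intro wp_find_far[OF inp2 _ _ ls(2) _ _ lo NI deg]) auto
        then have "wp B find_far \<tau>2 (\<lambda>t. ?Q (t1 + (t2 + (t + 1))))"
        proof (rule wp_mono_frame, elim conjE, goal_cases)
          case (1 t3 \<tau>3)
          have fr3: "frame find_far \<tau>2 \<tau>3" and t3: "t3 \<le> 60 * dsum {..<n}" by fact+
          have "reg \<tau>3 ''a'' \<in> NI" "reg \<tau>3 ''b'' \<in> NI" unfolding NI using 1 by auto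
          moreover have "reg \<tau>3 ''gap'' = 0" using fr3 True by (simp add: frame_def)
          ultimately have "located \<tau>3" using 1 unfolding located_def Let_def by auto
          moreover have "tracks (x, tip) [] \<tau>3" by (rule tracks_frame[OF tr2 fr3]) auto
          moreover have "arr \<tau>3 ''ord'' = arr \<tau>2 ''ord''" "arr \<tau>3 ''mark'' = arr \<tau>1 ''mark''" "reg \<tau>3 ''lo'' = reg \<tau>2 ''lo''"
            "reg \<tau>3 ''l'' = tip" "reg \<tau>3 ''len'' = Suc K" "reg \<tau>3 ''done'' = 0"
            using fr3 e2 by (auto simp: frame_def)
          moreover from this have "env \<tau>3" using env2 by (simp add: env_def)
          ultimately show ?case using lo2 t1 t2 t3 mark1 dsum_ge by simp
        qed
        then show ?thesis using True by simp
      qed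
    qed
  qed
qed

lemma wp_repair:
  assumes ls: "listed zs \<sigma>" "set zs = {..<n}" and len: "reg \<sigma> ''len'' = Suc K" and env: "env \<sigma>"
    and tr: "tracks (x, tip) [] \<sigma>" "reg \<sigma> ''done'' = 0"
    and mark: "\<And>v. v < n \<Longrightarrow> arr \<sigma> ''mark'' v = 0 \<and> arr \<sigma> ''mk'' v = 0"
  shows "wp B repair \<sigma> (\<lambda>t \<tau>. t \<le> 700 * dsum {..<n} \<and> partial (arr \<tau> ''part'') {..<n})"
proof -
  have jam: "jam (x, tip)" using tr by (auto simp: tracks_def)
  have card: "3 \<le> card NI" using jam stuck_deg tip_less card_NI Delta_ge by (auto simp: jam_def)
  have Kn: "Suc K \<le> n" using K_less distinct_card[OF dist] ls(2) by simp
  \<comment> \<open>Groups the first three commands, so that \<open>wp_locate\<close> applies to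
    them as one block.\<close>
  have assoc: "wp B ((P1 ;; P2 ;; P3) ;; P4 ;; P5) \<sigma> Q \<Longrightarrow> wp B (P1 ;; P2 ;; P3 ;; P4 ;; P5) \<sigma> Q"
    for P1 P2 P3 P4 P5 and Q by (simp add: add.assoc)
  show ?thesis
    unfolding repair_def
  proof (rule assoc, unfold wp_Seq[of _ "_ ;; _"],
      rule wp_mono[OF wp_locate[OF ls len env tr mark]], assumption, elim conjE, goal_cases)
    case (1 t1 \<tau>1)
    note t1 = 1(1) and env1 = 1(2) and tr1 = 1(3,4) and len1 = 1(5) and mark1 = 1(6) and lo1 = 1(7,8) and loc = 1(9)
    define a b where "a = reg \<tau>1 ''a''" and "b = reg \<tau>1 ''b''"
    have ab: "a \<in> NI" "b \<in> NI" "a < b" "\<And>m. m \<in> NI \<Longrightarrow> a < m \<Longrightarrow> m < b \<Longrightarrow> False"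
      using loc by (auto simp: located_def Let_def a_def b_def)
    show ?case
      unfolding wp_Seq
    proof (rule wp_mono_frame[OF wp_make_diff[OF tr1 env1 len1 Kn mark1[rule_format] refl lo1(1) lo1(2)[rule_format]
            a_def[symmetric] b_def[symmetric] ab]], assumption, assumption, assumption, assumption, assumption,
         elim conjE exE, goal_cases)
      case (1 t2 \<tau>2 y)
      have fr: "frame make_diff \<tau>1 \<tau>2" and t2: "t2 \<le> 100 * dsum {..<n}" by fact+
      have e2: "reg \<tau>2 ''a'' = a" "reg \<tau>2 ''b'' = b" "reg \<tau>2 ''q'' = reg \<tau>1 ''q''" "reg \<tau>2 ''gap'' = reg \<tau>1 ''gap''"
        "reg \<tau>2 ''lo'' = reg \<tau>1 ''lo''" "reg \<tau>2 ''len'' = Suc K"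
        using fr len1 by (auto simp: frame_def a_def b_def)
      have env2: "env \<tau>2" and tr2: "tracks (y, tip) [] \<tau>2" and y: "reg \<tau>2 ''done'' = 0 \<longrightarrow> arr \<tau>2 ''part'' = y"
        and diff: "y (zs ! a) \<noteq> y (zs ! b)" by fact+
      show ?case
      proof (cases "reg \<tau>1 ''gap'' = 0")
        case True
        define q where "q = reg \<tau>1 ''q''"
        have b: "b = Suc a" and q: "q \<in> NI"
          and bd: "(zs ! a \<in> insert (zs ! q) (nb (zs ! q))) \<noteq> (zs ! Suc a \<in> insert (zs ! q) (nb (zs ! q)))"
          using loc True by (auto simp: located_def Let_def a_def b_def q_def)
        have "wp B finish_swap \<tau>2 (\<lambda>t \<tau>. t \<le> 240 * dsum {..<n} \<and> partial (arr \<tau> ''part'') {..<n})"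
          using e2 b ab(1,2) q diff by (intro wp_finish_swap[OF tr2 env2 _ _ _ _ _ _ bd]) (auto simp: q_def)
        then have "wp B finish_swap \<tau>2 (\<lambda>t \<tau>. t1 + (t2 + (t + 1)) \<le> 700 * dsum {..<n} \<and> partial (arr \<tau> ''part'') {..<n})"
          by (rule wp_mono) (use t1 t2 dsum_ge in auto)
        then show ?thesis unfolding wp_If using True e2 by simp
      next
        case False
        then have wide: "Suc a < b" using loc by (auto simp: located_def Let_def a_def b_def)
        have "wp B finish_gap \<tau>2 (\<lambda>t \<tau>. t \<le> 500 * dsum {..<n} \<and> partial (arr \<tau> ''part'') {..<n})"
          by (rule wp_finish_gap[OF tr2 y env2 e2(6) Kn e2(5) lo1(1) lo1(2)[rule_format] card e2(1,2) ab(1,2) wide ab(4) diff])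
        then have "wp B finish_gap \<tau>2 (\<lambda>t \<tau>. t1 + (t2 + (t + 1)) \<le> 700 * dsum {..<n} \<and> partial (arr \<tau> ''part'') {..<n})"
          by (rule wp_mono) (use t1 t2 dsum_ge in auto)
        then show ?thesis unfolding wp_If using False e2 by simp
      qed
    qed
  qed
qed

end

context machine
begin

lemma wp_partition_program:
  assumes "input n E p \<sigma>"
  shows "wp B partition_program \<sigma> (\<lambda>t \<tau>. t \<le> 2000 * (n + card E) \<and> partial (arr \<tau> ''part'') {..<n})"
  unfolding partition_program_def wp_Seq
proof (rule wp_mono[OF wp_prepare[OF assms]], elim conjE exE, goal_cases)
  case (1 t1 \<tau>1 zs len)
  note t1 = 1(1)
  have tr: "tracks (arr \<tau>1 ''part'', reg \<tau>1 ''h'') [] \<tau>1" and h: "reg \<tau>1 ''done'' = 0 \<longrightarrow> reg \<tau>1 ''h'' = reg \<tau>1 ''l''"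
    and mark: "\<forall>v\<le>n. arr \<tau>1 ''mark'' v = 0 \<and> arr \<tau>1 ''mk'' v = 0" and geo: "geometry zs len \<tau>1" by fact+
  have ls: "listed zs \<tau>1" "length zs = n" and len: "reg \<tau>1 ''len'' = len" "0 < len" "len \<le> n" and pth: "is_path (take len zs)"
    and l: "reg \<tau>1 ''l'' = zs ! (len - 1)" "nb (zs ! (len - 1)) \<subseteq> set (take len zs)"
    using geo by (auto simp: geometry_def)
  note D = listedD[OF ls(1)]
  have V: "set zs = {..<n}"
    using card_subset_eq[OF _ D(3)] distinct_card[OF D(2)] ls(2) by simp
  interpret R: route n E p B zs "len - 1"
  proof unfold_locales
    show "distinct zs" "set zs \<subseteq> {..<n}" by fact+
    show "len - 1 < length zs" using len ls by simp
    show "zs ! Suc k \<in> nb (zs ! k)" if "k < len - 1" for k using pth that len ls(2) by (auto simp: is_path_def)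
    show "nb (zs ! (len - 1)) \<subseteq> set (take (Suc (len - 1)) zs)" using l(2) len by simp
  qed
  show ?case
  proof (cases "reg \<tau>1 ''done'' = 0")
    case True
    have tip: "R.tip = reg \<tau>1 ''l''" unfolding R.tip_def l(1) ..
    have "wp B repair \<tau>1 (\<lambda>t \<tau>. t \<le> 700 * dsum {..<n} \<and> partial (arr \<tau> ''part'') {..<n})"
    proof (rule R.wp_repair[OF ls(1) V _ _ _ True])
      show "tracks (arr \<tau>1 ''part'', R.tip) [] \<tau>1" using tr h True tip by simp
      show "R.env \<tau>1" unfolding R.env_def using D(5) tip by simp
    qed (use len mark in auto)
    then have "wp B repair \<tau>1 (\<lambda>t \<tau>. t1 + (t + 1) \<le> 2000 * (n + card E) \<and> partial (arr \<tau> ''part'') {..<n})"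
      \<comment> \<open>Preparation and repair take at most \<open>900 * dsum {..<n} + 1\<close>
        steps, and \<open>dsum {..<n}\<close> is at most \<open>2 * (n + card E)\<close>.\<close>
      by (rule wp_mono) (use t1 dsum_V dsum_ge in auto)
    then show ?thesis unfolding wp_If using True by simp
  next
    case False
    then have "partial (arr \<tau>1 ''part'') {..<n}" using tr by (auto simp: tracks_def)
    then show ?thesis using False t1 dsum_V dsum_ge by auto
  qed
qed

end

theorem theorem3:
  "\<exists>(P :: com) (c :: nat) (k :: nat).
     \<forall>(n :: nat) (E :: nat set set) (p :: nat list) (\<sigma> :: state).
       simple_graph {..<n} E \<and> connected_graph {..<n} E \<and> \<not> complete_graph {..<n} E \<and>
       max_degree {..<n} E \<ge> 3 \<and>
       length p \<ge> 2 \<and>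
       int (sum_list p) \<ge> int (max_degree {..<n} E) - int (length p) \<and>
       input n E p \<sigma> \<longrightarrow>
       (\<exists>t \<sigma>'. exec (input_magnitude n E p ^ k) P \<sigma> t \<sigma>' \<and>
          t \<le> c * (n + card E) \<and>
          (\<Union>i<length p. output_part n \<sigma>' i) = {..<n} \<and>
          disjoint_family_on (output_part n \<sigma>') {..<length p} \<and>
          (\<forall>i<length p. degenerate (p ! i) (output_part n \<sigma>' i)
             (induced_edges E (output_part n \<sigma>' i))))"
\<comment> \<open>The exponent 2 is there because positions in \<open>adj\<close> run up to
  \<open>2 * card E\<close>, which may exceed the input magnitude itself.\<close>
proof (rule exI[of _ partition_program], rule exI[of _ 2000], rule exI[of _ 2], intro allI impI, elim conjE)
  fix n :: nat and E :: "nat set set" and p :: "nat list" and \<sigma> :: state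
  assume a: "simple_graph {..<n} E" "connected_graph {..<n} E" "\<not> complete_graph {..<n} E"
    "max_degree {..<n} E \<ge> 3" "length p \<ge> 2" "int (sum_list p) \<ge> int (max_degree {..<n} E) - int (length p)"
    and inp: "input n E p \<sigma>"
  interpret partition_problem n E p by unfold_locales (use a in auto)
  let ?m = "input_magnitude n E p"
  interpret machine n E p "?m ^ 2"
  proof unfold_locales
    \<comment> \<open>Two parts supply the summand 2. As the magnitude is at least 4, its square is
      at least four times itself, which covers the second \<open>card E\<close>.\<close>
    have m: "n + card E + 2 \<le> ?m" "4 \<le> ?m" using a(5) n_ge by (auto simp: input_magnitude_def)
    from mult_le_mono1[OF m(2), of ?m] show "n + 2 * card E + 2 \<le> ?m ^ 2"
      unfolding power2_eq_square using m by linarith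
  qed
  from wp_partition_program[OF inp] obtain t \<tau> where
    t: "exec (?m ^ 2) partition_program \<sigma> t \<tau>" "t \<le> 2000 * (n + card E)" and P: "partial (arr \<tau> ''part'') {..<n}"
    unfolding wp_def by blast
  have part: "output_part n \<tau> i = {v \<in> {..<n}. arr \<tau> ''part'' v = i}" for i by (auto simp: output_part_def)
  have "(\<Union>i<length p. output_part n \<tau> i) = {..<n}" using P by (auto simp: part partial_def)
  moreover have "disjoint_family_on (output_part n \<tau>) {..<length p}" by (auto simp: part disjoint_family_on_def)
  moreover have "degenerate (p ! i) (output_part n \<tau> i) (induced_edges E (output_part n \<tau> i))" if "i < length p" for i
    using P that unfolding part by (intro degenerate_induced) (simp add: partial_def)
  ultimately show "\<exists>t \<sigma>'. exec (?m ^ 2) partition_program \<sigma> t \<sigma>' \<and>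
          t \<le> 2000 * (n + card E) \<and>
          (\<Union>i<length p. output_part n \<sigma>' i) = {..<n} \<and>
          disjoint_family_on (output_part n \<sigma>') {..<length p} \<and>
          (\<forall>i<length p. degenerate (p ! i) (output_part n \<sigma>' i)
             (induced_edges E (output_part n \<sigma>' i)))"
    using t by blast
qed

end
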